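(* There is an algorithm which, given $A$, $c$, a tropical basic point $x^I$ of $\mathcal P(A,b)$ and the associated set $I$, computes the tropical reduced costs $y^I$ (the unique $y\in\mathbb{T}_{\pm}^m$ with $y_i=-\infty$ for $i\notin I$ and $A^T\odot y\,\nabla\,c^T$) in time $O(n(m+n))$, counting each arithmetic operation or comparison in $\mathbb{T}$ as $O(1)$.
   Context: $\mathbb{T}=\mathbb{R}\cup\{-\infty\}$. Signed tropical numbers $\mathbb{T}_{\pm}$: positive numbers $a$ and negative numbers $\ominus a$, $-\infty=\ominus(-\infty)$; modulus $|a|=|\ominus a|=a$; positive part $w^+=|w|$ if $w$ positive else $-\infty$, negative part $w^-=|w|$ if negative else $-\infty$; $x\odot y$ has modulus $|x|+|y|$ and sign the product of signs. $\operatorname{tper}(M)=\max_\sigma\sum_im_{i\sigma(i)}$; $M$ tropically singular if $\operatorname{tper}(M)=-\infty$ or the maximum is attained twice; signed $M$ tropically sign singular if $\operatorname{tper}(|M|)=-\infty$ or two maximizing permutations $\sigma,\pi$ give $\operatorname{sgn}(\sigma)\prod\operatorname{sign}(m_{i\sigma(i)})=-\operatorname{sgn}(\pi)\prod\operatorname{sign}(m_{i\pi(i)})$; tropically (sign) generic: every square submatrix $U$ has $\operatorname{tper}(|U|)=-\infty$ or is not tropically (sign) singular. Setting: $A=(a_{ij})\in\mathbb{T}_{\pm}^{m\times n}$, $b\in\mathbb{T}_{\pm}^m$, $c\in\mathbb{T}^{1\times n}$ (entries regarded as positive signed numbers). Assumptions: each row of $(A\ b)$ has an entry $\neq-\infty$;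 $(A\ b)$ is tropically generic; every point of $\{x\in\mathbb{T}^{n+1}:(A\ b)^+\odot x\ge(A\ b)^-\odot x\}$ other than $(-\infty,\dots,-\infty)$ has finite coordinates; $(A^T\ c^T)$ is tropically sign generic. $\mathcal P(A,b)=\{x\in\mathbb{T}^n:A^+\odot x\oplus b^+\ge A^-\odot x\oplus b^-\}$ ($\oplus=\max$, $(A^\pm\odot x)_i=\max_j(a^\pm_{ij}+x_j)$); for $I\subset[m]$, $|I|=n$, $\operatorname{tper}(|A_I|)>-\infty$, the tropical basic point $x^I$ is the unique point of $\mathcal P(A,b)$ satisfying the inequalities in rows $i\in I$ with equality, when it exists. Balance: $A^T\odot y\,\nabla\,c^T$ means for each $j\in[n]$, among $a_{ij}\odot y_i$ ($i\in[m]$) and $\ominus c_j$, the maximum modulus is $-\infty$ or attained by both a positive and a negative element. *)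

theory Defs
  imports Complex_Main "HOL-Combinatorics.Permutations"
begin

section \<open>Tropical numbers\<close>

datatype trop = NegInf | Fin real

instantiation trop :: "{linorder, order_bot, comm_monoid_add}"
begin

fun less_eq_trop :: "trop \<Rightarrow> trop \<Rightarrow> bool" where
  "less_eq_trop NegInf y = True"
| "less_eq_trop (Fin a) NegInf = False"
| "less_eq_trop (Fin a) (Fin b) = (a \<le> b)"

definition less_trop :: "trop \<Rightarrow> trop \<Rightarrow> bool" where
  "less_trop x y \<longleftrightarrow> x \<le> y \<and> \<not> y \<le> x"

definition bot_trop :: trop where
  "bot_trop = NegInf"

fun plus_trop :: "trop \<Rightarrow> trop \<Rightarrow> trop" where
  "plus_trop (Fin a) (Fin b) = Fin (a + b)"
| "plus_trop NegInf y = NegInf"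
| "plus_trop x NegInf = NegInf"

definition zero_trop :: trop where
  "zero_trop = Fin 0"

instance
proof
  fix x y z :: trop
  show "x < y \<longleftrightarrow> x \<le> y \<and> \<not> y \<le> x" by (simp add: less_trop_def)
  show "x \<le> x" by (cases x) auto
  show "x \<le> y \<Longrightarrow> y \<le> z \<Longrightarrow> x \<le> z" by (cases x; cases y; cases z) auto
  show "x \<le> y \<Longrightarrow> y \<le> x \<Longrightarrow> x = y" by (cases x; cases y) auto
  show "x \<le> y \<or> y \<le> x" by (cases x; cases y) auto
  show "bot \<le> x" by (simp add: bot_trop_def)
  show "x + y + z = x + (y + z)" by (cases x; cases y; cases z) auto
  show "x + y = y + x" by (cases x; cases y) auto
  show "0 + x = x" by (cases x) (auto simp: zero_trop_def)
qed

end

text \<open>Tropical division; dividing by \<open>NegInf\<close> is given the dummy result \<open>NegInf\<close>.\<close>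

fun tdiv :: "trop \<Rightarrow> trop \<Rightarrow> trop" where
  "tdiv (Fin a) (Fin b) = Fin (a - b)"
| "tdiv _ _ = NegInf"


section \<open>Signed tropical numbers\<close>

datatype strop = SNegInf | SPos real | SNeg real

fun modulus :: "strop \<Rightarrow> trop" where
  "modulus SNegInf = NegInf"
| "modulus (SPos a) = Fin a"
| "modulus (SNeg a) = Fin a"

text \<open>The sign of \<open>SNegInf\<close> is immaterial; it is set to 0.\<close>

fun ssgn :: "strop \<Rightarrow> int" where
  "ssgn SNegInf = 0"
| "ssgn (SPos a) = 1"
| "ssgn (SNeg a) = -1"

fun pos_part :: "strop \<Rightarrow> trop" where
  "pos_part (SPos a) = Fin a"
| "pos_part _ = NegInf"

fun neg_part :: "strop \<Rightarrow> trop" where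
  "neg_part (SNeg a) = Fin a"
| "neg_part _ = NegInf"

fun of_trop :: "trop \<Rightarrow> strop" where
  "of_trop NegInf = SNegInf"
| "of_trop (Fin a) = SPos a"

fun sneg :: "strop \<Rightarrow> strop" where
  "sneg SNegInf = SNegInf"
| "sneg (SPos a) = SNeg a"
| "sneg (SNeg a) = SPos a"

fun smult :: "strop \<Rightarrow> strop \<Rightarrow> strop" where
  "smult (SPos a) (SPos b) = SPos (a + b)"
| "smult (SPos a) (SNeg b) = SNeg (a + b)"
| "smult (SNeg a) (SPos b) = SNeg (a + b)"
| "smult (SNeg a) (SNeg b) = SPos (a + b)"
| "smult SNegInf y = SNegInf"
| "smult x SNegInf = SNegInf"


section \<open>Permanents and genericity\<close>

text \<open>
  An \<open>m \<times> n\<close> matrix is a function \<open>M\<close> whose entries are \<open>M i j\<close> for \<open>i < m\<close> and \<open>j < n\<close>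
  (indices start at 0); values outside this range are never used.
\<close>

type_synonym 'a matrix = "nat \<Rightarrow> nat \<Rightarrow> 'a"

definition mod_mat :: "strop matrix \<Rightarrow> trop matrix" where
  "mod_mat M = (\<lambda>i j. modulus (M i j))"

definition tper :: "nat \<Rightarrow> trop matrix \<Rightarrow> trop" where
  "tper k M = Max ((\<lambda>\<sigma>. \<Sum>i<k. M i (\<sigma> i)) ` {\<sigma>. \<sigma> permutes {..<k}})"

definition max_perm :: "nat \<Rightarrow> trop matrix \<Rightarrow> (nat \<Rightarrow> nat) \<Rightarrow> bool" where
  "max_perm k M \<sigma> \<longleftrightarrow> \<sigma> permutes {..<k} \<and> (\<Sum>i<k. M i (\<sigma> i)) = tper k M"

definition trop_singular :: "nat \<Rightarrow> trop matrix \<Rightarrow> bool" where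
  "trop_singular k M \<longleftrightarrow>
     tper k M = NegInf \<or> (\<exists>\<sigma> \<pi>. max_perm k M \<sigma> \<and> max_perm k M \<pi> \<and> \<sigma> \<noteq> \<pi>)"

definition trop_sign_singular :: "nat \<Rightarrow> strop matrix \<Rightarrow> bool" where
  "trop_sign_singular k M \<longleftrightarrow>
     tper k (mod_mat M) = NegInf \<or>
     (\<exists>\<sigma> \<pi>. max_perm k (mod_mat M) \<sigma> \<and> max_perm k (mod_mat M) \<pi> \<and>
        sign \<sigma> * (\<Prod>i<k. ssgn (M i (\<sigma> i))) = - (sign \<pi> * (\<Prod>i<k. ssgn (M i (\<pi> i)))))"

text \<open>\<open>U\<close> is the \<open>k \<times> k\<close> submatrix with rows \<open>r 0 < \<dots> < r (k-1)\<close> and columns \<open>s 0 < \<dots> < s (k-1)\<close>.\<close>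

definition square_submatrix :: "nat \<Rightarrow> nat \<Rightarrow> 'a matrix \<Rightarrow> nat \<Rightarrow> 'a matrix \<Rightarrow> bool" where
  "square_submatrix m n M k U \<longleftrightarrow>
     (\<exists>r s. strict_mono_on {..<k} r \<and> r ` {..<k} \<subseteq> {..<m} \<and>
            strict_mono_on {..<k} s \<and> s ` {..<k} \<subseteq> {..<n} \<and>
            U = (\<lambda>i j. M (r i) (s j)))"

definition trop_generic :: "nat \<Rightarrow> nat \<Rightarrow> strop matrix \<Rightarrow> bool" where
  "trop_generic m n M \<longleftrightarrow>
     (\<forall>k U. square_submatrix m n M k U \<longrightarrow>
        tper k (mod_mat U) = NegInf \<or> \<not> trop_singular k (mod_mat U))"

definition trop_sign_generic :: "nat \<Rightarrow> nat \<Rightarrow> strop matrix \<Rightarrow> bool" where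
  "trop_sign_generic m n M \<longleftrightarrow>
     (\<forall>k U. square_submatrix m n M k U \<longrightarrow>
        tper k (mod_mat U) = NegInf \<or> \<not> trop_sign_singular k U)"


section \<open>Tropical polyhedra, basic points and reduced costs\<close>

definition pos_mat :: "strop matrix \<Rightarrow> trop matrix" where
  "pos_mat M = (\<lambda>i j. pos_part (M i j))"

definition neg_mat :: "strop matrix \<Rightarrow> trop matrix" where
  "neg_mat M = (\<lambda>i j. neg_part (M i j))"

definition tmat_vec :: "nat \<Rightarrow> trop matrix \<Rightarrow> (nat \<Rightarrow> trop) \<Rightarrow> nat \<Rightarrow> trop" where
  "tmat_vec n M x i = Max (insert NegInf ((\<lambda>j. M i j + x j) ` {..<n}))"

text \<open>The matrix \<open>(A b)\<close>, with \<open>b\<close> as column number \<open>n\<close>.\<close>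

definition append_col :: "nat \<Rightarrow> 'a matrix \<Rightarrow> (nat \<Rightarrow> 'a) \<Rightarrow> 'a matrix" where
  "append_col n A b = (\<lambda>i j. if j < n then A i j else b i)"

definition transp :: "'a matrix \<Rightarrow> 'a matrix" where
  "transp A = (\<lambda>j i. A i j)"

definition in_cone :: "nat \<Rightarrow> nat \<Rightarrow> strop matrix \<Rightarrow> (nat \<Rightarrow> trop) \<Rightarrow> bool" where
  "in_cone m n M x \<longleftrightarrow> (\<forall>i<m. tmat_vec n (neg_mat M) x i \<le> tmat_vec n (pos_mat M) x i)"

definition in_polyhedron ::
  "nat \<Rightarrow> nat \<Rightarrow> strop matrix \<Rightarrow> (nat \<Rightarrow> strop) \<Rightarrow> (nat \<Rightarrow> trop) \<Rightarrow> bool" where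
  "in_polyhedron m n A b x \<longleftrightarrow>
     (\<forall>i<m. max (tmat_vec n (neg_mat A) x i) (neg_part (b i))
          \<le> max (tmat_vec n (pos_mat A) x i) (pos_part (b i)))"

definition standing_assumptions ::
  "nat \<Rightarrow> nat \<Rightarrow> strop matrix \<Rightarrow> (nat \<Rightarrow> strop) \<Rightarrow> (nat \<Rightarrow> trop) \<Rightarrow> bool" where
  "standing_assumptions m n A b c \<longleftrightarrow>
     (\<forall>i<m. \<exists>j<n + 1. append_col n A b i j \<noteq> SNegInf) \<and>
     trop_generic m (n + 1) (append_col n A b) \<and>
     (\<forall>x. in_cone m (n + 1) (append_col n A b) x \<longrightarrow> (\<exists>j<n + 1. x j \<noteq> NegInf) \<longrightarrow>
        (\<forall>j<n + 1. x j \<noteq> NegInf)) \<and>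
     trop_sign_generic n (m + 1) (append_col m (transp A) (\<lambda>j. of_trop (c j)))"

definition row_submatrix :: "'a matrix \<Rightarrow> nat set \<Rightarrow> 'a matrix" where
  "row_submatrix A I = (\<lambda>k j. A (sorted_list_of_set I ! k) j)"

definition active_point ::
  "nat \<Rightarrow> nat \<Rightarrow> strop matrix \<Rightarrow> (nat \<Rightarrow> strop) \<Rightarrow> nat set \<Rightarrow> (nat \<Rightarrow> trop) \<Rightarrow> bool" where
  "active_point m n A b I x \<longleftrightarrow>
     in_polyhedron m n A b x \<and>
     (\<forall>i\<in>I. max (tmat_vec n (pos_mat A) x i) (pos_part (b i))
          = max (tmat_vec n (neg_mat A) x i) (neg_part (b i)))"

text \<open>\<open>basic_point m n A b I x\<close>: the tropical basic point of \<open>I\<close> exists and is \<open>x\<close>.\<close>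

definition basic_point ::
  "nat \<Rightarrow> nat \<Rightarrow> strop matrix \<Rightarrow> (nat \<Rightarrow> strop) \<Rightarrow> nat set \<Rightarrow> (nat \<Rightarrow> trop) \<Rightarrow> bool" where
  "basic_point m n A b I x \<longleftrightarrow>
     I \<subseteq> {..<m} \<and> card I = n \<and> tper n (mod_mat (row_submatrix A I)) > NegInf \<and>
     active_point m n A b I x \<and>
     (\<forall>x'. active_point m n A b I x' \<longrightarrow> (\<forall>j<n. x' j = x j))"

definition balanced_set :: "strop set \<Rightarrow> bool" where
  "balanced_set E \<longleftrightarrow>
     Max (modulus ` E) = NegInf \<or>
     (\<exists>e\<in>E. ssgn e = 1 \<and> modulus e = Max (modulus ` E)) \<and>
     (\<exists>e\<in>E. ssgn e = -1 \<and> modulus e = Max (modulus ` E))"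

text \<open>The relation \<open>A\<^sup>T \<odot> y \<nabla> c\<^sup>T\<close>.\<close>

definition dual_balance ::
  "nat \<Rightarrow> nat \<Rightarrow> strop matrix \<Rightarrow> (nat \<Rightarrow> strop) \<Rightarrow> (nat \<Rightarrow> trop) \<Rightarrow> bool" where
  "dual_balance m n A y c \<longleftrightarrow>
     (\<forall>j<n. balanced_set (insert (sneg (of_trop (c j))) ((\<lambda>i. smult (A i j) (y i)) ` {..<m})))"

definition is_reduced_costs ::
  "nat \<Rightarrow> nat \<Rightarrow> strop matrix \<Rightarrow> (nat \<Rightarrow> trop) \<Rightarrow> nat set \<Rightarrow> (nat \<Rightarrow> strop) \<Rightarrow> bool" where
  "is_reduced_costs m n A c I y \<longleftrightarrow> (\<forall>i. i \<notin> I \<longrightarrow> y i = SNegInf) \<and> dual_balance m n A y c"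

definition reduced_costs ::
  "nat \<Rightarrow> nat \<Rightarrow> strop matrix \<Rightarrow> (nat \<Rightarrow> trop) \<Rightarrow> nat set \<Rightarrow> nat \<Rightarrow> strop" where
  "reduced_costs m n A c I = (THE y. is_reduced_costs m n A c I y)"


section \<open>A unit-cost random access machine over the tropical numbers\<close>

text \<open>
  Algorithms are while-programs over two kinds of data: natural numbers, used as indices, counters
  and flags, and tropical numbers. Both kinds have scalar variables and arrays (one-dimensional for
  naturals, two-dimensional for tropical numbers). Natural numbers can be added, subtracted
  (truncated at 0) and compared but not multiplied; tropical numbers can be added, subtracted
  (\<open>tdiv\<close>), maximised and compared. There is no conversion between the two kinds, and the only
  tropical literals are \<open>NegInf\<close> and \<open>0\<close>. Every literal, variable or array access, operation,
  comparison, connective, assignment, branch and loop test costs one unit, whatever the size of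
  the operands.
\<close>

datatype iexp =
    ILit nat
  | IVar string
  | IArr string iexp
  | IAdd iexp iexp
  | ISub iexp iexp

datatype texp =
    TNegInf
  | TZero
  | TVar string
  | TArr string iexp iexp
  | TAdd texp texp
  | TDiv texp texp
  | TMax texp texp

datatype bexp =
    ILess iexp iexp
  | TLess texp texp
  | BNot bexp
  | BAnd bexp bexp

datatype com =
    Skip
  | IAssign string iexp
  | IStore string iexp iexp
  | TAssign string texp
  | TStore string iexp iexp texp
  | Seq com com
  | Cond bexp com com
  | While bexp com

record state =
  ivar :: "string \<Rightarrow> nat"
  iarr :: "string \<Rightarrow> nat \<Rightarrow> nat"
  tvar :: "string \<Rightarrow> trop"
  tarr :: "string \<Rightarrow> nat \<Rightarrow> nat \<Rightarrow> trop"

fun ival :: "iexp \<Rightarrow> state \<Rightarrow> nat" where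
  "ival (ILit k) s = k"
| "ival (IVar v) s = ivar s v"
| "ival (IArr a e) s = iarr s a (ival e s)"
| "ival (IAdd e f) s = ival e s + ival f s"
| "ival (ISub e f) s = ival e s - ival f s"

fun tval :: "texp \<Rightarrow> state \<Rightarrow> trop" where
  "tval TNegInf s = NegInf"
| "tval TZero s = 0"
| "tval (TVar v) s = tvar s v"
| "tval (TArr a e f) s = tarr s a (ival e s) (ival f s)"
| "tval (TAdd e f) s = tval e s + tval f s"
| "tval (TDiv e f) s = tdiv (tval e s) (tval f s)"
| "tval (TMax e f) s = max (tval e s) (tval f s)"

fun bval :: "bexp \<Rightarrow> state \<Rightarrow> bool" where
  "bval (ILess e f) s \<longleftrightarrow> ival e s < ival f s"
| "bval (TLess e f) s \<longleftrightarrow> tval e s < tval f s"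
| "bval (BNot b) s \<longleftrightarrow> \<not> bval b s"
| "bval (BAnd b d) s \<longleftrightarrow> bval b s \<and> bval d s"

fun icost :: "iexp \<Rightarrow> nat" where
  "icost (ILit k) = 1"
| "icost (IVar v) = 1"
| "icost (IArr a e) = icost e + 1"
| "icost (IAdd e f) = icost e + icost f + 1"
| "icost (ISub e f) = icost e + icost f + 1"

fun tcost :: "texp \<Rightarrow> nat" where
  "tcost TNegInf = 1"
| "tcost TZero = 1"
| "tcost (TVar v) = 1"
| "tcost (TArr a e f) = icost e + icost f + 1"
| "tcost (TAdd e f) = tcost e + tcost f + 1"
| "tcost (TDiv e f) = tcost e + tcost f + 1"
| "tcost (TMax e f) = tcost e + tcost f + 1"

fun bcost :: "bexp \<Rightarrow> nat" where
  "bcost (ILess e f) = icost e + icost f + 1"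
| "bcost (TLess e f) = tcost e + tcost f + 1"
| "bcost (BNot b) = bcost b + 1"
| "bcost (BAnd b d) = bcost b + bcost d + 1"

text \<open>\<open>exec p s t s'\<close>: started in \<open>s\<close>, the program \<open>p\<close> halts in \<open>s'\<close> after \<open>t\<close> time units.\<close>

inductive exec :: "com \<Rightarrow> state \<Rightarrow> nat \<Rightarrow> state \<Rightarrow> bool" where
  Skip: "exec Skip s 1 s"
| IAssign: "exec (IAssign v e) s (icost e + 1) (s\<lparr>ivar := (ivar s)(v := ival e s)\<rparr>)"
| IStore: "exec (IStore a e f) s (icost e + icost f + 1)
    (s\<lparr>iarr := (iarr s)(a := (iarr s a)(ival e s := ival f s))\<rparr>)"
| TAssign: "exec (TAssign v e) s (tcost e + 1) (s\<lparr>tvar := (tvar s)(v := tval e s)\<rparr>)"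
| TStore: "exec (TStore a e f g) s (icost e + icost f + tcost g + 1)
    (s\<lparr>tarr := (tarr s)(a := (tarr s a)(ival e s := (tarr s a (ival e s))(ival f s := tval g s)))\<rparr>)"
| Seq: "exec p s t s' \<Longrightarrow> exec q s' u s'' \<Longrightarrow> exec (Seq p q) s (t + u) s''"
| CondTrue: "bval b s \<Longrightarrow> exec p s t s' \<Longrightarrow> exec (Cond b p q) s (bcost b + t + 1) s'"
| CondFalse: "\<not> bval b s \<Longrightarrow> exec q s t s' \<Longrightarrow> exec (Cond b p q) s (bcost b + t + 1) s'"
| WhileFalse: "\<not> bval b s \<Longrightarrow> exec (While b p) s (bcost b + 1) s"
| WhileTrue: "bval b s \<Longrightarrow> exec p s t s' \<Longrightarrow> exec (While b p) s' u s'' \<Longrightarrow>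
    exec (While b p) s (bcost b + t + u + 1) s''"

inductive_cases exec_elims:
  "exec Skip s t s'"
  "exec (IAssign v e) s t s'"
  "exec (IStore a e f) s t s'"
  "exec (TAssign v e) s t s'"
  "exec (TStore a e f g) s t s'"
  "exec (Seq p q) s t s'"
  "exec (Cond b p q) s t s'"
  "exec (While b p) s t s'"

lemma exec_deterministic:
  "exec p s t s' \<Longrightarrow> exec p s u s'' \<Longrightarrow> u = t \<and> s'' = s'"
proof (induction arbitrary: u s'' rule: exec.induct)
  case (Seq p s t s' q v s2)
  from Seq.prems show ?case
  proof (rule exec_elims(6))
    fix t' r u' assume *: "u = t' + u'" "exec p s t' r" "exec q r u' s''"
    from Seq.IH(1)[OF *(2)] Seq.IH(2)[of u' s''] * show ?thesis by simp
  qed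
next
  case (CondTrue b s p t s' q)
  from CondTrue.prems show ?case
  proof (rule exec_elims(7))
    fix t' assume *: "u = Suc (bcost b + t')" "exec p s t' s''"
    from CondTrue.IH[OF *(2)] * show ?thesis by simp
  qed (use CondTrue.hyps in simp)
next
  case (CondFalse b s q t s' p)
  from CondFalse.prems show ?case
  proof (rule exec_elims(7))
    fix t' assume *: "u = Suc (bcost b + t')" "exec q s t' s''"
    from CondFalse.IH[OF *(2)] * show ?thesis by simp
  qed (use CondFalse.hyps in simp)
next
  case (WhileFalse b s p)
  from WhileFalse.prems show ?case
    by (rule exec_elims(8)) (use WhileFalse.hyps in simp_all)
next
  case (WhileTrue b s p t s' v s2)
  from WhileTrue.prems show ?case
  proof (rule exec_elims(8))
    fix t' r u' assume *: "u = Suc (bcost b + t' + u')" "exec p s t' r" "exec (While b p) r u' s''"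
    from WhileTrue.IH(1)[OF *(2)] WhileTrue.IH(2)[of u' s''] * show ?thesis by simp
  qed (use WhileTrue.hyps in simp)
qed (erule exec_elims(1-5); simp)+

text \<open>
  A signed tropical number is stored as the pair of its positive and negative parts, so a signed
  matrix takes two arrays. The set \<open>I\<close> is given by its indicator vector. All memory not holding
  the input is arbitrary, and \<open>b\<close> is not part of the input.
\<close>

definition holds_input ::
  "nat \<Rightarrow> nat \<Rightarrow> strop matrix \<Rightarrow> (nat \<Rightarrow> trop) \<Rightarrow> (nat \<Rightarrow> trop) \<Rightarrow> nat set \<Rightarrow> state \<Rightarrow> bool" where
  "holds_input m n A c x I s \<longleftrightarrow>
     ivar s ''m'' = m \<and> ivar s ''n'' = n \<and>
     (\<forall>i<m. \<forall>j<n. tarr s ''A+'' i j = pos_part (A i j) \<and> tarr s ''A-'' i j = neg_part (A i j)) \<and>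
     (\<forall>j<n. tarr s ''c'' 0 j = c j) \<and>
     (\<forall>j<n. tarr s ''x'' 0 j = x j) \<and>
     (\<forall>i<m. iarr s ''I'' i = (if i \<in> I then 1 else 0))"

definition holds_output :: "nat \<Rightarrow> (nat \<Rightarrow> strop) \<Rightarrow> state \<Rightarrow> bool" where
  "holds_output m y s \<longleftrightarrow>
     (\<forall>i<m. tarr s ''y+'' 0 i = pos_part (y i) \<and> tarr s ''y-'' 0 i = neg_part (y i))"

end

theory Submission
  imports Defs "HOL-Combinatorics.Cycles"
begin

text \<open>
  Put \<open>v\<^sub>i = max\<^sub>j (|a\<^sub>i\<^sub>j| + x\<^sub>j)\<close>. The graph of the pairs attaining these maxima over \<open>(A b)\<close> has no
  cycle, since a cycle would give a submatrix with two maximal permutations, while every row in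
  \<open>I\<close> has degree at least two. Hence rows can be peeled off one at a time, each matched to the only
  unmatched column at which it is tight. The potentials \<open>x, v\<close> turn the balance relations into a
  longest path problem with nonpositive weights, solved by Dijkstra's algorithm; the signs are
  propagated along the path tree.

  For uniqueness, sign genericity excludes cycles of tight terms of alternating sign. This forces
  the matched term of every row to be maximal and every maximal term of opposite sign to lead to
  \<open>c\<close> after finitely many steps, which determines the moduli; the sign of an unknown is then a
  signed permutation product, as in Cramer's rule.
\<close>

section \<open>Arithmetic of (signed) tropical numbers\<close>

text \<open>The time bound leaves no room for solving an assignment problem from scratch. The basic
  point pays for it: \<open>x\<close> and \<open>v\<close> are dual variables of the assignment
  problem for |A| on the rows of \<open>I\<close>, so an optimal assignment \<open>\<rho>\<close>
  can be read off from tight entries. Relation \<open>j\<close> of the balance system is then used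
  to determine the unknown of row \<open>\<rho> j\<close>. Once \<open>x j\<close> is added to the
  moduli of relation \<open>j\<close>, passing from column \<open>k\<close> to column
  \<open>j\<close> adds the modulus of \<open>A (\<rho> k) j\<close> plus \<open>x j\<close> minus
  \<open>v (\<rho> k)\<close>, which is at most 0. This is why the largest key is final when it is
  chosen. The two genericity assumptions act separately: the one on (A b) gives the matching, the
  one on the transposed A with c gives uniqueness. Both enter through one combinatorial fact: if
  each row of a nonempty set has two tight entries within at most as many columns as there are rows,
  these entries contain a cycle, and the two perfect matchings of the cycle are two maximal
  permutations of one submatrix. Existence of \<open>y\<close> is obtained from the invariant of the
  program, not from a separate argument.\<close>

instance trop :: ordered_comm_monoid_add
proof
  fix a b c :: trop
  show "a \<le> b \<Longrightarrow> c + a \<le> c + b"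
    by (cases a; cases b; cases c) auto
qed

lemma NegInf_le [simp]: "NegInf \<le> a"
  by simp

lemma le_NegInf_iff [simp]: "a \<le> NegInf \<longleftrightarrow> a = NegInf"
  by (cases a) auto

lemma add_NegInf [simp]: "a + NegInf = NegInf"
  by (cases a) auto

lemma NegInf_less_iff [simp]: "NegInf < a \<longleftrightarrow> a \<noteq> NegInf"
  by (cases a) (auto simp: less_trop_def)

lemma max_NegInf [simp]: "max NegInf a = a" "max a NegInf = a"
  by (auto simp: max_def)

lemma add_eq_NegInf_iff [simp]: "a + b = NegInf \<longleftrightarrow> a = NegInf \<or> b = NegInf"
  for a b :: trop
  by (cases a; cases b) auto

lemma sum_eq_NegInf_iff: "finite S \<Longrightarrow> sum f S = NegInf \<longleftrightarrow> (\<exists>i\<in>S. f i = NegInf)"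
  for f :: "'a \<Rightarrow> trop"
  by (induction S rule: finite_induct) (auto simp: zero_trop_def)

lemma add_le_cancel_right_trop: "c \<noteq> NegInf \<Longrightarrow> a + c \<le> b + c \<longleftrightarrow> a \<le> b"
  for a b c :: trop
  by (cases a; cases b; cases c) auto

lemma modulus_eq_NegInf_iff [simp]: "modulus a = NegInf \<longleftrightarrow> a = SNegInf"
  by (cases a) auto

lemma ssgn_eq_0_iff [simp]: "ssgn a = 0 \<longleftrightarrow> a = SNegInf"
  by (cases a) auto

lemma modulus_smult [simp]: "modulus (smult a b) = modulus a + modulus b"
  by (cases a; cases b) auto

lemma ssgn_smult [simp]: "ssgn (smult a b) = ssgn a * ssgn b"
  by (cases a; cases b) auto

lemma modulus_sneg [simp]: "modulus (sneg a) = modulus a"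
  by (cases a) auto

lemma ssgn_sneg [simp]: "ssgn (sneg a) = - ssgn a"
  by (cases a) auto

lemma modulus_of_trop [simp]: "modulus (of_trop a) = a"
  by (cases a) auto

lemma strop_eqI: "modulus a = modulus b \<Longrightarrow> ssgn a = ssgn b \<Longrightarrow> a = b"
  by (cases a; cases b) auto

lemma ssgn_square: "a \<noteq> SNegInf \<Longrightarrow> ssgn a * ssgn a = 1"
  by (cases a) auto

section \<open>Tight permutations of submatrices\<close>

lemma max_permI:
  assumes "\<sigma> permutes {..<k}"
    and "\<And>\<pi>. \<pi> permutes {..<k} \<Longrightarrow> (\<Sum>i<k. M i (\<pi> i)) \<le> (\<Sum>i<k. M i (\<sigma> i))"
  shows "max_perm k M \<sigma>"
proof -
  have "tper k M = (\<Sum>i<k. M i (\<sigma> i))"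
    unfolding tper_def
    by (rule Max_eqI) (use assms in \<open>auto simp: finite_permutations\<close>)
  then show ?thesis
    using assms(1) by (simp add: max_perm_def)
qed

text \<open>Genericity speaks of increasing enumerations of rows and columns, whereas the later
  arguments produce a set \<open>R\<close>, a set \<open>U\<close> and a bijection \<open>h\<close>
  in arbitrary order. \<open>\<Phi>\<close> translates permutations of \<open>R\<close> into
  permutations of indices. Reordering costs a sign \<open>\<epsilon>\<close> that does not depend on
  \<open>\<sigma>\<close>, so comparing signs of two permutations remains possible.\<close>

lemma submatrix_permutations:
  fixes R U :: "nat set"
  assumes R: "R \<subseteq> {..<nr}" and U: "U \<subseteq> {..<nc}" and h: "bij_betw h R U"
  obtains r s \<Phi> \<epsilon> where
    "strict_mono_on {..<card R} r" "bij_betw r {..<card R} R"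
    "strict_mono_on {..<card R} s" "bij_betw s {..<card R} U"
    "\<epsilon> = 1 \<or> \<epsilon> = - 1"
    "\<And>\<sigma>. \<sigma> permutes R \<Longrightarrow> \<Phi> \<sigma> permutes {..<card R}"
    "\<And>\<sigma>. \<sigma> permutes R \<Longrightarrow> sign (\<Phi> \<sigma>) = \<epsilon> * sign \<sigma>"
    "\<And>\<sigma> i. \<sigma> permutes R \<Longrightarrow> i < card R \<Longrightarrow> s (\<Phi> \<sigma> i) = h (\<sigma> (r i))"
proof -
  have fin: "finite R" "finite U"
    using R U finite_subset by blast+
  define k where "k = card R"
  have kU: "card U = k"
    using bij_betw_same_card[OF h] k_def by simp
  define r where "r = (!) (sorted_list_of_set R)"
  define s where "s = (!) (sorted_list_of_set U)"
  have enum: "strict_mono_on {..<card S} ((!) (sorted_list_of_set S))"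
    "bij_betw ((!) (sorted_list_of_set S)) {..<card S} S" if "finite S" for S :: "nat set"
  proof -
    show "strict_mono_on {..<card S} ((!) (sorted_list_of_set S))"
      using that strict_sorted_list_of_set[of S]
      by (auto simp: monotone_on_def sorted_wrt_iff_nth_less)
    show "bij_betw ((!) (sorted_list_of_set S)) {..<card S} S"
      by (rule bij_betw_nth) (use that in auto)
  qed
  have r: "strict_mono_on {..<k} r" "bij_betw r {..<k} R"
    using enum[OF fin(1)] by (auto simp: r_def k_def)
  have s: "strict_mono_on {..<k} s" "bij_betw s {..<k} U"
    using enum[OF fin(2)] by (auto simp: s_def kU)
  \<comment> \<open>\<open>h0\<close> is \<open>h\<close> read in the two sorted enumerations; its
    sign is the factor \<open>\<epsilon>\<close>, and \<open>\<Phi> \<sigma>\<close> is the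
    conjugate of \<open>\<sigma>\<close> by the enumeration of \<open>R\<close>, followed by
    \<open>h0\<close>.\<close>
  define h0 where "h0 = restrict_id (inv_into {..<k} s \<circ> h \<circ> r) {..<k}"
  have h0: "h0 permutes {..<k}"
  proof (rule bij_imp_permutes)
    have "bij_betw (inv_into {..<k} s \<circ> (h \<circ> r)) {..<k} {..<k}"
      using bij_betw_trans[OF bij_betw_trans[OF r(2) h] bij_betw_inv_into[OF s(2)]] .
    then show "bij_betw h0 {..<k} {..<k}"
      by (subst bij_betw_cong[where g = "inv_into {..<k} s \<circ> (h \<circ> r)"]) (auto simp: h0_def)
  qed (auto simp: h0_def)
  have sh0: "s (h0 i) = h (r i)" if "i < k" for i
  proof -
    have "h (r i) \<in> U"
      using that h r(2) by (auto simp: bij_betw_def)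
    then show ?thesis
      using that s(2) by (auto simp: h0_def bij_betw_def f_inv_into_f)
  qed
  define q where "q = inv_into {..<k} r"
  have q: "bij_betw q R {..<k}"
    unfolding q_def by (rule bij_betw_inv_into[OF r(2)])
  define \<Phi> where "\<Phi> = (\<lambda>\<sigma>. h0 \<circ> map_permutation R q \<sigma>)"
  have mp: "map_permutation R q \<sigma> permutes {..<k}" if "\<sigma> permutes R" for \<sigma>
    by (rule map_permutation_permutes[OF q that])
  have fin_k: "finite {..<k}"
    by simp
  show ?thesis
  proof (rule that)
    show "sign h0 = 1 \<or> sign h0 = - 1"
      by (cases h0 rule: sign_cases) auto
    show "\<Phi> \<sigma> permutes {..<card R}" if "\<sigma> permutes R" for \<sigma>
      using permutes_compose[OF mp[OF that] h0] by (simp add: \<Phi>_def k_def)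
    show "sign (\<Phi> \<sigma>) = sign h0 * sign \<sigma>" if "\<sigma> permutes R" for \<sigma>
      unfolding \<Phi>_def
      by (subst sign_compose)
        (use permutes_imp_permutation[OF fin_k h0] permutes_imp_permutation[OF fin_k mp[OF that]]
           sign_map_permutation[of q R \<sigma>] q that fin in \<open>auto simp: bij_betw_def\<close>)
    show "s (\<Phi> \<sigma> i) = h (\<sigma> (r i))" if "\<sigma> permutes R" "i < card R" for \<sigma> i
    proof -
      have i: "i < k" "r i \<in> R"
        using that r(2) by (auto simp: k_def bij_betw_def)
      have qr: "q (r i) = i"
        using i r(2) by (auto simp: q_def bij_betw_def)
      have "map_permutation R q \<sigma> (q (r i)) = q (\<sigma> (r i))"
        by (rule map_permutation_apply) (use q i in \<open>auto simp: bij_betw_def\<close>)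
      then have "map_permutation R q \<sigma> i = q (\<sigma> (r i))"
        by (simp add: qr)
      moreover have "\<sigma> (r i) \<in> R"
        using i that(1) by (simp add: permutes_in_image)
      moreover have "r (q (\<sigma> (r i))) = \<sigma> (r i)"
        using \<open>\<sigma> (r i) \<in> R\<close> r(2) by (simp add: q_def bij_betw_def f_inv_into_f)
      moreover have "q (\<sigma> (r i)) < k"
        using \<open>\<sigma> (r i) \<in> R\<close> q by (auto simp: bij_betw_def)
      ultimately show ?thesis
        by (simp add: \<Phi>_def sh0)
    qed
  qed (use r s k_def in auto)
qed

text \<open>Weak duality for the assignment problem: \<open>T\<close> and \<open>z\<close> bound the
  weight of every permutation by the sum of \<open>T\<close> minus the sum of \<open>z\<close>, and
  a permutation through tight entries attains the bound. The estimate is kept additive, with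
  \<open>z\<close> on the left, and the finite sum of \<open>z\<close> is cancelled at the
  end.\<close>

lemma tight_permutations:
  fixes M :: "strop matrix"
  assumes R: "R \<subseteq> {..<nr}" and U: "U \<subseteq> {..<nc}" and h: "bij_betw h R U"
    and fin: "\<And>r. r \<in> R \<Longrightarrow> T r \<noteq> NegInf" "\<And>u. u \<in> U \<Longrightarrow> z u \<noteq> NegInf"
    and le: "\<And>r u. r \<in> R \<Longrightarrow> u \<in> U \<Longrightarrow> modulus (M r u) + z u \<le> T r"
  obtains k W \<Phi> \<epsilon> where
    "square_submatrix nr nc M k W" "\<epsilon> = 1 \<or> \<epsilon> = - 1" "inj_on \<Phi> {\<sigma>. \<sigma> permutes R}"
    "\<And>\<sigma>. \<sigma> permutes R \<Longrightarrow> sign (\<Phi> \<sigma>) * (\<Prod>i<k. ssgn (W i (\<Phi> \<sigma> i)))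
       = \<epsilon> * (sign \<sigma> * (\<Prod>r\<in>R. ssgn (M r (h (\<sigma> r)))))"
    "\<And>\<sigma>. \<sigma> permutes R \<Longrightarrow> (\<And>r. r \<in> R \<Longrightarrow> modulus (M r (h (\<sigma> r))) + z (h (\<sigma> r)) = T r) \<Longrightarrow>
       max_perm k (mod_mat W) (\<Phi> \<sigma>) \<and> tper k (mod_mat W) \<noteq> NegInf"
proof -
  have finR: "finite R" and finU: "finite U"
    using R U finite_subset by blast+
  obtain r s \<Phi> \<epsilon> where
    r: "strict_mono_on {..<card R} r" "bij_betw r {..<card R} R" and
    s: "strict_mono_on {..<card R} s" "bij_betw s {..<card R} U" and
    \<epsilon>: "\<epsilon> = 1 \<or> \<epsilon> = - 1" and
    \<Phi>: "\<And>\<sigma>. \<sigma> permutes R \<Longrightarrow> \<Phi> \<sigma> permutes {..<card R}"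
      "\<And>\<sigma>. \<sigma> permutes R \<Longrightarrow> sign (\<Phi> \<sigma>) = \<epsilon> * sign \<sigma>"
      "\<And>\<sigma> i. \<sigma> permutes R \<Longrightarrow> i < card R \<Longrightarrow> s (\<Phi> \<sigma> i) = h (\<sigma> (r i))"
    by (rule submatrix_permutations[OF R U h]) blast
  define k where "k = card R"
  define W where "W = (\<lambda>i j. M (r i) (s j))"
  have sum_z: "(\<Sum>i<k. z (s (\<pi> i))) = sum z U" if "\<pi> permutes {..<k}" for \<pi>
    using sum.reindex_bij_betw[OF bij_betw_trans[OF permutes_imp_bij[OF that] s(2)[folded k_def]], of z]
    by simp
  have sum_T: "(\<Sum>i<k. T (r i)) = sum T R"
    using sum.reindex_bij_betw[OF r(2)[folded k_def], of T] by simp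
  have zfin: "sum z U \<noteq> NegInf"
    using fin(2) finU by (simp add: sum_eq_NegInf_iff)
  have Tfin: "sum T R \<noteq> NegInf"
    using fin(1) finR by (simp add: sum_eq_NegInf_iff)
  show ?thesis
  proof (rule that)
    show "square_submatrix nr nc M k W"
      unfolding square_submatrix_def W_def k_def
      using r s R U by (intro exI[of _ r] exI[of _ s]) (auto simp: bij_betw_def)
    show "\<epsilon> = 1 \<or> \<epsilon> = - 1"
      by fact
    show "inj_on \<Phi> {\<sigma>. \<sigma> permutes R}"
    proof (rule inj_onI, clarsimp)
      fix \<sigma> \<pi> assume perm: "\<sigma> permutes R" "\<pi> permutes R" and eq: "\<Phi> \<sigma> = \<Phi> \<pi>"
      show "\<sigma> = \<pi>"
      proof
        fix x show "\<sigma> x = \<pi> x"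
        proof (cases "x \<in> R")
          case True
          then obtain i where i: "i < card R" "x = r i"
            using r(2) by (auto simp: bij_betw_def)
          have "h (\<sigma> x) = h (\<pi> x)"
            using \<Phi>(3)[OF perm(1) i(1)] \<Phi>(3)[OF perm(2) i(1)] eq i by simp
          then show ?thesis
            using h True perm by (auto simp: bij_betw_def inj_on_def permutes_in_image)
        next
          case False
          then show ?thesis using perm by (simp add: permutes_not_in)
        qed
      qed
    qed
    show "sign (\<Phi> \<sigma>) * (\<Prod>i<k. ssgn (W i (\<Phi> \<sigma> i)))
       = \<epsilon> * (sign \<sigma> * (\<Prod>r\<in>R. ssgn (M r (h (\<sigma> r)))))" if "\<sigma> permutes R" for \<sigma>
    proof -
      have "(\<Prod>i<k. ssgn (W i (\<Phi> \<sigma> i))) = (\<Prod>i<k. ssgn (M (r i) (h (\<sigma> (r i)))))"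
        by (rule prod.cong) (auto simp: W_def k_def \<Phi>(3)[OF that])
      also have "\<dots> = (\<Prod>r\<in>R. ssgn (M r (h (\<sigma> r))))"
        using prod.reindex_bij_betw[OF r(2)[folded k_def], of "\<lambda>r. ssgn (M r (h (\<sigma> r)))"] by simp
      finally show ?thesis
        by (simp add: \<Phi>(2)[OF that])
    qed
    show "max_perm k (mod_mat W) (\<Phi> \<sigma>) \<and> tper k (mod_mat W) \<noteq> NegInf"
      if perm: "\<sigma> permutes R"
        and tight: "\<And>r. r \<in> R \<Longrightarrow> modulus (M r (h (\<sigma> r))) + z (h (\<sigma> r)) = T r" for \<sigma>
    proof -
      have rR: "r i \<in> R" if "i < k" for i
        using that r(2) by (auto simp: k_def bij_betw_def)
      have "(\<Sum>i<k. mod_mat W i (\<Phi> \<sigma> i)) + sum z U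
          = (\<Sum>i<k. mod_mat W i (\<Phi> \<sigma> i) + z (s (\<Phi> \<sigma> i)))"
        using sum_z[OF \<Phi>(1)[OF perm, folded k_def]] by (simp add: sum.distrib)
      also have "\<dots> = (\<Sum>i<k. T (r i))"
        by (rule sum.cong) (auto simp: mod_mat_def W_def k_def \<Phi>(3)[OF perm] intro!: tight rR[unfolded k_def])
      finally have eq: "(\<Sum>i<k. mod_mat W i (\<Phi> \<sigma> i)) + sum z U = sum T R"
        using sum_T by simp
      have "(\<Sum>i<k. mod_mat W i (\<pi> i)) \<le> (\<Sum>i<k. mod_mat W i (\<Phi> \<sigma> i))"
        if \<pi>: "\<pi> permutes {..<k}" for \<pi>
      proof -
        have "(\<Sum>i<k. mod_mat W i (\<pi> i)) + sum z U = (\<Sum>i<k. mod_mat W i (\<pi> i) + z (s (\<pi> i)))"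
          using sum_z[OF \<pi>] by (simp add: sum.distrib)
        also have "\<dots> \<le> (\<Sum>i<k. T (r i))"
        proof (rule sum_mono)
          fix i assume "i \<in> {..<k}"
          moreover from this have "s (\<pi> i) \<in> U"
            using s(2) permutes_in_image[OF \<pi>, of i] by (auto simp: bij_betw_def k_def)
          ultimately show "mod_mat W i (\<pi> i) + z (s (\<pi> i)) \<le> T (r i)"
            by (auto simp: mod_mat_def W_def intro!: le rR)
        qed
        finally show ?thesis
          using eq sum_T zfin by (metis add_le_cancel_right_trop)
      qed
      then have mp: "max_perm k (mod_mat W) (\<Phi> \<sigma>)"
        using \<Phi>(1)[OF perm] by (intro max_permI) (auto simp: k_def)
      moreover have "tper k (mod_mat W) \<noteq> NegInf"
        using mp eq Tfin by (auto simp: max_perm_def)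
      ultimately show ?thesis by simp
    qed
  qed
qed

lemma generic_tight_unique:
  fixes M :: "strop matrix"
  assumes gen: "trop_generic nr nc M"
    and R: "R \<subseteq> {..<nr}" and U: "U \<subseteq> {..<nc}" and h: "bij_betw h R U"
    and fin: "\<And>r. r \<in> R \<Longrightarrow> T r \<noteq> NegInf" "\<And>u. u \<in> U \<Longrightarrow> z u \<noteq> NegInf"
    and le: "\<And>r u. r \<in> R \<Longrightarrow> u \<in> U \<Longrightarrow> modulus (M r u) + z u \<le> T r"
    and \<sigma>: "\<sigma> permutes R" "\<And>r. r \<in> R \<Longrightarrow> modulus (M r (h (\<sigma> r))) + z (h (\<sigma> r)) = T r"
    and \<pi>: "\<pi> permutes R" "\<And>r. r \<in> R \<Longrightarrow> modulus (M r (h (\<pi> r))) + z (h (\<pi> r)) = T r"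
  shows "\<sigma> = \<pi>"
proof -
  obtain k W \<Phi> \<epsilon> where W: "square_submatrix nr nc M k W" and inj: "inj_on \<Phi> {\<sigma>. \<sigma> permutes R}"
    and mp: "\<And>\<sigma>. \<sigma> permutes R \<Longrightarrow>
      (\<And>r. r \<in> R \<Longrightarrow> modulus (M r (h (\<sigma> r))) + z (h (\<sigma> r)) = T r) \<Longrightarrow>
       max_perm k (mod_mat W) (\<Phi> \<sigma>) \<and> tper k (mod_mat W) \<noteq> NegInf"
    by (rule tight_permutations[OF R U h fin le]) blast+
  have "\<not> trop_singular k (mod_mat W)"
    using gen W mp[OF \<sigma>] by (auto simp: trop_generic_def)
  then have "\<Phi> \<sigma> = \<Phi> \<pi>"
    using mp[OF \<sigma>] mp[OF \<pi>] by (auto simp: trop_singular_def)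
  then show ?thesis
    using inj \<sigma>(1) \<pi>(1) by (auto dest: inj_onD)
qed

text \<open>Both permutations are maximal in the same submatrix, and their signed products there
  differ from those over \<open>R\<close> only by the common factor
  \<open>\<epsilon>\<close>.\<close>

lemma sign_generic_tight_sign:
  fixes M :: "strop matrix"
  assumes gen: "trop_sign_generic nr nc M"
    and R: "R \<subseteq> {..<nr}" and U: "U \<subseteq> {..<nc}" and h: "bij_betw h R U"
    and fin: "\<And>r. r \<in> R \<Longrightarrow> T r \<noteq> NegInf" "\<And>u. u \<in> U \<Longrightarrow> z u \<noteq> NegInf"
    and le: "\<And>r u. r \<in> R \<Longrightarrow> u \<in> U \<Longrightarrow> modulus (M r u) + z u \<le> T r"
    and \<sigma>: "\<sigma> permutes R" "\<And>r. r \<in> R \<Longrightarrow> modulus (M r (h (\<sigma> r))) + z (h (\<sigma> r)) = T r"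
    and \<pi>: "\<pi> permutes R" "\<And>r. r \<in> R \<Longrightarrow> modulus (M r (h (\<pi> r))) + z (h (\<pi> r)) = T r"
  shows "sign \<sigma> * (\<Prod>r\<in>R. ssgn (M r (h (\<sigma> r)))) \<noteq> - (sign \<pi> * (\<Prod>r\<in>R. ssgn (M r (h (\<pi> r)))))"
proof
  assume opp: "sign \<sigma> * (\<Prod>r\<in>R. ssgn (M r (h (\<sigma> r)))) = - (sign \<pi> * (\<Prod>r\<in>R. ssgn (M r (h (\<pi> r)))))"
  obtain k W \<Phi> \<epsilon> where W: "square_submatrix nr nc M k W" and
    sgn: "\<And>\<sigma>. \<sigma> permutes R \<Longrightarrow> sign (\<Phi> \<sigma>) * (\<Prod>i<k. ssgn (W i (\<Phi> \<sigma> i)))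
       = \<epsilon> * (sign \<sigma> * (\<Prod>r\<in>R. ssgn (M r (h (\<sigma> r)))))"
    and mp: "\<And>\<sigma>. \<sigma> permutes R \<Longrightarrow>
      (\<And>r. r \<in> R \<Longrightarrow> modulus (M r (h (\<sigma> r))) + z (h (\<sigma> r)) = T r) \<Longrightarrow>
       max_perm k (mod_mat W) (\<Phi> \<sigma>) \<and> tper k (mod_mat W) \<noteq> NegInf"
    by (rule tight_permutations[OF R U h fin le]) blast+
  have "\<not> trop_sign_singular k W"
    using gen W mp[OF \<sigma>] by (auto simp: trop_sign_generic_def)
  moreover have "sign (\<Phi> \<sigma>) * (\<Prod>i<k. ssgn (W i (\<Phi> \<sigma> i)))
      = - (sign (\<Phi> \<pi>) * (\<Prod>i<k. ssgn (W i (\<Phi> \<pi> i))))"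
    unfolding sgn[OF \<sigma>(1)] sgn[OF \<pi>(1)] opp by simp
  ultimately show False
    using mp[OF \<sigma>] mp[OF \<pi>] unfolding trop_sign_singular_def by blast
qed

section \<open>Overfull sets of rows\<close>

lemma cycle_of_list_nth:
  assumes "distinct cs" "t < length cs"
  shows "cycle_of_list cs (cs ! t) = cs ! (Suc t mod length cs)"
proof -
  have "map (cycle_of_list cs) cs = rotate 1 cs"
    using cyclic_rotation[OF assms(1), of 1] by simp
  then have "cycle_of_list cs (cs ! t) = rotate 1 cs ! t"
    using assms(2) by (metis nth_map)
  also have "\<dots> = cs ! (Suc t mod length cs)"
    using nth_rotate[OF assms(2), of 1] by simp
  finally show ?thesis .
qed

lemma sign_cycle_of_list:
  "distinct cs \<Longrightarrow> cs \<noteq> [] \<Longrightarrow> sign (cycle_of_list cs) = (- 1) ^ (length cs - 1)"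
proof (induction cs rule: cycle_of_list.induct)
  case (1 i j cs)
  then have "sign (cycle_of_list (i # j # cs)) = sign (transpose i j) * sign (cycle_of_list (j # cs))"
    by (simp add: sign_compose permutation_swap_id permutation_of_cycle)
  then show ?case
    using 1 by (simp add: sign_swap_id del: cycle_of_list.simps)
qed (simp_all add: id_def)

text \<open>
  Rows are viewed as edges of a multigraph on the columns: discarding columns of degree at most one
  leaves a graph in which a walk that never reuses an edge immediately must close up.
\<close>

lemma multigraph_cycle:
  fixes p q :: "'a \<Rightarrow> 'b"
  assumes "finite R" "finite U" "R \<noteq> {}" "card U \<le> card R"
    and "\<And>r. r \<in> R \<Longrightarrow> p r \<in> U \<and> q r \<in> U \<and> p r \<noteq> q r"
  obtains rs us where "length rs = length us" "length rs \<ge> 2" "distinct rs" "distinct us"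
    "set rs \<subseteq> R" "set us \<subseteq> U"
    "\<And>t. t < length rs \<Longrightarrow> {us ! t, us ! (Suc t mod length rs)} = {p (rs ! t), q (rs ! t)}"
proof -
  have "\<exists>rs us. length rs = length us \<and> length rs \<ge> 2 \<and> distinct rs \<and> distinct us \<and>
    set rs \<subseteq> R \<and> set us \<subseteq> U \<and>
    (\<forall>t<length rs. {us ! t, us ! (Suc t mod length rs)} = {p (rs ! t), q (rs ! t)})"
    using assms
  proof (induction "card R" arbitrary: R U rule: less_induct)
    case less
    note IH = less.hyps and fin = less.prems(1,2) and ne = less.prems(3) and le = less.prems(4)
      and pq = less.prems(5)
    show ?case
    proof (cases "\<exists>u\<in>U. \<exists>r\<in>R. \<forall>r'\<in>R - {r}. p r' \<noteq> u \<and> q r' \<noteq> u")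
      case True
      then obtain u r where u: "u \<in> U" "r \<in> R" "\<forall>r'\<in>R - {r}. p r' \<noteq> u \<and> q r' \<noteq> u"
        by blast
      \<comment> \<open>The two ends of the row \<open>r\<close> force
        \<open>card R \<ge> 2\<close>, so removing \<open>r\<close> together with the column
        \<open>u\<close> leaves a nonempty set of rows for the induction hypothesis.\<close>
      have "card {p r, q r} \<le> card U"
        by (rule card_mono) (use pq u fin in auto)
      then have "card R \<ge> 2"
        using le pq[OF u(2)] by auto
      then have "R - {r} \<noteq> {}"
        using fin u by (metis One_nat_def Suc_1 card.empty card_Suc_Diff1 not_less_eq_eq le_refl zero_le)
      then have "\<exists>rs us. length rs = length us \<and> length rs \<ge> 2 \<and> distinct rs \<and> distinct us \<and>
        set rs \<subseteq> R - {r} \<and> set us \<subseteq> U - {u} \<and>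
        (\<forall>t<length rs. {us ! t, us ! (Suc t mod length rs)} = {p (rs ! t), q (rs ! t)})"
        using fin u pq le card_Diff1_less[OF fin(1) u(2)]
        by (intro IH) (auto simp del: Diff_eq_empty_iff)
      then show ?thesis
        by blast
    next
      case False
      define adj where "adj r u \<longleftrightarrow> u = p r \<or> u = q r" for r u
      have nxt: "\<exists>r'\<in>R. r' \<noteq> r \<and> adj r' u" if "r \<in> R" "u \<in> U" for r u
      proof (rule ccontr)
        assume "\<not> ?thesis"
        then have "\<forall>r'\<in>R - {r}. p r' \<noteq> u \<and> q r' \<noteq> u"
          by (auto simp: adj_def)
        with False that show False by blast
      qed
      have "\<exists>r' u'. r' \<in> R \<and> u' \<in> U \<and> r' \<noteq> r \<and> u' \<noteq> u \<and> {p r', q r'} = {u, u'}"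
        if "r \<in> R" "u \<in> U" for r u
      proof -
        obtain r' where r': "r' \<in> R" "r' \<noteq> r" "adj r' u"
          using nxt[OF \<open>r \<in> R\<close> \<open>u \<in> U\<close>] by blast
        show ?thesis
        proof (cases "u = p r'")
          case True
          then show ?thesis using r' pq[of r'] by (intro exI[of _ r'] exI[of _ "q r'"]) auto
        next
          case False
          then show ?thesis using r' pq[of r'] by (intro exI[of _ r'] exI[of _ "p r'"]) (auto simp: adj_def)
        qed
      qed
      then have "\<exists>x'. fst x' \<in> R \<and> snd x' \<in> U \<and> fst x' \<noteq> fst x \<and> snd x' \<noteq> snd x \<and>
        {p (fst x'), q (fst x')} = {snd x, snd x'}" if "fst x \<in> R \<and> snd x \<in> U" for x
        using that by fastforce
      then obtain f where f: "\<And>x. fst x \<in> R \<and> snd x \<in> U \<Longrightarrow>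
        fst (f x) \<in> R \<and> snd (f x) \<in> U \<and> fst (f x) \<noteq> fst x \<and> snd (f x) \<noteq> snd x \<and>
        {p (fst (f x)), q (fst (f x))} = {snd x, snd (f x)}"
        by metis
      obtain r0 where "r0 \<in> R"
        using ne by blast
      \<comment> \<open>A state of the walk is the row just used and the column it leads to;
        remembering the row is what allows \<open>f\<close> to leave the column by a different
        one.\<close>
      define w where "w t = (f ^^ t) (r0, p r0)" for t
      have wS: "w (Suc t) = f (w t)" for t
        by (simp add: w_def)
      have win: "fst (w t) \<in> R \<and> snd (w t) \<in> U" for t
      proof (induction t)
        case 0
        then show ?case using \<open>r0 \<in> R\<close> pq by (simp add: w_def)
      next
        case (Suc t)
        then show ?case using f by (simp add: wS)
      qed
      define i where "i t = fst (w t)" for t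
      define j where "j t = snd (w t)" for t
      have ij: "i t \<in> R" "j t \<in> U" "i (Suc t) \<noteq> i t" "j (Suc t) \<noteq> j t"
        "{p (i (Suc t)), q (i (Suc t))} = {j t, j (Suc t)}" for t
        using win[of t] f[OF win[of t]] by (auto simp: i_def j_def wS)
      have "\<exists>b. \<exists>a<b. j a = j b"
      proof -
        have "\<not> inj j"
          using fin(2) ij(2) by (metis finite_subset image_subsetI infinite_UNIV_nat finite_imageD)
        then show ?thesis
          unfolding inj_def by (metis linorder_neqE_nat)
      qed
      \<comment> \<open>Minimality of \<open>b\<close> makes the columns at times \<open>a\<close>
        to \<open>b - 1\<close> distinct. Distinctness of the rows between them does not follow at
        once and is shown separately.\<close>
      define b where "b = (LEAST b. \<exists>a<b. j a = j b)"
      obtain a where a: "a < b" "j a = j b"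
        using LeastI_ex[OF \<open>\<exists>b. \<exists>a<b. j a = j b\<close>] b_def by blast
      have inj: "j t \<noteq> j t'" if "t < t'" "t' < b" for t t'
        using not_less_Least[of t' "\<lambda>b. \<exists>a<b. j a = j b"] that b_def by blast
      have ab: "a + 2 \<le> b"
        using a ij(4)[of a] by (metis Suc_leI add_2_eq_Suc' le_neq_implies_less)
      define L where "L = b - a"
      have L: "L \<ge> 2" "b = a + L"
        using ab by (auto simp: L_def)
      define rs where "rs = map (\<lambda>t. i (Suc (a + t))) [0..<L]"
      define us where "us = map (\<lambda>t. j (a + t)) [0..<L]"
      have jmod: "j (a + Suc t mod L) = j (Suc (a + t))" if "t < L" for t
      proof (cases "Suc t < L")
        case False
        then have "Suc t = L" using that by simp
        then show ?thesis using a(2) L(2) by (metis add_Suc_right add_0_right mod_self)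
      qed simp
      have injL: "t = t'" if "j (a + t) = j (a + t')" "t < L" "t' < L" for t t'
        using inj[of "a + t" "a + t'"] inj[of "a + t'" "a + t"] that L(2)
        by (cases t t' rule: linorder_cases) auto
      \<comment> \<open>Equal rows have equal pairs of ends; as the columns are distinct, this
        leaves only \<open>Suc t = t'\<close>, and consecutive rows of the walk differ.\<close>
      have "i (Suc (a + t)) \<noteq> i (Suc (a + t'))" if "t < t'" "t' < L" for t t'
      proof
        assume eq: "i (Suc (a + t)) = i (Suc (a + t'))"
        then have "{j (a + t), j (a + Suc t)} = {j (a + t'), j (a + Suc t' mod L)}"
          using ij(5)[of "a + t"] ij(5)[of "a + t'"] jmod[of t'] that by auto
        moreover have "j (a + t) \<noteq> j (a + t')"
          using injL[of t t'] that by auto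
        ultimately have "j (a + Suc t) = j (a + t')"
          by (auto simp: doubleton_eq_iff)
        then have "Suc t = t'"
          using injL[of "Suc t" t'] that by auto
        then show False
          using eq ij(3)[of "Suc (a + t)"] by auto
      qed
      then have "inj_on (\<lambda>t. i (Suc (a + t))) {0..<L}"
        by (intro inj_onI) (metis atLeastLessThan_iff linorder_neqE_nat)
      then have "distinct rs"
        by (simp add: rs_def distinct_map)
      moreover have "distinct us"
        using injL by (auto simp: us_def distinct_map inj_on_def)
      moreover have "{us ! t, us ! (Suc t mod length rs)} = {p (rs ! t), q (rs ! t)}"
        if "t < length rs" for t
      proof -
        have t: "t < L" "Suc t mod L < L"
          using that L by (auto simp: rs_def)
        then have "us ! (Suc t mod length rs) = j (a + Suc t mod L)"
          by (simp add: us_def rs_def)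
        then show ?thesis
          using t ij(5)[of "a + t"] jmod[of t] by (simp add: us_def rs_def)
      qed
      moreover have "length rs = length us" "length rs \<ge> 2" "set rs \<subseteq> R" "set us \<subseteq> U"
        using ij L by (auto simp: rs_def us_def)
      ultimately show ?thesis
        by blast
    qed
  qed
  then show ?thesis
    using that by blast
qed

text \<open>\<open>h\<close> and its composite with the cyclic shift of \<open>rs\<close> are the
  two perfect matchings of the cycle. This form lets the identity and the shift serve as the two
  permutations to which genericity is applied.\<close>

lemma alternating_cycle:
  fixes p q :: "'a \<Rightarrow> 'b"
  assumes "finite R" "finite U" "R \<noteq> {}" "card U \<le> card R"
    and "\<And>r. r \<in> R \<Longrightarrow> p r \<in> U \<and> q r \<in> U \<and> p r \<noteq> q r"
  obtains rs h where "distinct rs" "rs \<noteq> []" "set rs \<subseteq> R" "inj_on h (set rs)" "h ` set rs \<subseteq> U"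
    "\<And>r. r \<in> set rs \<Longrightarrow> {h r, h (cycle_of_list rs r)} = {p r, q r}"
proof -
  obtain rs us where len: "length rs = length us" "length rs \<ge> 2" and dist: "distinct rs" "distinct us"
    and sub: "set rs \<subseteq> R" "set us \<subseteq> U" and
    cyc: "\<And>t. t < length rs \<Longrightarrow> {us ! t, us ! (Suc t mod length rs)} = {p (rs ! t), q (rs ! t)}"
    by (rule multigraph_cycle[OF assms]) blast+
  define h where "h = (!) us \<circ> inv_into {..<length rs} ((!) rs)"
  have brs: "bij_betw ((!) rs) {..<length rs} (set rs)"
    by (rule bij_betw_nth[OF dist(1)]) auto
  have bus: "bij_betw ((!) us) {..<length rs} (set us)"
    by (rule bij_betw_nth[OF dist(2)]) (auto simp: len)
  have h: "bij_betw h (set rs) (set us)"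
    unfolding h_def by (rule bij_betw_trans[OF bij_betw_inv_into[OF brs] bus])
  have h_nth: "h (rs ! t) = us ! t" if "t < length rs" for t
    using that brs by (simp add: h_def bij_betw_def)
  have "{h r, h (cycle_of_list rs r)} = {p r, q r}" if r: "r \<in> set rs" for r
  proof -
    obtain t where t: "t < length rs" "r = rs ! t"
      using r by (metis in_set_conv_nth)
    have t': "Suc t mod length rs < length rs"
      using t(1) by (intro mod_less_divisor) auto
    show ?thesis
      using cyc[OF t(1)] t h_nth[OF t(1)] h_nth[OF t'] cycle_of_list_nth[OF dist(1) t(1)] by auto
  qed
  then show ?thesis
    using that[of rs h] dist sub h len by (metis bij_betw_def length_0_conv list.size(3) not_numeral_le_zero)
qed

text \<open>Along the alternating cycle, the identity and the cyclic shift are both tight, so they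
  would have to coincide; but then the two ends of a row on the cycle would coincide too.\<close>

lemma no_overfull_generic:
  fixes M :: "strop matrix"
  assumes gen: "trop_generic nr nc M"
    and R: "R \<subseteq> {..<nr}" and U: "U \<subseteq> {..<nc}" and "R \<noteq> {}" and "card U \<le> card R"
    and fin: "\<And>r. r \<in> R \<Longrightarrow> T r \<noteq> NegInf" "\<And>u. u \<in> U \<Longrightarrow> z u \<noteq> NegInf"
    and le: "\<And>r u. r \<in> R \<Longrightarrow> u \<in> U \<Longrightarrow> modulus (M r u) + z u \<le> T r"
    and two: "\<And>r. r \<in> R \<Longrightarrow> \<exists>u\<in>U. \<exists>u'\<in>U. u \<noteq> u' \<and>
      modulus (M r u) + z u = T r \<and> modulus (M r u') + z u' = T r"
  shows False
proof -
  have finite: "finite R" "finite U"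
    using R U finite_subset by blast+
  obtain p q where pq: "\<And>r. r \<in> R \<Longrightarrow> p r \<in> U \<and> q r \<in> U \<and> p r \<noteq> q r"
    and tight: "\<And>r. r \<in> R \<Longrightarrow> modulus (M r (p r)) + z (p r) = T r \<and> modulus (M r (q r)) + z (q r) = T r"
    using two by metis
  obtain rs h where dist: "distinct rs" "rs \<noteq> []" and sub: "set rs \<subseteq> R" "h ` set rs \<subseteq> U"
    and inj: "inj_on h (set rs)"
    and pair: "\<And>r. r \<in> set rs \<Longrightarrow> {h r, h (cycle_of_list rs r)} = {p r, q r}"
    by (rule alternating_cycle[OF finite \<open>R \<noteq> {}\<close> \<open>card U \<le> card R\<close> pq]) blast+
  let ?\<sigma> = "cycle_of_list rs"
  have "id = ?\<sigma>"
  proof (rule generic_tight_unique[OF gen _ _ inj_on_imp_bij_betw[OF inj], where T = T and z = z])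
    show "?\<sigma> permutes set rs"
      by (rule cycle_permutes)
    fix r assume r: "r \<in> set rs"
    then show "modulus (M r (h (id r))) + z (h (id r)) = T r"
      "modulus (M r (h (?\<sigma> r))) + z (h (?\<sigma> r)) = T r"
      using pair[OF r] tight[of r] sub by (auto simp: doubleton_eq_iff)
  qed (use sub R U fin le in \<open>auto simp: permutes_id subset_iff\<close>)
  then have "{h (hd rs)} = {p (hd rs), q (hd rs)}"
    using pair[of "hd rs"] dist(2) by (metis id_apply insert_absorb2 list.set_sel(1))
  then show False
    using pq[of "hd rs"] sub dist(2) by (auto simp: subset_iff)
qed

text \<open>On a cycle of length L the two matchings take terms of opposite sign in each of the L
  rows, and the shift itself has sign (-1)^(L-1), so the two signed products are opposite for every
  L. The unknowns \<open>Y\<close> only scale the columns: each occurs once in either product, and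
  its sign cancels.\<close>

lemma no_overfull_sign_generic:
  fixes M :: "strop matrix"
  assumes gen: "trop_sign_generic nr nc M"
    and R: "R \<subseteq> {..<nr}" and U: "U \<subseteq> {..<nc}" and "R \<noteq> {}" and "card U \<le> card R"
    and fin: "\<And>u. u \<in> U \<Longrightarrow> Y u \<noteq> SNegInf"
    and le: "\<And>r u. r \<in> R \<Longrightarrow> u \<in> U \<Longrightarrow> modulus (smult (M r u) (Y u)) \<le> T r"
    and two: "\<And>r. r \<in> R \<Longrightarrow> \<exists>u\<in>U. \<exists>u'\<in>U.
      modulus (smult (M r u) (Y u)) = T r \<and> modulus (smult (M r u') (Y u')) = T r \<and>
      ssgn (smult (M r u) (Y u)) * ssgn (smult (M r u') (Y u')) = - 1"
  shows False
proof -
  have finite: "finite R" "finite U"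
    using R U finite_subset by blast+
  define s where "s r u = ssgn (smult (M r u) (Y u))" for r u
  have "\<forall>r\<in>R. \<exists>u u'. u \<in> U \<and> u' \<in> U \<and> u \<noteq> u' \<and>
      modulus (smult (M r u) (Y u)) = T r \<and> modulus (smult (M r u') (Y u')) = T r \<and> s r u * s r u' = - 1"
  proof
    fix r assume "r \<in> R"
    then obtain u u' where u: "u \<in> U" "u' \<in> U" "modulus (smult (M r u) (Y u)) = T r"
      "modulus (smult (M r u') (Y u')) = T r" "s r u * s r u' = - 1"
      using two unfolding s_def by blast
    moreover have "u \<noteq> u'"
    proof
      assume "u = u'"
      then have "s r u * s r u = - 1" using u by simp
      moreover have "s r u * s r u \<ge> 0" by simp
      ultimately show False by simp
    qed
    ultimately show "\<exists>u u'. u \<in> U \<and> u' \<in> U \<and> u \<noteq> u' \<and>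
      modulus (smult (M r u) (Y u)) = T r \<and> modulus (smult (M r u') (Y u')) = T r \<and> s r u * s r u' = - 1"
      by blast
  qed
  then obtain p q where pq: "\<And>r. r \<in> R \<Longrightarrow> p r \<in> U \<and> q r \<in> U \<and> p r \<noteq> q r"
    and tight: "\<And>r. r \<in> R \<Longrightarrow> modulus (smult (M r (p r)) (Y (p r))) = T r \<and>
      modulus (smult (M r (q r)) (Y (q r))) = T r"
    and opp: "\<And>r. r \<in> R \<Longrightarrow> s r (p r) * s r (q r) = - 1"
    by metis
  obtain rs h where dist: "distinct rs" and ne: "rs \<noteq> []" and sub: "set rs \<subseteq> R" "h ` set rs \<subseteq> U"
    and inj: "inj_on h (set rs)"
    and pair: "\<And>r. r \<in> set rs \<Longrightarrow> {h r, h (cycle_of_list rs r)} = {p r, q r}"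
    by (rule alternating_cycle[OF finite \<open>R \<noteq> {}\<close> \<open>card U \<le> card R\<close> pq]) blast+
  define V where "V = h ` set rs"
  have h: "bij_betw h (set rs) V"
    unfolding V_def by (rule inj_on_imp_bij_betw[OF inj])
  have V: "V \<subseteq> U"
    using sub by (simp add: V_def)
  let ?\<sigma> = "cycle_of_list rs"
  have \<sigma>: "?\<sigma> permutes set rs"
    by (rule cycle_permutes)
  have h\<sigma>: "bij_betw (\<lambda>r. h (?\<sigma> r)) (set rs) (V)"
    using bij_betw_trans[OF permutes_imp_bij[OF \<sigma>] h] by (simp add: comp_def)
  have t1: "modulus (M r (h (id r))) + modulus (Y (h (id r))) = T r"
    and t2: "modulus (M r (h (?\<sigma> r))) + modulus (Y (h (?\<sigma> r))) = T r"
    and t3: "s r (h r) * s r (h (?\<sigma> r)) = - 1" if r: "r \<in> set rs" for r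
    using pair[OF r] tight[of r] opp[of r] r sub by (auto simp: doubleton_eq_iff mult.commute)
  have T: "T r \<noteq> NegInf" if "r \<in> set rs" for r
    using t1[OF that] t3[OF that] by (auto simp: s_def simp flip: t1[OF that])
  let ?P = "\<lambda>f. \<Prod>r\<in>set rs. ssgn (M r (f r))" and ?Y = "\<Prod>u\<in>V. ssgn (Y u)"
  have split: "(\<Prod>r\<in>set rs. s r (f r)) = ?P f * ?Y" if "bij_betw f (set rs) (V)" for f
    using prod.reindex_bij_betw[OF that, of "\<lambda>u. ssgn (Y u)"] by (simp add: s_def prod.distrib)
  have "(\<Prod>r\<in>set rs. s r (h r) * s r (h (?\<sigma> r))) = (- 1) ^ length rs"
    using t3 dist by (simp add: distinct_card cong: prod.cong)
  then have "?P h * ?Y * (?P (\<lambda>r. h (?\<sigma> r)) * ?Y) = (- 1) ^ length rs"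
    by (simp add: prod.distrib split[OF h] split[OF h\<sigma>])
  moreover have "?Y * ?Y = 1"
    using fin V by (auto simp flip: prod.distrib intro!: prod.neutral ssgn_square)
  moreover have "?P h * ?Y * (?P (\<lambda>r. h (?\<sigma> r)) * ?Y) = ?P h * ?P (\<lambda>r. h (?\<sigma> r)) * (?Y * ?Y)"
    by (simp only: ac_simps)
  ultimately have PP: "?P h * ?P (\<lambda>r. h (?\<sigma> r)) = (- 1) ^ length rs"
    by simp
  have Psq: "?P h * ?P h = 1"
    using t1 T by (auto simp flip: prod.distrib intro!: prod.neutral ssgn_square)
      (metis add_eq_NegInf_iff modulus.simps(1))
  have "?P (\<lambda>r. h (?\<sigma> r)) = ?P h * (- 1) ^ length rs"
  proof -
    have "?P (\<lambda>r. h (?\<sigma> r)) = ?P h * ?P h * ?P (\<lambda>r. h (?\<sigma> r))"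
      by (simp only: Psq mult_1)
    then show ?thesis
      by (simp only: mult.assoc PP)
  qed
  moreover have "sign ?\<sigma> * (- 1) ^ length rs = - 1"
    using sign_cycle_of_list[OF dist ne] ne
    by (cases "length rs") (auto simp flip: power_mult_distrib)
  moreover have "sign ?\<sigma> * (?P h * (- 1) ^ length rs) = ?P h * (sign ?\<sigma> * (- 1) ^ length rs)"
    by (simp only: ac_simps)
  ultimately have "sign (id :: nat \<Rightarrow> nat) * ?P (\<lambda>r. h (id r)) = - (sign ?\<sigma> * ?P (\<lambda>r. h (?\<sigma> r)))"
    by simp
  moreover have "sign (id :: nat \<Rightarrow> nat) * ?P (\<lambda>r. h (id r)) \<noteq> - (sign ?\<sigma> * ?P (\<lambda>r. h (?\<sigma> r)))"
    by (rule sign_generic_tight_sign[where \<sigma> = id and \<pi> = ?\<sigma>, OF gen _ _ h,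
          where T = T and z = "\<lambda>u. modulus (Y u)"])
      (use sub V R U fin le t1 t2 \<sigma> T in \<open>auto simp: permutes_id subset_iff\<close>)
  ultimately show False
    by contradiction
qed

section \<open>Uniqueness of the reduced costs\<close>

text \<open>Dual feasibility (\<open>v_ge\<close>) and complementary slackness
  (\<open>v_tight\<close>) of an optimal assignment. The map \<open>\<rho>\<close> goes from columns
  to rows since the balance relations are indexed by columns: relation \<open>j\<close> owns the
  unknown \<open>\<rho> j\<close>. Apart from these facts nothing about \<open>b\<close> or the
  basic point enters the uniqueness proof or the invariant.\<close>

locale matched_rows =
  fixes m n :: nat and A :: "strop matrix" and c :: "nat \<Rightarrow> trop" and I :: "nat set"
    and x v :: "nat \<Rightarrow> trop" and \<rho> :: "nat \<Rightarrow> nat"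
  assumes I: "I \<subseteq> {..<m}" and \<rho>: "bij_betw \<rho> {..<n} I"
    and x_fin: "\<And>j. j < n \<Longrightarrow> x j \<noteq> NegInf" and v_fin: "\<And>i. i \<in> I \<Longrightarrow> v i \<noteq> NegInf"
    and v_ge: "\<And>i j. i \<in> I \<Longrightarrow> j < n \<Longrightarrow> modulus (A i j) + x j \<le> v i"
    and v_tight: "\<And>j. j < n \<Longrightarrow> modulus (A (\<rho> j) j) + x j = v (\<rho> j)"
begin

lemma \<rho>_I: "j < n \<Longrightarrow> \<rho> j \<in> I"
  using \<rho> by (auto simp: bij_betw_def)

lemma \<rho>_less: "j < n \<Longrightarrow> \<rho> j < m"
  using \<rho>_I I by auto

lemma \<rho>_eq: "j < n \<Longrightarrow> k < n \<Longrightarrow> \<rho> j = \<rho> k \<longleftrightarrow> j = k"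
  using \<rho> by (auto simp: bij_betw_def inj_on_def)

lemma I_\<rho>: "i \<in> I \<Longrightarrow> \<exists>j<n. i = \<rho> j"
  using \<rho> by (auto simp: bij_betw_def)

lemma own_nonzero: "j < n \<Longrightarrow> A (\<rho> j) j \<noteq> SNegInf"
  using v_tight[of j] v_fin[OF \<rho>_I, of j] by (metis add_eq_NegInf_iff modulus_eq_NegInf_iff)

text \<open>
  The balance relation is made homogeneous: \<open>c\<close> becomes column \<open>m\<close>, with the extra unknown
  fixed to \<open>\<ominus>0\<close>.
\<close>

definition hmat :: "strop matrix" where
  "hmat = append_col m (transp A) (\<lambda>j. of_trop (c j))"

definition hvec :: "(nat \<Rightarrow> strop) \<Rightarrow> nat \<Rightarrow> strop" where
  "hvec y i = (if i < m then y i else SNeg 0)"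

definition trm :: "(nat \<Rightarrow> strop) \<Rightarrow> nat \<Rightarrow> nat \<Rightarrow> strop" where
  "trm y j i = smult (hmat j i) (hvec y i)"

definition row_max :: "(nat \<Rightarrow> strop) \<Rightarrow> nat \<Rightarrow> trop" where
  "row_max y j = Max (modulus ` trm y j ` {..m})"

text \<open>To be read as an arc: an index \<open>\<rho> k\<close> leads from relation
  \<open>j\<close> to relation \<open>k\<close>, the index \<open>m\<close> leads to
  \<open>c\<close>. The product of signs being -1 also excludes terms equal to
  \<open>SNegInf\<close>.\<close>

definition opposed :: "(nat \<Rightarrow> strop) \<Rightarrow> nat \<Rightarrow> nat \<Rightarrow> bool" where
  "opposed y j i \<longleftrightarrow> i \<le> m \<and> modulus (trm y j i) = row_max y j \<and>
     ssgn (trm y j (\<rho> j)) * ssgn (trm y j i) = - 1"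

lemma hmat_less: "i < m \<Longrightarrow> hmat j i = A i j"
  by (simp add: hmat_def append_col_def transp_def)

lemma trm_less: "i < m \<Longrightarrow> trm y j i = smult (A i j) (y i)"
  by (simp add: trm_def hmat_less hvec_def)

lemma trm_last: "trm y j m = sneg (of_trop (c j))"
  by (cases "c j") (simp_all add: trm_def hmat_def append_col_def hvec_def)

lemma row_max_ge: "i \<le> m \<Longrightarrow> modulus (trm y j i) \<le> row_max y j"
  by (simp add: row_max_def)

lemma trm_set:
  "insert (sneg (of_trop (c j))) ((\<lambda>i. smult (A i j) (y i)) ` {..<m}) = trm y j ` {..m}"
proof -
  have "{..m} = insert m {..<m}"
    by auto
  then show ?thesis
    by (simp add: trm_last trm_less cong: image_cong_simp)
qed

section \<open>Structure of a single solution under sign genericity\<close>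

context
  fixes y :: "nat \<Rightarrow> strop"
  assumes sol: "is_reduced_costs m n A c I y"
    and gen: "trop_sign_generic n (m + 1) hmat"
begin

lemma balanced:
  assumes "j < n" "row_max y j \<noteq> NegInf"
  obtains i i' where "i \<le> m" "i' \<le> m" "modulus (trm y j i) = row_max y j" "modulus (trm y j i') = row_max y j"
    "ssgn (trm y j i) = 1" "ssgn (trm y j i') = - 1"
proof -
  have "balanced_set (trm y j ` {..m})"
    using sol assms(1) by (simp add: is_reduced_costs_def dual_balance_def trm_set)
  then show ?thesis
    using assms(2) that by (auto simp: balanced_set_def simp flip: row_max_def)
qed

lemma support: "i \<le> m \<Longrightarrow> trm y j i \<noteq> SNegInf \<Longrightarrow> i = m \<or> (\<exists>k<n. i = \<rho> k \<and> y i \<noteq> SNegInf)"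
proof -
  assume i: "i \<le> m" "trm y j i \<noteq> SNegInf"
  show ?thesis
  proof (cases "i = m")
    case False
    then have "y i \<noteq> SNegInf"
      using i by (cases "A i j") (auto simp: trm_less)
    then show ?thesis
      using I_\<rho>[of i] sol by (auto simp: is_reduced_costs_def)
  qed simp
qed

text \<open>After adding \<open>x\<close>, the own term depends on the unknown and its row alone; by
  \<open>v_ge\<close> no other term of that unknown can exceed this value.\<close>

lemma scaled_own: "j < n \<Longrightarrow> modulus (trm y j (\<rho> j)) + x j = modulus (y (\<rho> j)) + v (\<rho> j)"
  by (simp add: trm_less \<rho>_less flip: v_tight) (simp add: ac_simps)

text \<open>
  If the own term of row \<open>j0\<close> were not maximal, the rows whose scaled maximum is at least that of
  \<open>j0\<close> would be overfull.
\<close>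

lemma own_row_max:
  assumes "j < n"
  shows "modulus (trm y j (\<rho> j)) = row_max y j"
proof (rule ccontr)
  assume "modulus (trm y j (\<rho> j)) \<noteq> row_max y j"
  then have less: "modulus (trm y j (\<rho> j)) < row_max y j"
    using row_max_ge[of "\<rho> j" y j] \<rho>_less[OF assms] by auto
  \<comment> \<open>Sizes are compared after adding \<open>x\<close>: in this scale the single
    number \<open>z k\<close> bounds all terms of the unknown \<open>\<rho> k\<close>.\<close>
  define \<theta> where "\<theta> = row_max y j + x j"
  define z where "z k = modulus (y (\<rho> k)) + v (\<rho> k)" for k
  have z: "z k \<le> row_max y k + x k" if "k < n" for k
    using row_max_ge[of "\<rho> k" y k] \<rho>_less[OF that] scaled_own[OF that] x_fin[OF that]
    by (metis z_def add_le_cancel_right_trop less_imp_le)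
  have zj: "z j < \<theta>"
    using less scaled_own[OF assms] x_fin[OF assms]
    by (metis z_def \<theta>_def add_le_cancel_right_trop not_le)
  then have \<theta>: "\<theta> \<noteq> NegInf"
    by (metis le_NegInf_iff NegInf_le not_le)
  define K where "K = {k. k < n \<and> \<theta> \<le> z k}"
  define R where "R = {k. k < n \<and> \<theta> \<le> row_max y k + x k}"
  \<comment> \<open>The relation \<open>j\<close> lies in \<open>R\<close> but not in
    \<open>K\<close>; this surplus row makes up for the extra column \<open>m\<close> in the
    count.\<close>
  have KR: "insert j K \<subseteq> R" and jK: "j \<notin> K"
    using z zj assms by (auto simp: K_def R_def \<theta>_def intro: order_trans)
  have "finite R"
    by (simp add: R_def)
  then have "card (insert j K) \<le> card R"
    using KR by (intro card_mono)
  then have "card K + 1 \<le> card R"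
    using jK by (simp add: K_def)
  moreover have "card (insert m (\<rho> ` K)) \<le> card K + 1"
    using card_image_le[of K \<rho>] card_insert_le_m1[of "Suc (card K)" "\<rho> ` K" m]
    by (simp add: K_def card_insert_if)
  ultimately have card: "card (insert m (\<rho> ` K)) \<le> card R"
    by linarith
  show False
  proof (rule no_overfull_sign_generic[OF gen _ _ _ card, where Y = "hvec y" and T = "row_max y"])
    show "R \<subseteq> {..<n}" "R \<noteq> {}" "insert m (\<rho> ` K) \<subseteq> {..<m + 1}"
      using KR by (auto simp: R_def K_def dest: \<rho>_less)
    show "hvec y u \<noteq> SNegInf" if u: "u \<in> insert m (\<rho> ` K)" for u
    proof (cases "u = m")
      case False
      then obtain k where k: "u = \<rho> k" "k < n" "\<theta> \<le> z k"
        using u by (auto simp: K_def)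
      then have "z k \<noteq> NegInf"
        using \<theta> by auto
      then show ?thesis
        using k \<rho>_less[of k] by (auto simp: z_def hvec_def)
    qed (simp add: hvec_def)
    show "modulus (smult (hmat r u) (hvec y u)) \<le> row_max y r"
      if "r \<in> R" "u \<in> insert m (\<rho> ` K)" for r u
    proof -
      have "u \<le> m"
        using that by (auto simp: K_def dest: \<rho>_less)
      from row_max_ge[OF this, of y r] show ?thesis by (simp only: trm_def)
    qed
    fix r assume "r \<in> R"
    then have r: "r < n" "\<theta> \<le> row_max y r + x r"
      by (auto simp: R_def)
    then have row_max: "row_max y r \<noteq> NegInf"
      using \<theta> by auto
    \<comment> \<open>A maximal term of a row in \<open>R\<close> has scaled modulus at least
      \<open>\<theta>\<close> and, unless it comes from \<open>c\<close>, at most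
      \<open>z k\<close>; hence its unknown belongs to \<open>K\<close>.\<close>
    have mem: "i \<in> insert m (\<rho> ` K)" if i: "i \<le> m" "modulus (trm y r i) = row_max y r" for i
    proof -
      have "trm y r i \<noteq> SNegInf"
        using i(2) row_max by auto
      from support[OF i(1) this] consider "i = m" | k where "k < n" "i = \<rho> k"
        by blast
      then show ?thesis
      proof cases
        case (2 k)
        have "\<theta> \<le> modulus (A i r) + modulus (y i) + x r"
          using r i(2) \<rho>_less[OF 2(1)] 2(2) by (simp add: trm_less)
        also have "\<dots> = modulus (y i) + (modulus (A i r) + x r)"
          by (simp only: ac_simps)
        also have "\<dots> \<le> z k"
          unfolding z_def 2(2) using v_ge[OF \<rho>_I[OF 2(1)] r(1)] by (intro add_mono) auto
        finally show ?thesis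
          using 2 by (auto simp: K_def)
      qed simp
    qed
    show "\<exists>u\<in>insert m (\<rho> ` K). \<exists>u'\<in>insert m (\<rho> ` K).
        modulus (smult (hmat r u) (hvec y u)) = row_max y r \<and>
        modulus (smult (hmat r u') (hvec y u')) = row_max y r \<and>
        ssgn (smult (hmat r u) (hvec y u)) * ssgn (smult (hmat r u') (hvec y u')) = - 1"
    proof -
      obtain i i' where "i \<le> m" "i' \<le> m" "modulus (trm y r i) = row_max y r" "modulus (trm y r i') = row_max y r"
        "ssgn (trm y r i) = 1" "ssgn (trm y r i') = - 1"
        using balanced[OF r(1) row_max] .
      then show ?thesis
        using mem[of i] mem[of i'] unfolding trm_def
        by (intro bexI[of _ i] bexI[of _ i']) auto
    qed
  qed
qed

lemma row_max_eq: "j < n \<Longrightarrow> row_max y j = modulus (A (\<rho> j) j) + modulus (y (\<rho> j))"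
  using own_row_max[of j] by (simp add: trm_less \<rho>_less)

lemma row_max_fin_iff: "j < n \<Longrightarrow> row_max y j = NegInf \<longleftrightarrow> y (\<rho> j) = SNegInf"
  using own_nonzero[of j] by (simp add: row_max_eq)

lemma ex_opposed:
  assumes "j < n" "y (\<rho> j) \<noteq> SNegInf"
  shows "\<exists>i. opposed y j i"
proof -
  have row_max: "row_max y j \<noteq> NegInf"
    using assms by (simp add: row_max_fin_iff)
  then have "trm y j (\<rho> j) \<noteq> SNegInf"
    using own_row_max[OF assms(1)] by auto
  then consider "ssgn (trm y j (\<rho> j)) = 1" | "ssgn (trm y j (\<rho> j)) = - 1"
    by (cases "trm y j (\<rho> j)") auto
  then show ?thesis
    by cases (rule balanced[OF assms(1) row_max]; force simp: opposed_def)+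
qed

lemma opposed_cases:
  assumes "j < n" "opposed y j i"
  obtains "i = m" | k where "k < n" "i = \<rho> k" "y (\<rho> k) \<noteq> SNegInf"
proof -
  have "trm y j i \<noteq> SNegInf"
    using assms(2) by (auto simp: opposed_def)
  then show ?thesis
    using support[of i j] assms(2) that by (auto simp: opposed_def)
qed

text \<open>In each relation of \<open>R\<close> the own term and the one given by
  \<open>closed\<close> are two opposed maximal terms, so \<open>R\<close> would be overfull on the
  columns \<open>\<rho>\<close> followed by its own indices. This is acyclicity of
  \<open>opposed\<close> in the form of an induction principle: to prove a property of all relations
  with finite unknown, it suffices that each counterexample leads to another.\<close>

lemma no_closed_set:
  assumes R: "R \<subseteq> {j. j < n \<and> y (\<rho> j) \<noteq> SNegInf}"
    and closed: "\<And>j. j \<in> R \<Longrightarrow> \<exists>k\<in>R. opposed y j (\<rho> k)"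
  shows "R = {}"
proof (rule ccontr)
  assume "R \<noteq> {}"
  have "finite R"
    using R by (rule finite_subset) auto
  then have card: "card (\<rho> ` R) \<le> card R"
    by (rule card_image_le)
  have less: "\<rho> k < m" "k < n" "y (\<rho> k) \<noteq> SNegInf" if "k \<in> R" for k
    using R that \<rho>_less by auto
  show False
  proof (rule no_overfull_sign_generic[OF gen _ _ \<open>R \<noteq> {}\<close> card, where Y = "hvec y" and T = "row_max y"])
    show "R \<subseteq> {..<n}" "\<rho> ` R \<subseteq> {..<m + 1}" "\<And>u. u \<in> \<rho> ` R \<Longrightarrow> hvec y u \<noteq> SNegInf"
      using less by (auto simp: hvec_def less_Suc_eq)
    show "modulus (smult (hmat r u) (hvec y u)) \<le> row_max y r" if "u \<in> \<rho> ` R" for r u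
      using that less(1) row_max_ge[of u y r] by (auto simp: trm_def less_imp_le)
    fix r assume r: "r \<in> R"
    obtain k where k: "k \<in> R" "opposed y r (\<rho> k)"
      using closed[OF r] by blast
    show "\<exists>u\<in>\<rho> ` R. \<exists>u'\<in>\<rho> ` R. modulus (smult (hmat r u) (hvec y u)) = row_max y r \<and>
        modulus (smult (hmat r u') (hvec y u')) = row_max y r \<and>
        ssgn (smult (hmat r u) (hvec y u)) * ssgn (smult (hmat r u') (hvec y u')) = - 1"
      using r k own_row_max[OF less(2)[OF r]] unfolding opposed_def trm_def
      by (intro bexI[of _ "\<rho> r"] bexI[of _ "\<rho> k"]) auto
  qed
qed

definition opposed_path :: "nat list \<Rightarrow> bool" where
  "opposed_path js \<longleftrightarrow> js \<noteq> [] \<and> distinct js \<and> set js \<subseteq> {j. j < n \<and> y (\<rho> j) \<noteq> SNegInf} \<and>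
     (\<forall>t. Suc t < length js \<longrightarrow> opposed y (js ! t) (\<rho> (js ! Suc t))) \<and> opposed y (last js) m"

text \<open>The relations without a path to \<open>c\<close> would form a closed set. If the
  starting relation already occurs on the path of its successor, the tail of that path is taken,
  which keeps paths free of repetitions.\<close>

lemma ex_opposed_path:
  assumes "j < n" "y (\<rho> j) \<noteq> SNegInf"
  shows "\<exists>js. opposed_path js \<and> hd js = j"
proof -
  let ?J = "{j. j < n \<and> y (\<rho> j) \<noteq> SNegInf}"
  let ?Q = "{j. j \<in> ?J \<and> (\<nexists>js. opposed_path js \<and> hd js = j)}"
  have "?Q = {}"
  proof (rule no_closed_set)
    show "?Q \<subseteq> ?J"
      by blast
    fix j assume j: "j \<in> ?Q"
    then obtain i where i: "opposed y j i"
      using ex_opposed by blast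
    have "j < n"
      using j by blast
    from this i show "\<exists>k\<in>?Q. opposed y j (\<rho> k)"
    proof (cases rule: opposed_cases)
      case 1
      then have "opposed_path [j]"
        using j i by (simp add: opposed_path_def)
      then show ?thesis
        using j by fastforce
    next
      case (2 k)
      have "k \<in> ?Q"
      proof (rule ccontr)
        assume "k \<notin> ?Q"
        then obtain js where js: "opposed_path js" "hd js = k"
          using 2 by blast
        have "\<exists>js. opposed_path js \<and> hd js = j"
        proof (cases "j \<in> set js")
          case True
          then obtain t where t: "t < length js" "js ! t = j"
            by (metis in_set_conv_nth)
          have "opposed_path (drop t js)" "hd (drop t js) = j"
            using js(1) t set_drop_subset[of t js]
            by (auto simp: opposed_path_def hd_drop_conv_nth)
          then show ?thesis by blast
        next
          case False
          have "opposed y ((j # js) ! t) (\<rho> ((j # js) ! Suc t))" if "Suc t < length (j # js)" for t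
          proof (cases t)
            case 0
            then show ?thesis
              using i 2 js by (auto simp: opposed_path_def hd_conv_nth)
          next
            case (Suc t')
            then show ?thesis
              using that js(1) by (auto simp: opposed_path_def)
          qed
          then have "opposed_path (j # js)"
            using js(1) False j by (simp add: opposed_path_def)
          then show ?thesis
            by (metis list.sel(1))
        qed
        then show False
          using j by blast
      qed
      then show ?thesis
        using i 2 by blast
    qed
  qed
  then show ?thesis
    using assms by blast
qed

text \<open>
  The path permutation expresses the sign of one unknown as a signed permutation product, as in
  Cramer's rule.
\<close>

lemma path_permutation:
  assumes path: "opposed_path js" and J: "J = {j. j < n \<and> y (\<rho> j) \<noteq> SNegInf}"
    and h: "h = (\<lambda>j. if j = hd js then m else \<rho> j)"
  shows "cycle_of_list js permutes J"
    and "\<And>j. j \<in> J \<Longrightarrow> modulus (trm y j (h (cycle_of_list js j))) = row_max y j"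
    and "ssgn (y (\<rho> (hd js))) * (\<Prod>j\<in>J. ssgn (hmat j (\<rho> j)))
      = sign (cycle_of_list js) * (\<Prod>j\<in>J. ssgn (hmat j (h (cycle_of_list js j))))"
proof -
  let ?\<sigma> = "cycle_of_list js" and ?j0 = "hd js"
  have ne: "js \<noteq> []" and dist: "distinct js" and sub: "set js \<subseteq> J"
    and step: "\<And>t. Suc t < length js \<Longrightarrow> opposed y (js ! t) (\<rho> (js ! Suc t))"
    and last: "opposed y (last js) m"
    using path by (auto simp: opposed_path_def J)
  have finJ: "finite J"
    by (simp add: J)
  have j0: "?j0 \<in> J" "?j0 \<in> set js"
    using ne sub by auto
  show \<sigma>: "?\<sigma> permutes J"
    using permutes_subset[OF cycle_permutes sub] .
  \<comment> \<open>The cyclic shift sends the last relation of the path back to its head, and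
    \<open>h\<close> has replaced the column of the head by \<open>m\<close>: this closes the path
    through its final arc to \<open>c\<close>.\<close>
  have opp: "opposed y j (h (?\<sigma> j))" if "j \<in> set js" for j
  proof -
    obtain t where t: "t < length js" "j = js ! t"
      using \<open>j \<in> set js\<close> by (metis in_set_conv_nth)
    have \<sigma>t: "?\<sigma> j = js ! (Suc t mod length js)"
      using cycle_of_list_nth[OF dist t(1)] t(2) by simp
    show ?thesis
    proof (cases "Suc t < length js")
      case True
      then have "js ! Suc t \<noteq> ?j0"
        using dist ne by (simp add: hd_conv_nth nth_eq_iff_index_eq)
      then show ?thesis
        using True \<sigma>t step[OF True] t by (simp add: h)
    next
      case False
      then have "Suc t = length js"
        using t by simp
      then have "?\<sigma> j = ?j0" "j = last js"
        using \<sigma>t ne t by (auto simp: hd_conv_nth last_conv_nth simp flip: \<open>Suc t = length js\<close>)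
      then show ?thesis
        using last by (simp add: h)
    qed
  qed
  have own: "h (?\<sigma> j) = \<rho> j" if "j \<in> J - set js" for j
    using that j0 by (auto simp: h id_outside_supp)
  show "modulus (trm y j (h (?\<sigma> j))) = row_max y j" if "j \<in> J" for j
    using opp[of j] own[of j] own_row_max[of j] that by (cases "j \<in> set js") (auto simp: opposed_def J)
  define s where "s j i = ssgn (trm y j i)" for j i
  \<comment> \<open>Each relation on the path exchanges its own term for one of opposite sign, which
    yields the factor \<open>(- 1) ^ length js\<close>; off the path nothing changes.\<close>
  have flip: "s j (\<rho> j) = - s j (h (?\<sigma> j))" if "j \<in> set js" for j
    using opp[OF that] unfolding opposed_def s_def
    by (cases "trm y j (\<rho> j)"; cases "trm y j (h (?\<sigma> j))") auto
  have "(\<Prod>j\<in>J. s j (\<rho> j)) = (\<Prod>j\<in>J - set js. s j (\<rho> j)) * (\<Prod>j\<in>set js. s j (\<rho> j))"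
    by (rule prod.subset_diff[OF sub finJ])
  also have "(\<Prod>j\<in>J - set js. s j (\<rho> j)) = (\<Prod>j\<in>J - set js. s j (h (?\<sigma> j)))"
    by (rule prod.cong) (auto simp: own)
  also have "(\<Prod>j\<in>set js. s j (\<rho> j)) = (\<Prod>j\<in>set js. - s j (h (?\<sigma> j)))"
    by (rule prod.cong) (auto simp: flip)
  also have "\<dots> = (- 1) ^ length js * (\<Prod>j\<in>set js. s j (h (?\<sigma> j)))"
    using dist by (simp add: prod_uminus distinct_card)
  also have "(\<Prod>j\<in>J - set js. s j (h (?\<sigma> j))) * ((- 1) ^ length js * (\<Prod>j\<in>set js. s j (h (?\<sigma> j))))
      = (- 1) ^ length js * (\<Prod>j\<in>J. s j (h (?\<sigma> j)))"
    by (simp only: prod.subset_diff[OF sub finJ, of "\<lambda>j. s j (h (?\<sigma> j))"] ac_simps)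
  finally have 1: "(\<Prod>j\<in>J. s j (\<rho> j)) = (- 1) ^ length js * (\<Prod>j\<in>J. s j (h (?\<sigma> j)))" .
  \<comment> \<open>The signs of all unknowns but the head one. They occur in both products and
    cancel, which leaves the sign of the head unknown against the -1 of the fixed unknown
    \<open>SNeg 0\<close>.\<close>
  let ?Q = "\<Prod>j\<in>J - {?j0}. ssgn (hvec y (\<rho> j))"
  have Jlt: "\<rho> j < m" "y (\<rho> j) \<noteq> SNegInf" if "j \<in> J" for j
    using that \<rho>_less by (auto simp: J)
  have 2: "(\<Prod>j\<in>J. s j (\<rho> j)) = (\<Prod>j\<in>J. ssgn (hmat j (\<rho> j))) * (ssgn (y (\<rho> ?j0)) * ?Q)"
    using prod.remove[OF finJ j0(1), of "\<lambda>j. ssgn (hvec y (\<rho> j))"] Jlt[OF j0(1)]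
    by (simp add: s_def trm_def prod.distrib hvec_def)
  have "(\<Prod>j\<in>J. ssgn (hvec y (h (?\<sigma> j)))) = (\<Prod>j\<in>J. ssgn (hvec y (h j)))"
    using prod.permute[OF \<sigma>, of "\<lambda>j. ssgn (hvec y (h j))"] by (simp add: comp_def)
  also have "\<dots> = ssgn (hvec y (h ?j0)) * (\<Prod>j\<in>J - {?j0}. ssgn (hvec y (h j)))"
    using j0 finJ by (simp add: prod.remove)
  also have "(\<Prod>j\<in>J - {?j0}. ssgn (hvec y (h j))) = ?Q"
    by (rule prod.cong) (auto simp: h)
  also have "ssgn (hvec y (h ?j0)) * ?Q = - ?Q"
    by (simp add: h hvec_def)
  finally have 3: "(\<Prod>j\<in>J. s j (h (?\<sigma> j))) = (\<Prod>j\<in>J. ssgn (hmat j (h (?\<sigma> j)))) * - ?Q"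
    by (simp add: s_def trm_def prod.distrib)
  have Q: "?Q * ?Q = 1"
    using Jlt by (auto simp: hvec_def simp flip: prod.distrib intro!: prod.neutral ssgn_square)
  \<comment> \<open>The cycle contributes one factor -1 fewer than the path has relations; this
    compensates the -1 coming from \<open>SNeg 0\<close>.\<close>
  have sgn: "sign ?\<sigma> = - ((- 1) ^ length js)"
    using sign_cycle_of_list[OF dist ne] ne by (cases js) auto
  have alg: "a * b = - e * d" if "b * (a * q) = e * (d * - q)" "q * q = 1" for a b d e q :: int
  proof -
    have "a * b = b * (a * q) * q"
      using that(2) by (simp add: ac_simps)
    also have "\<dots> = - e * d * (q * q)"
      unfolding that(1) by (simp add: ac_simps)
    finally show ?thesis
      using that(2) by simp
  qed
  show "ssgn (y (\<rho> ?j0)) * (\<Prod>j\<in>J. ssgn (hmat j (\<rho> j)))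
      = sign ?\<sigma> * (\<Prod>j\<in>J. ssgn (hmat j (h (?\<sigma> j))))"
    unfolding sgn by (rule alg[OF _ Q]) (use 1 2 3 in simp)
qed

end

text \<open>The relations whose unknown is larger in \<open>y\<close> than in \<open>y'\<close> form
  a closed set. Their row maximum is larger for \<open>y\<close>, so an opposed term of
  \<open>y\<close> can neither be that of \<open>c\<close>, which is common to both, nor that of an
  unknown which is not larger in \<open>y\<close>.\<close>

lemma modulus_reduced_costs_le:
  assumes y: "is_reduced_costs m n A c I y" and y': "is_reduced_costs m n A c I y'"
    and gen: "trop_sign_generic n (m + 1) hmat" and "j < n"
  shows "modulus (y (\<rho> j)) \<le> modulus (y' (\<rho> j))"
proof -
  let ?D = "{j. j < n \<and> modulus (y' (\<rho> j)) < modulus (y (\<rho> j))}"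
  have "?D = {}"
  proof (rule no_closed_set[OF y gen])
    show D: "?D \<subseteq> {j. j < n \<and> y (\<rho> j) \<noteq> SNegInf}"
      by (auto simp: less_trop_def)
    fix j assume j: "j \<in> ?D"
    then have jn: "j < n"
      by blast
    have less: "row_max y' j < row_max y j"
      using j row_max_eq[OF y gen jn] row_max_eq[OF y' gen jn] own_nonzero[OF jn]
      by (metis (no_types, lifting) add.commute add_le_cancel_right_trop linorder_not_less mem_Collect_eq
          modulus_eq_NegInf_iff)
    obtain i where i: "opposed y j i"
      using ex_opposed[OF y gen jn] j D by blast
    from y gen jn i show "\<exists>k\<in>?D. opposed y j (\<rho> k)"
    proof (cases rule: opposed_cases)
      case 1
      then have "row_max y j \<le> row_max y' j"
        using i row_max_ge[of m y' j] by (simp add: opposed_def trm_last)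
      then show ?thesis
        using less by simp
    next
      case (2 k)
      have "k \<in> ?D"
      proof (rule ccontr)
        assume "k \<notin> ?D"
        then have "modulus (y (\<rho> k)) \<le> modulus (y' (\<rho> k))"
          using 2 by auto
        then have "modulus (trm y j (\<rho> k)) \<le> modulus (trm y' j (\<rho> k))"
          using \<rho>_less[OF 2(1)] by (simp add: trm_less add_left_mono)
        also have "\<dots> \<le> row_max y' j"
          using \<rho>_less[OF 2(1)] by (intro row_max_ge) simp
        finally show False
          using less i 2 by (simp add: opposed_def)
      qed
      then show ?thesis
        using i 2 by blast
    qed
  qed
  then show ?thesis
    using \<open>j < n\<close> by (metis (mono_tags, lifting) empty_iff mem_Collect_eq not_less)
qed

text \<open>Equal moduli make the path permutations of \<open>y\<close> and \<open>y'\<close> tight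
  for the same \<open>T\<close> and \<open>z\<close>, so their signed products cannot be opposite.
  Each product is the sign of the unknown times the same product over the own entries, hence the
  signs of the unknown agree.\<close>

lemma reduced_costs_unique:
  assumes y: "is_reduced_costs m n A c I y" and y': "is_reduced_costs m n A c I y'"
    and gen: "trop_sign_generic n (m + 1) hmat"
  shows "y = y'"
proof
  fix i
  have mod_eq: "modulus (y (\<rho> j)) = modulus (y' (\<rho> j))" if "j < n" for j
    using modulus_reduced_costs_le[OF y y' gen that] modulus_reduced_costs_le[OF y' y gen that] by simp
  show "y i = y' i"
  proof (cases "i \<in> I \<and> y i \<noteq> SNegInf")
    case False
    then consider "i \<notin> I" | "i \<in> I" "y i = SNegInf"
      by blast
    then show ?thesis
    proof cases
      case 1
      then show ?thesis
        using y y' by (simp add: is_reduced_costs_def)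
    next
      case 2
      then show ?thesis
        using I_\<rho>[of i] mod_eq by (metis modulus_eq_NegInf_iff)
    qed
  next
    case True
    then obtain j0 where j0: "j0 < n" "i = \<rho> j0" "y (\<rho> j0) \<noteq> SNegInf"
      using I_\<rho> by blast
    define J where "J = {j. j < n \<and> y (\<rho> j) \<noteq> SNegInf}"
    define h where "h = (\<lambda>j. if j = j0 then m else \<rho> j)"
    have SNegInf_iff: "y (\<rho> j) = SNegInf \<longleftrightarrow> y' (\<rho> j) = SNegInf" if "j < n" for j
      using mod_eq[OF that] by (metis modulus_eq_NegInf_iff)
    have J': "J = {j. j < n \<and> y' (\<rho> j) \<noteq> SNegInf}"
      using SNegInf_iff by (auto simp: J_def)
    obtain js where js: "opposed_path y js" "hd js = j0"
      using ex_opposed_path[OF y gen j0(1,3)] by blast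
    obtain js' where js': "opposed_path y' js'" "hd js' = j0"
      using ex_opposed_path[OF y' gen j0(1)] j0 SNegInf_iff by blast
    note P = path_permutation[OF y gen js(1) J_def h_def[folded js(2)], unfolded js(2)]
    note P' = path_permutation[OF y' gen js'(1) J' h_def[folded js'(2)], unfolded js'(2)]
    have row_max_eq: "row_max y j = row_max y' j" if "j < n" for j
      using that mod_eq row_max_eq[OF y gen] row_max_eq[OF y' gen] by simp
    have hvec_mod: "modulus (hvec y (h j)) = modulus (hvec y' (h j))" if "j \<in> J" for j
      using mod_eq that by (auto simp: hvec_def h_def J_def)
    have inj: "inj_on h J"
      using \<rho>_less by (auto simp: inj_on_def h_def J_def \<rho>_eq dest: less_imp_neq)
    have hJ: "h ` J \<subseteq> {..<m + 1}"
      using \<rho>_less by (auto simp: h_def J_def less_Suc_eq)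
    have "sign (cycle_of_list js) * (\<Prod>j\<in>J. ssgn (hmat j (h (cycle_of_list js j))))
      \<noteq> - (sign (cycle_of_list js') * (\<Prod>j\<in>J. ssgn (hmat j (h (cycle_of_list js' j)))))"
    proof (rule sign_generic_tight_sign[OF gen _ hJ inj_on_imp_bij_betw[OF inj], where T = "row_max y"
          and z = "\<lambda>u. modulus (hvec y u)"])
      show "J \<subseteq> {..<n}"
        by (auto simp: J_def)
      show "row_max y r \<noteq> NegInf" if "r \<in> J" for r
        using that row_max_fin_iff[OF y gen] by (auto simp: J_def)
      show "modulus (hvec y u) \<noteq> NegInf" if "u \<in> h ` J" for u
        using that \<rho>_less by (auto simp: hvec_def h_def J_def)
      show "modulus (hmat r u) + modulus (hvec y u) \<le> row_max y r" if "u \<in> h ` J" for r u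
        using that hJ row_max_ge[of u y r] by (auto simp: trm_def less_Suc_eq_le)
      show "modulus (hmat r (h (cycle_of_list js r))) + modulus (hvec y (h (cycle_of_list js r))) = row_max y r"
        if "r \<in> J" for r
        using P(2)[OF that] by (simp add: trm_def)
      show "modulus (hmat r (h (cycle_of_list js' r))) + modulus (hvec y (h (cycle_of_list js' r))) = row_max y r"
        if "r \<in> J" for r
      proof -
        have "cycle_of_list js' r \<in> J"
          using P'(1) that by (simp add: permutes_in_image)
        then show ?thesis
          using P'(2)[OF that] that row_max_eq[of r] hvec_mod by (auto simp: trm_def J_def)
      qed
    qed (rule P(1) P'(1))+
    then have "ssgn (y i) * (\<Prod>j\<in>J. ssgn (hmat j (\<rho> j))) \<noteq> - (ssgn (y' i) * (\<Prod>j\<in>J. ssgn (hmat j (\<rho> j))))"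
      using P(3) P'(3) j0(2) by simp
    then have "ssgn (y i) \<noteq> - ssgn (y' i)"
      by auto
    moreover have "y' i \<noteq> SNegInf"
      using j0 SNegInf_iff by auto
    ultimately have "ssgn (y i) = ssgn (y' i)"
      using True by (cases "y i"; cases "y' i") auto
    then show ?thesis
      using mod_eq[OF j0(1)] j0(2) by (intro strop_eqI) auto
  qed
qed

end

section \<open>The matching defined by a basic point\<close>

lemma tmat_vec_ge: "j < n \<Longrightarrow> M i j + x j \<le> tmat_vec n M x i"
  by (simp add: tmat_vec_def)

lemma tmat_vec_attained:
  assumes "tmat_vec n M x i \<noteq> NegInf"
  obtains j where "j < n" "M i j + x j = tmat_vec n M x i"
proof -
  have "tmat_vec n M x i \<in> insert NegInf ((\<lambda>j. M i j + x j) ` {..<n})"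
    unfolding tmat_vec_def by (rule Max_in) auto
  then show ?thesis
    using assms that by auto
qed

lemma tmat_vec_append_col:
  "tmat_vec (n + 1) (\<lambda>i j. f (append_col n A b i j)) (x(n := 0)) i
     = max (tmat_vec n (\<lambda>i j. f (A i j)) x i) (f (b i))"
proof -
  have "(\<lambda>j. f (append_col n A b i j) + (x(n := 0)) j) ` {..<n + 1}
      = insert (f (b i)) ((\<lambda>j. f (A i j) + x j) ` {..<n})"
    by (auto simp: append_col_def lessThan_Suc image_iff)
  then show ?thesis
    using Max_insert[of "insert NegInf ((\<lambda>j. f (A i j) + x j) ` {..<n})" "f (b i)"]
    unfolding tmat_vec_def by (simp only: insert_commute[of NegInf "f (b i)"] max.commute) simp
qed

lemma modulus_eq_max: "modulus a = max (pos_part a) (neg_part a)"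
  by (cases a) auto

lemma pos_part_neg_part_NegInf: "pos_part a = NegInf \<or> neg_part a = NegInf"
  by (cases a) auto

definition row_value :: "nat \<Rightarrow> strop matrix \<Rightarrow> (nat \<Rightarrow> trop) \<Rightarrow> nat \<Rightarrow> trop" where
  "row_value n A x = tmat_vec n (mod_mat A) x"

definition tight :: "nat \<Rightarrow> strop matrix \<Rightarrow> (nat \<Rightarrow> trop) \<Rightarrow> nat \<Rightarrow> nat \<Rightarrow> bool" where
  "tight n A x i j \<longleftrightarrow> modulus (A i j) + x j = row_value n A x i"

lemma row_value_ge: "j < n \<Longrightarrow> modulus (A i j) + x j \<le> row_value n A x i"
  using tmat_vec_ge[of j n "mod_mat A" i x] by (simp add: row_value_def mod_mat_def)

locale basic_setting =
  fixes m n :: nat and A :: "strop matrix" and b :: "nat \<Rightarrow> strop" and c :: "nat \<Rightarrow> trop"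
    and I :: "nat set" and x :: "nat \<Rightarrow> trop"
  assumes standing: "standing_assumptions m n A b c" and basic: "basic_point m n A b I x"
begin

lemma I_sub: "I \<subseteq> {..<m}" and card_I: "card I = n"
  using basic by (auto simp: basic_point_def)

lemma finite_I: "finite I"
  using I_sub finite_subset by blast

lemma generic_Ab: "trop_generic m (n + 1) (append_col n A b)"
  using standing by (simp add: standing_assumptions_def)

lemma sign_generic_Ac: "trop_sign_generic n (m + 1) (append_col m (transp A) (\<lambda>j. of_trop (c j)))"
  using standing by (simp add: standing_assumptions_def)

abbreviation "Ab \<equiv> append_col n A b"
abbreviation "x1 \<equiv> x(n := 0)"

text \<open>Appending the coordinate \<open>0\<close>, the tropical unit, turns the point of the
  polyhedron into a point of the cone that is not identically \<open>NegInf\<close>, to which the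
  finiteness assumption applies.\<close>

lemma x1_fin: "j < n + 1 \<Longrightarrow> x1 j \<noteq> NegInf"
proof -
  have "in_cone m (n + 1) Ab x1"
    using basic
    by (simp add: in_cone_def basic_point_def active_point_def in_polyhedron_def pos_mat_def neg_mat_def
        tmat_vec_append_col del: One_nat_def Suc_eq_plus1 add_Suc_right fun_upd_apply)
  moreover have "\<exists>j<n + 1. x1 j \<noteq> NegInf"
    by (intro exI[of _ n]) (simp add: zero_trop_def)
  ultimately show "j < n + 1 \<Longrightarrow> x1 j \<noteq> NegInf"
    using standing unfolding standing_assumptions_def by blast
qed

lemma x_fin: "j < n \<Longrightarrow> x j \<noteq> NegInf"
  using x1_fin[of j] by simp

text \<open>
  At an active row the maximum over \<open>(A b)\<close> is attained by a positive and by a negative entry,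
  so at least once within \<open>A\<close>: this is why \<open>b\<close> need not be known.
\<close>

lemma active_row:
  assumes "i \<in> I"
  shows row_value_fin: "row_value n A x i \<noteq> NegInf"
    and Ab_le: "\<And>j. j < n + 1 \<Longrightarrow> modulus (Ab i j) + x1 j \<le> row_value n A x i"
    and two_tight: "\<exists>j<n + 1. \<exists>j'<n + 1. j \<noteq> j' \<and> modulus (Ab i j) + x1 j = row_value n A x i \<and>
      modulus (Ab i j') + x1 j' = row_value n A x i"
proof -
  define P where "P = tmat_vec (n + 1) (\<lambda>i j. pos_part (Ab i j)) x1 i"
  define N where "N = tmat_vec (n + 1) (\<lambda>i j. neg_part (Ab i j)) x1 i"
  have PN: "P = N"
    using basic assms unfolding P_def N_def tmat_vec_append_col
    by (simp add: basic_point_def active_point_def pos_mat_def neg_mat_def)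
  have le: "modulus (Ab i j) + x1 j \<le> P" if "j < n + 1" for j
  proof -
    have "pos_part (Ab i j) + x1 j \<le> P" "neg_part (Ab i j) + x1 j \<le> P"
      using tmat_vec_ge[OF that, of "\<lambda>i j. pos_part (Ab i j)" i x1]
        tmat_vec_ge[OF that, of "\<lambda>i j. neg_part (Ab i j)" i x1] PN
      by (simp_all only: P_def N_def)
    then show ?thesis
      by (cases "Ab i j") (simp_all del: fun_upd_apply)
  qed
  have "i < m"
    using assms I_sub by auto
  then obtain j0 where j0: "j0 < n + 1" "Ab i j0 \<noteq> SNegInf"
    using standing unfolding standing_assumptions_def by blast
  have Pfin: "P \<noteq> NegInf"
    using le[OF j0(1)] j0(2) x1_fin[OF j0(1)] by (auto simp del: fun_upd_apply)
  obtain j where j: "j < n + 1" "pos_part (Ab i j) + x1 j = P"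
    using tmat_vec_attained[of "n + 1" "\<lambda>i j. pos_part (Ab i j)" x1 i] Pfin unfolding P_def by blast
  obtain j' where j': "j' < n + 1" "neg_part (Ab i j') + x1 j' = P"
    using tmat_vec_attained[of "n + 1" "\<lambda>i j. neg_part (Ab i j)" x1 i] Pfin PN unfolding N_def by metis
  have fin: "pos_part (Ab i j) \<noteq> NegInf" "neg_part (Ab i j') \<noteq> NegInf"
    using j j' Pfin by (auto simp del: fun_upd_apply)
  then have neq: "j \<noteq> j'"
    using pos_part_neg_part_NegInf[of "Ab i j"] by auto
  have att: "modulus (Ab i j) + x1 j = P" "modulus (Ab i j') + x1 j' = P"
    using j j' fin by (cases "Ab i j"; cases "Ab i j'"; simp del: fun_upd_apply)+
  \<comment> \<open>Of the two distinct columns attaining the maximum, at most one is the column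
    \<open>n\<close> of \<open>b\<close>.\<close>
  have "P \<le> row_value n A x i"
  proof -
    obtain k where "k < n" "modulus (Ab i k) + x1 k = P"
      using att j(1) j'(1) neq by (metis Suc_eq_plus1 less_SucE)
    then show ?thesis
      using row_value_ge[of k n A i x] by (simp add: append_col_def)
  qed
  moreover have "row_value n A x i \<le> P"
  proof (cases "row_value n A x i = NegInf")
    case False
    then obtain k where "k < n" "modulus (A i k) + x k = row_value n A x i"
      using tmat_vec_attained[of n "mod_mat A" x i] unfolding row_value_def mod_mat_def by blast
    then show ?thesis
      using le[of k] by (simp add: append_col_def)
  qed simp
  ultimately have eq: "row_value n A x i = P"
    by simp
  show "row_value n A x i \<noteq> NegInf"
    using Pfin eq by simp
  show "modulus (Ab i j) + x1 j \<le> row_value n A x i" if "j < n + 1" for j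
    using le[OF that] by (simp only: eq)
  show "\<exists>j<n + 1. \<exists>j'<n + 1. j \<noteq> j' \<and> modulus (Ab i j) + x1 j = row_value n A x i \<and>
      modulus (Ab i j') + x1 j' = row_value n A x i"
    unfolding eq using j(1) j'(1) neq att by blast
qed

lemma tight_iff: "j < n \<Longrightarrow> tight n A x i j \<longleftrightarrow> modulus (Ab i j) + x1 j = row_value n A x i"
  by (simp add: tight_def append_col_def)

text \<open>
  \<open>U\<close> is the set of columns matched so far and \<open>\<rho>\<close> the rows matched to them; a row is matched
  only once all but one of its tight columns are matched.
\<close>

definition partial_matching :: "nat set \<Rightarrow> (nat \<Rightarrow> nat) \<Rightarrow> bool" where
  "partial_matching U \<rho> \<longleftrightarrow> U \<subseteq> {..<n} \<and> inj_on \<rho> U \<and> \<rho> ` U \<subseteq> I \<and>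
     (\<forall>j\<in>U. tight n A x (\<rho> j) j \<and> (\<forall>k<n. tight n A x (\<rho> j) k \<longrightarrow> k \<in> U))"

definition open_columns :: "nat set \<Rightarrow> nat \<Rightarrow> nat set" where
  "open_columns U i = {j. j < n \<and> j \<notin> U \<and> tight n A x i j}"

text \<open>Otherwise one of two sets of rows is overfull. If an unmatched row has no open column,
  it joins the matched rows: \<open>card U + 1\<close> rows whose tight columns lie in
  \<open>U\<close> or are column \<open>n\<close>. If there is no such row, every remaining row has
  two open columns, and there are as many remaining rows as remaining columns.\<close>

lemma ex_matchable_row:
  assumes pm: "partial_matching U \<rho>" and less: "card U < n"
  shows "\<exists>i\<in>I. card (open_columns U i) = 1"
proof (rule ccontr)
  assume none: "\<not> ?thesis"
  have U: "U \<subseteq> {..<n}" "inj_on \<rho> U" "\<rho> ` U \<subseteq> I"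
    and Utight: "\<And>j k. j \<in> U \<Longrightarrow> k < n \<Longrightarrow> tight n A x (\<rho> j) k \<Longrightarrow> k \<in> U"
    using pm by (auto simp: partial_matching_def)
  have finU: "finite U"
    using U(1) finite_subset by blast
  have card\<rho>: "card (\<rho> ` U) = card U"
    by (rule card_image[OF U(2)])
  have overfull: False
    if R: "R \<subseteq> I" "R \<noteq> {}" and C: "C \<subseteq> {..<n + 1}" "card C \<le> card R"
      and two: "\<And>r. r \<in> R \<Longrightarrow> \<exists>u\<in>C. \<exists>u'\<in>C. u \<noteq> u' \<and> modulus (Ab r u) + x1 u = row_value n A x r \<and>
        modulus (Ab r u') + x1 u' = row_value n A x r" for R C
  proof (rule no_overfull_generic[OF generic_Ab _ C(1) R(2) C(2), where T = "row_value n A x" and z = x1])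
    show "R \<subseteq> {..<m}" "\<And>r. r \<in> R \<Longrightarrow> row_value n A x r \<noteq> NegInf"
      "\<And>u. u \<in> C \<Longrightarrow> x1 u \<noteq> NegInf"
      "\<And>r u. r \<in> R \<Longrightarrow> u \<in> C \<Longrightarrow> modulus (Ab r u) + x1 u \<le> row_value n A x r"
      using R(1) I_sub row_value_fin C(1) x1_fin Ab_le by blast+
  qed (rule two)
  show False
  proof (cases "\<exists>i\<in>I - \<rho> ` U. open_columns U i = {}")
    case True
    then obtain i0 where i0: "i0 \<in> I" "i0 \<notin> \<rho> ` U" "open_columns U i0 = {}"
      by blast
    show False
    proof (rule overfull[of "insert i0 (\<rho> ` U)" "insert n U"])
      show "card (insert n U) \<le> card (insert i0 (\<rho> ` U))"
        using i0 finU card\<rho> by (simp add: card_insert_if)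
      fix r assume r: "r \<in> insert i0 (\<rho> ` U)"
      have mem: "j \<in> insert n U" if "j < n + 1" "modulus (Ab r j) + x1 j = row_value n A x r" for j
      proof (cases "j = n")
        case False
        then have "j < n" "tight n A x r j"
          using that tight_iff[of j r] by auto
        then show ?thesis
          using r i0(3) Utight by (auto simp: open_columns_def)
      qed simp
      have "r \<in> I"
        using r i0 U by auto
      from two_tight[OF this] mem show "\<exists>u\<in>insert n U. \<exists>u'\<in>insert n U. u \<noteq> u' \<and>
          modulus (Ab r u) + x1 u = row_value n A x r \<and> modulus (Ab r u') + x1 u' = row_value n A x r"
        by blast
    qed (use i0 U in auto)
  next
    case False
    show False
    proof (rule overfull[of "I - \<rho> ` U" "{..<n} - U"])
      have card: "card (I - \<rho> ` U) = n - card U"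
        using card_Diff_subset[OF _ U(3)] finU card\<rho> card_I by simp
      then show "card ({..<n} - U) \<le> card (I - \<rho> ` U)"
        using card_Diff_subset[OF finU U(1)] by simp
      show "I - \<rho> ` U \<noteq> {}"
        using card less by (metis card.empty zero_less_diff less_numeral_extra(3))
      fix r assume r: "r \<in> I - \<rho> ` U"
      have fin: "finite (open_columns U r)"
        by (simp add: open_columns_def)
      have "card (open_columns U r) \<noteq> 0" "card (open_columns U r) \<noteq> 1"
        using r False none fin by auto
      then have "2 \<le> card (open_columns U r)"
        by linarith
      then obtain u u' where "u \<in> open_columns U r" "u' \<in> open_columns U r" "u \<noteq> u'"
        using fin by (metis card_le_Suc0_iff_eq not_less_eq_eq numeral_2_eq_2)
      then show "\<exists>u\<in>{..<n} - U. \<exists>u'\<in>{..<n} - U. u \<noteq> u' \<and>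
          modulus (Ab r u) + x1 u = row_value n A x r \<and> modulus (Ab r u') + x1 u' = row_value n A x r"
        using tight_iff unfolding open_columns_def by blast
    qed auto
  qed
qed

lemma partial_matching_step:
  assumes pm: "partial_matching U \<rho>" and i: "i \<in> I" "open_columns U i = {j}"
  shows "partial_matching (insert j U) (\<rho>(j := i))" "j < n" "j \<notin> U"
proof -
  have j: "j < n" "j \<notin> U" "tight n A x i j"
    using i(2) by (auto simp: open_columns_def)
  show "j < n" "j \<notin> U"
    by fact+
  have only: "k \<in> insert j U" if "k < n" "tight n A x i k" for k
    using that i(2) by (auto simp: open_columns_def)
  have "i \<notin> \<rho> ` U"
    using pm j by (auto simp: partial_matching_def)
  then show "partial_matching (insert j U) (\<rho>(j := i))"
    using pm j i(1) only unfolding partial_matching_def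
    by (auto simp: inj_on_def)
qed

lemma partial_matching_full:
  assumes "partial_matching U \<rho>" "card U = n"
  shows "matched_rows m n A I x (row_value n A x) \<rho>"
proof
  have "U = {..<n}"
    using assms by (intro card_subset_eq) (auto simp: partial_matching_def)
  then have \<rho>: "inj_on \<rho> {..<n}" "\<rho> ` {..<n} \<subseteq> I" "\<And>j. j < n \<Longrightarrow> tight n A x (\<rho> j) j"
    using assms(1) by (auto simp: partial_matching_def)
  then have "\<rho> ` {..<n} = I"
    using card_subset_eq[OF finite_I \<rho>(2)] card_image[OF \<rho>(1)] card_I by simp
  then show "bij_betw \<rho> {..<n} I"
    using \<rho>(1) by (simp add: bij_betw_def)
  show "modulus (A (\<rho> j) j) + x j = row_value n A x (\<rho> j)" if "j < n" for j
    using \<rho>(3)[OF that] by (simp add: tight_def)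
qed (use I_sub x_fin row_value_fin row_value_ge in auto)

end

section \<open>Invariant of the shortest path computation\<close>

text \<open>The divisor is always a finite own entry. A numerator \<open>SNegInf\<close> gives
  \<open>SNegInf\<close>, which is the right value for columns not reached from
  \<open>c\<close>.\<close>

fun sdiv :: "strop \<Rightarrow> strop \<Rightarrow> strop" where
  "sdiv (SPos a) (SPos b) = SPos (a - b)"
| "sdiv (SPos a) (SNeg b) = SNeg (a - b)"
| "sdiv (SNeg a) (SPos b) = SNeg (a - b)"
| "sdiv (SNeg a) (SNeg b) = SPos (a - b)"
| "sdiv _ _ = SNegInf"

lemma smult_sdiv: "b \<noteq> SNegInf \<Longrightarrow> smult b (sdiv a b) = a"
  by (cases a; cases b) auto

lemma sneg_sneg [simp]: "sneg (sneg a) = a"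
  by (cases a) auto

context matched_rows
begin

text \<open>
  \<open>S\<close> is the set of settled columns. The number \<open>\<omega> j\<close> is the opposite of a term of largest
  modulus found so far in row \<open>j\<close>, that is, the value which the own term of that row must take.
\<close>

definition settled :: "nat set \<Rightarrow> (nat \<Rightarrow> strop) \<Rightarrow> (nat \<Rightarrow> strop) \<Rightarrow> bool" where
  "settled S \<omega> y \<longleftrightarrow> S \<subseteq> {..<n} \<and> (\<forall>i. i \<notin> \<rho> ` S \<longrightarrow> y i = SNegInf) \<and>
     (\<forall>j<n. c j \<le> modulus (\<omega> j)) \<and>
     (\<forall>k\<in>S. \<forall>j<n. modulus (smult (A (\<rho> k) j) (y (\<rho> k))) \<le> modulus (\<omega> j)) \<and>
     (\<forall>j<n. \<omega> j = of_trop (c j) \<or> (\<exists>k\<in>S. \<omega> j = sneg (smult (A (\<rho> k) j) (y (\<rho> k))))) \<and>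
     (\<forall>k\<in>S. smult (A (\<rho> k) k) (y (\<rho> k)) = \<omega> k) \<and>
     (\<forall>k\<in>S. \<forall>j<n. j \<notin> S \<longrightarrow> modulus (\<omega> j) + x j \<le> modulus (\<omega> k) + x k)"

lemma settled_init: "settled {} (\<lambda>j. of_trop (c j)) (\<lambda>i. SNegInf)"
  by (simp add: settled_def)

text \<open>Dijkstra's exchange argument: relaxing from \<open>k\<close> never yields a key above
  that of \<open>k\<close>, and all columns settled earlier have keys at least as large, so their
  values stay correct.\<close>

lemma settled_step:
  assumes st: "settled S \<omega> y" and k: "k < n" "k \<notin> S"
    and max: "\<And>j. j < n \<Longrightarrow> j \<notin> S \<Longrightarrow> modulus (\<omega> j) + x j \<le> modulus (\<omega> k) + x k"
    and y': "y' = y(\<rho> k := sdiv (\<omega> k) (A (\<rho> k) k))"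
    and \<omega>': "\<And>j. j < n \<Longrightarrow> \<omega>' j = (if modulus (\<omega> j) < modulus (smult (A (\<rho> k) j) (y' (\<rho> k)))
      then sneg (smult (A (\<rho> k) j) (y' (\<rho> k))) else \<omega> j)"
  shows "settled (insert k S) \<omega>' y'"
proof -
  have S: "S \<subseteq> {..<n}" and supp: "\<And>i. i \<notin> \<rho> ` S \<Longrightarrow> y i = SNegInf"
    and c: "\<And>j. j < n \<Longrightarrow> c j \<le> modulus (\<omega> j)"
    and le: "\<And>k j. k \<in> S \<Longrightarrow> j < n \<Longrightarrow> modulus (smult (A (\<rho> k) j) (y (\<rho> k))) \<le> modulus (\<omega> j)"
    and src: "\<And>j. j < n \<Longrightarrow> \<omega> j = of_trop (c j) \<or> (\<exists>k\<in>S. \<omega> j = sneg (smult (A (\<rho> k) j) (y (\<rho> k))))"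
    and own: "\<And>k. k \<in> S \<Longrightarrow> smult (A (\<rho> k) k) (y (\<rho> k)) = \<omega> k"
    and ord: "\<And>k j. k \<in> S \<Longrightarrow> j < n \<Longrightarrow> j \<notin> S \<Longrightarrow> modulus (\<omega> j) + x j \<le> modulus (\<omega> k) + x k"
    using st by (auto simp: settled_def)
  have y'S: "y' (\<rho> l) = y (\<rho> l)" if "l \<in> S" for l
    using that k S \<rho>_eq[of l k] by (auto simp: y')
  define q where "q j = smult (A (\<rho> k) j) (y' (\<rho> k))" for j
  have qk: "q k = \<omega> k"
    using own_nonzero[OF k(1)] by (simp add: q_def y' smult_sdiv)
  \<comment> \<open>The step from \<open>k\<close> to \<open>j\<close> has nonpositive weight,
    because \<open>v (\<rho> k)\<close> bounds row \<open>\<rho> k\<close> and is attained at its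
    own column.\<close>
  have q_le: "modulus (q j) + x j \<le> modulus (\<omega> k) + x k" if "j < n" for j
  proof -
    have "modulus (q j) + x j = modulus (y' (\<rho> k)) + (modulus (A (\<rho> k) j) + x j)"
      by (simp add: q_def ac_simps)
    also have "\<dots> \<le> modulus (y' (\<rho> k)) + (modulus (A (\<rho> k) k) + x k)"
      unfolding v_tight[OF k(1)] by (intro add_left_mono v_ge \<rho>_I k that)
    also have "\<dots> = modulus (q k) + x k"
      by (simp add: q_def ac_simps)
    finally show ?thesis
      by (simp add: qk)
  qed
  have q_le_S: "modulus (q j) \<le> modulus (\<omega> j)" if "j \<in> insert k S" for j
  proof -
    have "j < n"
      using that S k by auto
    have "modulus (q j) + x j \<le> modulus (\<omega> j) + x j"
      using q_le[OF \<open>j < n\<close>] ord[OF _ k, of j] that by (auto intro: order_trans)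
    then show ?thesis
      using x_fin[OF \<open>j < n\<close>] by (simp add: add_le_cancel_right_trop)
  qed
  \<comment> \<open>The comparison in the definition of \<open>\<omega>'\<close> is strict, so a tie
    leaves a settled value and its sign untouched; this covers \<open>k\<close> itself, where
    \<open>q k = \<omega> k\<close>.\<close>
  have \<omega>'_S: "\<omega>' j = \<omega> j" if "j \<in> insert k S" for j
  proof -
    have "j < n"
      using that S k by auto
    then show ?thesis
      using \<omega>'[of j] q_le_S[OF that] by (auto simp: q_def)
  qed
  have \<omega>'_mod: "modulus (\<omega>' j) = Orderings.max (modulus (\<omega> j)) (modulus (q j))" if "j < n" for j
    using \<omega>'[OF that] by (auto simp: q_def max_def)
  show ?thesis
    unfolding settled_def
  proof (intro conjI allI ballI impI)
    show "insert k S \<subseteq> {..<n}"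
      using S k by simp
    show "y' i = SNegInf" if "i \<notin> \<rho> ` insert k S" for i
      using that supp[of i] by (auto simp: y')
    show "c j \<le> modulus (\<omega>' j)" if "j < n" for j
      using c[OF that] \<omega>'_mod[OF that] by (simp add: le_max_iff_disj)
    show "modulus (smult (A (\<rho> l) j) (y' (\<rho> l))) \<le> modulus (\<omega>' j)" if "l \<in> insert k S" "j < n" for l j
    proof (cases "l = k")
      case True
      then show ?thesis
        using \<omega>'_mod[OF that(2)] by (simp add: q_def)
    next
      case False
      then show ?thesis
        using that le[of l j] y'S[of l] \<omega>'_mod[OF that(2)] by (simp add: le_max_iff_disj)
    qed
    show "\<omega>' j = of_trop (c j) \<or> (\<exists>l\<in>insert k S. \<omega>' j = sneg (smult (A (\<rho> l) j) (y' (\<rho> l))))"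
      if "j < n" for j
    proof (cases "modulus (\<omega> j) < modulus (q j)")
      case True
      then show ?thesis
        using \<omega>'[OF that] by (auto simp: q_def)
    next
      case False
      then have "\<omega>' j = \<omega> j"
        using \<omega>'[OF that] by (auto simp: q_def)
      then show ?thesis
        using src[OF that] y'S by auto
    qed
    show "smult (A (\<rho> l) l) (y' (\<rho> l)) = \<omega>' l" if "l \<in> insert k S" for l
      using that own[of l] y'S[of l] \<omega>'_S[of l] qk by (auto simp: q_def)
    show "modulus (\<omega>' j) + x j \<le> modulus (\<omega>' l) + x l"
      if "l \<in> insert k S" "j < n" "j \<notin> insert k S" for l j
    proof -
      have "modulus (\<omega>' j) + x j \<le> modulus (\<omega> k) + x k"
        using \<omega>'_mod[OF that(2)] max[OF that(2)] q_le[OF that(2)] that(3) by (auto simp: max_def)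
      also have "\<dots> \<le> modulus (\<omega> l) + x l"
        using ord[OF _ k, of l] that(1) by auto
      finally show ?thesis
        by (simp add: \<omega>'_S[OF that(1)])
    qed
  qed
qed

text \<open>Once all columns are settled, \<open>\<omega> j\<close> is the own term of relation
  \<open>j\<close>, its opposite is the term from which it was recorded, and both have the largest
  modulus.\<close>

lemma settled_full:
  assumes st: "settled {..<n} \<omega> y"
  shows "is_reduced_costs m n A c I y"
  unfolding is_reduced_costs_def dual_balance_def
proof (intro conjI allI impI)
  have img: "\<rho> ` {..<n} = I"
    using \<rho> by (simp add: bij_betw_def)
  have supp: "y i = SNegInf" if "i \<notin> I" for i
    using st that by (auto simp: settled_def img)
  then show "y i = SNegInf" if "i \<notin> I" for i
    using that by blast
  fix j assume j: "j < n"
  let ?E = "insert (sneg (of_trop (c j))) ((\<lambda>i. smult (A i j) (y i)) ` {..<m})"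
  have own: "\<omega> j \<in> ?E"
  proof -
    have "\<omega> j = smult (A (\<rho> j) j) (y (\<rho> j))"
      using st j by (simp add: settled_def)
    then show ?thesis
      using \<rho>_less[OF j] by auto
  qed
  have src: "sneg (\<omega> j) \<in> ?E"
  proof -
    have "\<omega> j = of_trop (c j) \<or> (\<exists>k\<in>{..<n}. \<omega> j = sneg (smult (A (\<rho> k) j) (y (\<rho> k))))"
      using st j unfolding settled_def by blast
    then show ?thesis
      using \<rho>_less by auto
  qed
  have "modulus e \<le> modulus (\<omega> j)" if e: "e \<in> ?E" for e
  proof -
    consider "e = sneg (of_trop (c j))" | i where "i < m" "e = smult (A i j) (y i)"
      using e by auto
    then show ?thesis
    proof cases
      case 1
      then show ?thesis using st j by (simp add: settled_def)
    next
      case (2 i)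
      show ?thesis
      proof (cases "i \<in> I")
        case True
        then obtain k where "k < n" "i = \<rho> k"
          using I_\<rho> by blast
        then show ?thesis
          using st j 2 by (simp add: settled_def)
      qed (use 2 supp in simp)
    qed
  qed
  then have Max: "Max (modulus ` ?E) = modulus (\<omega> j)"
    using own by (intro Max_eqI) blast+
  show "balanced_set ?E"
  proof (cases "\<omega> j")
    case SNegInf
    then show ?thesis
      unfolding balanced_set_def Max by simp
  next
    case (SPos a)
    then show ?thesis
      unfolding balanced_set_def Max
      by (intro disjI2 conjI bexI[OF _ own] bexI[OF _ src]) auto
  next
    case (SNeg a)
    then show ?thesis
      unfolding balanced_set_def Max
      by (intro disjI2 conjI bexI[OF _ own] bexI[OF _ src]) auto
  qed
qed

end

section \<open>Reasoning about programs\<close>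

text \<open>Total correctness with a time bound. Since the postcondition is a predicate, a nested
  \<open>runs\<close> serves as intermediate assertion in \<open>runs_Seq\<close>.\<close>

definition runs :: "com \<Rightarrow> state \<Rightarrow> nat \<Rightarrow> (state \<Rightarrow> bool) \<Rightarrow> bool" where
  "runs p s t Q \<longleftrightarrow> (\<exists>u s'. exec p s u s' \<and> u \<le> t \<and> Q s')"

lemma runs_mono: "runs p s t Q \<Longrightarrow> t \<le> t' \<Longrightarrow> (\<And>s. Q s \<Longrightarrow> Q' s) \<Longrightarrow> runs p s t' Q'"
  unfolding runs_def by (meson order_trans)

lemma runs_Seq: "runs p s t (\<lambda>s'. runs q s' u Q) \<Longrightarrow> t + u \<le> w \<Longrightarrow> runs (Seq p q) s w Q"
  unfolding runs_def by (meson exec.Seq add_mono order_trans)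

fun loop_free :: "com \<Rightarrow> bool" where
  "loop_free (Seq p q) \<longleftrightarrow> loop_free p \<and> loop_free q"
| "loop_free (Cond b p q) \<longleftrightarrow> loop_free p \<and> loop_free q"
| "loop_free (While b p) \<longleftrightarrow> False"
| "loop_free _ \<longleftrightarrow> True"

text \<open>The values of the next two functions on loops are junk.\<close>

fun result :: "com \<Rightarrow> state \<Rightarrow> state" where
  "result Skip s = s"
| "result (IAssign v e) s = s\<lparr>ivar := (ivar s)(v := ival e s)\<rparr>"
| "result (IStore a e f) s = s\<lparr>iarr := (iarr s)(a := (iarr s a)(ival e s := ival f s))\<rparr>"
| "result (TAssign v e) s = s\<lparr>tvar := (tvar s)(v := tval e s)\<rparr>"
| "result (TStore a e f g) s =
    s\<lparr>tarr := (tarr s)(a := (tarr s a)(ival e s := (tarr s a (ival e s))(ival f s := tval g s)))\<rparr>"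
| "result (Seq p q) s = result q (result p s)"
| "result (Cond b p q) s = (if bval b s then result p s else result q s)"
| "result (While b p) s = s"

fun max_cost :: "com \<Rightarrow> nat" where
  "max_cost Skip = 1"
| "max_cost (IAssign v e) = icost e + 1"
| "max_cost (IStore a e f) = icost e + icost f + 1"
| "max_cost (TAssign v e) = tcost e + 1"
| "max_cost (TStore a e f g) = icost e + icost f + tcost g + 1"
| "max_cost (Seq p q) = max_cost p + max_cost q"
| "max_cost (Cond b p q) = bcost b + max (max_cost p) (max_cost q) + 1"
| "max_cost (While b p) = 0"

lemma exec_loop_free: "loop_free p \<Longrightarrow> \<exists>t. exec p s t (result p s) \<and> t \<le> max_cost p"
proof (induction p arbitrary: s)
  case (Seq p q)
  then show ?case
    using exec.Seq by (metis add_mono loop_free.simps(1) max_cost.simps(6) result.simps(6))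
next
  case (Cond b p q)
  show ?case
  proof (cases "bval b s")
    case True
    obtain t where "exec p s t (result p s)" "t \<le> max_cost p"
      using Cond by auto
    then show ?thesis
      using exec.CondTrue[OF True, of p t _ q] True by (intro exI[of _ "bcost b + t + 1"]) auto
  next
    case False
    obtain t where "exec q s t (result q s)" "t \<le> max_cost q"
      using Cond by auto
    then show ?thesis
      using exec.CondFalse[OF False, of q t _ p] False by (intro exI[of _ "bcost b + t + 1"]) auto
  qed
qed (auto intro: exec.intros[simplified] intro!: exI)

lemma runs_loop_free: "loop_free p \<Longrightarrow> max_cost p \<le> t \<Longrightarrow> Q (result p s) \<Longrightarrow> runs p s t Q"
  unfolding runs_def using exec_loop_free[of p s] by (meson order_trans)

definition For :: "string \<Rightarrow> string \<Rightarrow> com \<Rightarrow> com" where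
  "For v N p = Seq (IAssign v (ILit 0))
     (While (ILess (IVar v) (IVar N)) (Seq p (IAssign v (IAdd (IVar v) (ILit 1)))))"

text \<open>An iteration costs \<open>B\<close>, plus 4 for the test and 4 for the increment; the
  initial assignment and the failing test cost 6 more, and \<open>1 \<le> n\<close> absorbs them
  into the factor \<open>B + 14\<close>. The invariant refers to the state in which the counter is
  already updated.\<close>

lemma runs_For:
  assumes "N \<noteq> v" and N: "ivar s N = n"
    and init: "Inv 0 (s\<lparr>ivar := (ivar s)(v := 0)\<rparr>)"
    and body: "\<And>k s. k < n \<Longrightarrow> Inv k s \<Longrightarrow> ivar s v = k \<Longrightarrow> ivar s N = n \<Longrightarrow>
      runs p s B (\<lambda>s'. ivar s' v = k \<and> ivar s' N = n \<and> Inv (Suc k) (s'\<lparr>ivar := (ivar s')(v := Suc k)\<rparr>))"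
    and cost: "1 \<le> n" "n * (B + 14) \<le> t"
    and post: "\<And>s. Inv n s \<Longrightarrow> Q s"
  shows "runs (For v N p) s t Q"
proof -
  let ?b = "ILess (IVar v) (IVar N)" and ?p = "Seq p (IAssign v (IAdd (IVar v) (ILit 1)))"
  have loop: "runs (While ?b ?p) s ((n - k) * (B + 8) + 4) Q"
    if "k \<le> n" "Inv k s" "ivar s v = k" "ivar s N = n" for k s
    using that
  proof (induction "n - k" arbitrary: k s)
    case 0
    then have "\<not> bval ?b s" "Q s"
      using post by auto
    then show ?case
      unfolding runs_def using exec.WhileFalse[of ?b s ?p] by fastforce
  next
    case (Suc d)
    then have k: "k < n"
      by simp
    obtain u s' where u: "exec p s u s'" "u \<le> B" "ivar s' v = k" "ivar s' N = n"
      "Inv (Suc k) (s'\<lparr>ivar := (ivar s')(v := Suc k)\<rparr>)"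
      using body[OF k Suc.prems(2-4)] unfolding runs_def by blast
    let ?s = "s'\<lparr>ivar := (ivar s')(v := Suc k)\<rparr>"
    have step: "exec ?p s (u + 4) ?s"
      using exec.Seq[OF u(1) exec.IAssign[of v "IAdd (IVar v) (ILit 1)" s']] u(3)
      by (simp add: numeral_eq_Suc)
    have "runs (While ?b ?p) ?s ((n - Suc k) * (B + 8) + 4) Q"
      using Suc k u \<open>N \<noteq> v\<close> by (intro Suc.hyps(1)) auto
    then obtain w s'' where w: "exec (While ?b ?p) ?s w s''" "w \<le> (n - Suc k) * (B + 8) + 4" "Q s''"
      unfolding runs_def by blast
    have "bval ?b s"
      using Suc.prems k by simp
    from exec.WhileTrue[OF this step w(1)] have "exec (While ?b ?p) s (3 + (u + 4) + w + 1) s''"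
      by simp
    moreover have "3 + (u + 4) + w + 1 \<le> (n - k) * (B + 8) + 4"
    proof -
      have "n - k = Suc (n - Suc k)"
        using k by simp
      then show ?thesis
        using u(2) w(2) by simp
    qed
    ultimately show ?case
      unfolding runs_def using w(3) by blast
  qed
  have "runs (While ?b ?p) (s\<lparr>ivar := (ivar s)(v := 0)\<rparr>) ((n - 0) * (B + 8) + 4) Q"
    by (rule loop) (use assms in auto)
  then have "runs (IAssign v (ILit 0)) s 2 (\<lambda>s. runs (While ?b ?p) s (n * (B + 8) + 4) Q)"
    by - (rule runs_loop_free, auto)
  then show ?thesis
    unfolding For_def by (rule runs_Seq) (use cost in \<open>simp add: algebra_simps\<close>)
qed

definition frame ::
  "string list \<Rightarrow> string list \<Rightarrow> string list \<Rightarrow> string list \<Rightarrow> state \<Rightarrow> state \<Rightarrow> bool" where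
  "frame X Y Z W s s' \<longleftrightarrow>
     (\<forall>v. v \<notin> set X \<longrightarrow> ivar s' v = ivar s v) \<and> (\<forall>a. a \<notin> set Y \<longrightarrow> iarr s' a = iarr s a) \<and>
     (\<forall>v. v \<notin> set Z \<longrightarrow> tvar s' v = tvar s v) \<and> (\<forall>a. a \<notin> set W \<longrightarrow> tarr s' a = tarr s a)"

lemma frame_ivar: "frame X Y Z W s s' \<Longrightarrow> v \<notin> set X \<Longrightarrow> ivar s' v = ivar s v"
  and frame_iarr: "frame X Y Z W s s' \<Longrightarrow> a \<notin> set Y \<Longrightarrow> iarr s' a = iarr s a"
  and frame_tvar: "frame X Y Z W s s' \<Longrightarrow> v \<notin> set Z \<Longrightarrow> tvar s' v = tvar s v"
  and frame_tarr: "frame X Y Z W s s' \<Longrightarrow> a \<notin> set W \<Longrightarrow> tarr s' a = tarr s a"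
  by (auto simp: frame_def)

lemma frame_iarr_Nil: "frame X [] Z W s s' \<Longrightarrow> iarr s' = iarr s"
  and frame_tarr_Nil: "frame X Y Z [] s s' \<Longrightarrow> tarr s' = tarr s"
  by (simp_all add: frame_def fun_eq_iff)

lemma holds_input_frame:
  assumes "frame X Y Z W s s'" "holds_input m n A c x I s"
    and "''m'' \<notin> set X" "''n'' \<notin> set X" "''I'' \<notin> set Y"
    and "''A+'' \<notin> set W" "''A-'' \<notin> set W" "''c'' \<notin> set W" "''x'' \<notin> set W"
  shows "holds_input m n A c x I s'"
  using assms(2)
  by (simp add: holds_input_def frame_ivar[OF assms(1)] frame_iarr[OF assms(1)] frame_tarr[OF assms(1)] assms)

section \<open>The program\<close>

text \<open>
  The arrays \<open>cnt\<close> and \<open>sum\<close> hold the number and the sum of the unmatched columns at which a row is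
  tight, so that the last such column is read off in constant time. The arrays \<open>p\<close> and \<open>q\<close> hold the
  positive and negative parts of \<open>\<omega>\<close>.
\<close>

definition weight :: texp where
  "weight = TAdd (TMax (TArr ''A+'' (IVar ''i'') (IVar ''j'')) (TArr ''A-'' (IVar ''i'') (IVar ''j'')))
     (TArr ''x'' (ILit 0) (IVar ''j''))"

definition max_loop :: com where
  "max_loop = For ''j'' ''n'' (TAssign ''w'' (TMax (TVar ''w'') weight))"

definition count_loop :: com where
  "count_loop = For ''j'' ''n'' (Cond (TLess weight (TVar ''w'')) Skip
     (Seq (IStore ''cnt'' (IVar ''i'') (IAdd (IArr ''cnt'' (IVar ''i'')) (ILit 1)))
          (IStore ''sum'' (IVar ''i'') (IAdd (IArr ''sum'' (IVar ''i'')) (IVar ''j'')))))"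

definition row_phase :: com where
  "row_phase = For ''i'' ''m''
     (Seq (TAssign ''w'' TNegInf)
     (Seq max_loop
     (Seq (Seq (TStore ''v'' (ILit 0) (IVar ''i'') (TVar ''w''))
          (Seq (IStore ''cnt'' (IVar ''i'') (ILit 0)) (IStore ''sum'' (IVar ''i'') (ILit 0))))
     count_loop)))"

text \<open>The scan has no early exit, and the last suitable row is kept: any of them will do, and
  the cost stays linear in \<open>m\<close>.\<close>

definition find_loop :: com where
  "find_loop = For ''i'' ''m'' (Cond
     (BAnd (ILess (ILit 0) (IArr ''I'' (IVar ''i'')))
        (BAnd (ILess (ILit 0) (IArr ''cnt'' (IVar ''i''))) (ILess (IArr ''cnt'' (IVar ''i'')) (ILit 2))))
     (IAssign ''k'' (IVar ''i'')) Skip)"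

text \<open>No flag for matched rows is required: the row just matched was tight at this one open
  column, so its count drops to 0 and it is never found again.\<close>

definition remove_loop :: com where
  "remove_loop = For ''i'' ''m'' (Cond (TLess weight (TArr ''v'' (ILit 0) (IVar ''i''))) Skip
     (Seq (IStore ''cnt'' (IVar ''i'') (ISub (IArr ''cnt'' (IVar ''i'')) (ILit 1)))
          (IStore ''sum'' (IVar ''i'') (ISub (IArr ''sum'' (IVar ''i'')) (IVar ''j'')))))"

definition match_phase :: com where
  "match_phase = For ''r'' ''n''
     (Seq find_loop
     (Seq (Seq (IAssign ''j'' (IArr ''sum'' (IVar ''k''))) (IStore ''rho'' (IVar ''j'') (IVar ''k'')))
     remove_loop))"

definition init_y :: com where
  "init_y = For ''i'' ''m'' (Seq (TStore ''y+'' (ILit 0) (IVar ''i'') TNegInf)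
     (TStore ''y-'' (ILit 0) (IVar ''i'') TNegInf))"

definition init_columns :: com where
  "init_columns = For ''j'' ''n'' (Seq (TStore ''p'' (ILit 0) (IVar ''j'') (TArr ''c'' (ILit 0) (IVar ''j'')))
     (Seq (TStore ''q'' (ILit 0) (IVar ''j'') TNegInf) (IStore ''done'' (IVar ''j'') (ILit 0))))"

definition key :: texp where
  "key = TAdd (TMax (TArr ''p'' (ILit 0) (IVar ''j'')) (TArr ''q'' (ILit 0) (IVar ''j'')))
     (TArr ''x'' (ILit 0) (IVar ''j''))"

text \<open>The comparison is not strict, so that a column with key \<open>NegInf\<close> can be
  selected as well; columns not reached from \<open>c\<close> must be settled too.\<close>

definition select_loop :: com where
  "select_loop = For ''j'' ''n'' (Cond
     (BAnd (ILess (IArr ''done'' (IVar ''j'')) (ILit 1)) (BNot (TLess key (TVar ''w''))))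
     (Seq (TAssign ''w'' key) (IAssign ''k'' (IVar ''j''))) Skip)"

definition mul :: "string \<Rightarrow> string \<Rightarrow> texp" where
  "mul a b = TMax
     (TAdd (TArr ''A+'' (IVar ''i'') (IVar ''j'')) (TArr a (ILit 0) (IVar ''i'')))
     (TAdd (TArr ''A-'' (IVar ''i'') (IVar ''j'')) (TArr b (ILit 0) (IVar ''i'')))"

text \<open>One part of the divisor is \<open>NegInf\<close>, and \<open>tdiv\<close> then returns
  \<open>NegInf\<close>, so the maximum keeps the quotient by the other part. Exchanging the
  arguments gives the negative part, as for \<open>mul\<close>.\<close>

definition quot :: "string \<Rightarrow> string \<Rightarrow> texp" where
  "quot a b = TMax
     (TDiv (TArr a (ILit 0) (IVar ''k'')) (TArr ''A+'' (IVar ''i'') (IVar ''k'')))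
     (TDiv (TArr b (ILit 0) (IVar ''k'')) (TArr ''A-'' (IVar ''i'') (IVar ''k'')))"

text \<open>The parts are stored crosswise, since the opposite of the new term is recorded.\<close>

definition relax_loop :: com where
  "relax_loop = For ''j'' ''n''
     (Seq (TAssign ''a'' (mul ''y+'' ''y-''))
     (Seq (TAssign ''b'' (mul ''y-'' ''y+''))
     (Cond (TLess (TMax (TArr ''p'' (ILit 0) (IVar ''j'')) (TArr ''q'' (ILit 0) (IVar ''j'')))
              (TMax (TVar ''a'') (TVar ''b'')))
        (Seq (TStore ''p'' (ILit 0) (IVar ''j'') (TVar ''b''))
             (TStore ''q'' (ILit 0) (IVar ''j'') (TVar ''a''))) Skip)))"

definition settle_phase :: com where
  "settle_phase = For ''r'' ''n''
     (Seq (TAssign ''w'' TNegInf)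
     (Seq select_loop
     (Seq (Seq (IAssign ''i'' (IArr ''rho'' (IVar ''k'')))
          (Seq (IStore ''done'' (IVar ''k'') (ILit 1))
          (Seq (TStore ''y+'' (ILit 0) (IVar ''i'') (quot ''p'' ''q''))
               (TStore ''y-'' (ILit 0) (IVar ''i'') (quot ''q'' ''p'')))))
     relax_loop)))"

definition reduced_costs_prog :: com where
  "reduced_costs_prog = Seq row_phase (Seq match_phase (Seq init_y (Seq init_columns settle_phase)))"

section \<open>Correctness and running time\<close>

lemma holds_inputD:
  assumes "holds_input m n A c x I s"
  shows "ivar s ''m'' = m" "ivar s ''n'' = n"
    "\<And>i j. i < m \<Longrightarrow> j < n \<Longrightarrow> tarr s ''A+'' i j = pos_part (A i j)"
    "\<And>i j. i < m \<Longrightarrow> j < n \<Longrightarrow> tarr s ''A-'' i j = neg_part (A i j)"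
    "\<And>j. j < n \<Longrightarrow> tarr s ''c'' 0 j = c j" "\<And>j. j < n \<Longrightarrow> tarr s ''x'' 0 j = x j"
    "\<And>i. i < m \<Longrightarrow> iarr s ''I'' i = (if i \<in> I then 1 else 0)"
  using assms by (auto simp: holds_input_def)

lemma tval_weight:
  assumes "holds_input m n A c x I s" "ivar s ''i'' = i" "ivar s ''j'' = j" "i < m" "j < n"
  shows "tval weight s = modulus (A i j) + x j"
  using assms by (simp add: weight_def holds_inputD modulus_eq_max)

section \<open>Row maxima, counts of tight columns, search and removal\<close>

lemma tmat_vec_Suc: "tmat_vec (Suc k) M x i = max (tmat_vec k M x i) (M i k + x k)"
proof -
  have "Max (insert (M i k + x k) (insert NegInf ((\<lambda>j. M i j + x j) ` {..<k})))
      = max (M i k + x k) (Max (insert NegInf ((\<lambda>j. M i j + x j) ` {..<k})))"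
    by (rule Max_insert) auto
  then show ?thesis
    by (simp add: tmat_vec_def lessThan_Suc insert_commute[of NegInf "M i k + x k"] max.commute)
qed

lemma runs_max_loop:
  assumes s: "holds_input m n A c x I s" "ivar s ''i'' = i" "i < m" "tvar s ''w'' = NegInf" and n: "1 \<le> n"
    and t: "n * 30 \<le> t"
    and Q: "\<And>s'. frame [''j''] [] [''w''] [] s s' \<Longrightarrow> tvar s' ''w'' = row_value n A x i \<Longrightarrow> Q s'"
  shows "runs max_loop s t Q"
  unfolding max_loop_def
proof (rule runs_For[where B = 16 and
      Inv = "\<lambda>k s'. frame [''j''] [] [''w''] [] s s' \<and> tvar s' ''w'' = tmat_vec k (mod_mat A) x i"])
  fix k s' assume k: "k < n" and inv: "frame [''j''] [] [''w''] [] s s' \<and> tvar s' ''w'' = tmat_vec k (mod_mat A) x i"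
    and j: "ivar s' ''j'' = k" "ivar s' ''n'' = n"
  have "holds_input m n A c x I s'"
    by (rule holds_input_frame[OF conjunct1[OF inv] s(1)]) simp_all
  moreover have "ivar s' ''i'' = i"
    using frame_ivar[OF conjunct1[OF inv], of "''i''"] s by simp
  ultimately have w: "tval weight s' = modulus (A i k) + x k"
    using tval_weight j k s(3) by blast
  show "runs (TAssign ''w'' (TMax (TVar ''w'') weight)) s' 16 (\<lambda>s'. ivar s' ''j'' = k \<and> ivar s' ''n'' = n \<and>
      frame [''j''] [] [''w''] [] s (s'\<lparr>ivar := (ivar s')(''j'' := Suc k)\<rparr>) \<and>
      tvar (s'\<lparr>ivar := (ivar s')(''j'' := Suc k)\<rparr>) ''w'' = tmat_vec (Suc k) (mod_mat A) x i)"
  proof (rule runs_loop_free)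
    show "max_cost (TAssign ''w'' (TMax (TVar ''w'') weight)) \<le> 16"
      by (simp add: weight_def)
  qed (use inv j in \<open>simp_all add: w tmat_vec_Suc mod_mat_def frame_def\<close>)
qed (use s n t Q in \<open>auto simp: holds_inputD frame_def tmat_vec_def row_value_def\<close>)


text \<open>Since the row value is an upper bound, one strict comparison decides tightness; the
  machine offers no equality test.\<close>

lemma tight_iff_not_less:
  "j < n \<Longrightarrow> tight n A x i j \<longleftrightarrow> \<not> modulus (A i j) + x j < row_value n A x i"
  using row_value_ge[of j n A i x] by (auto simp: tight_def)

lemma runs_count_loop:
  assumes s: "holds_input m n A c x I s" "ivar s ''i'' = i" "i < m" "tvar s ''w'' = row_value n A x i"
      "iarr s ''cnt'' i = 0" "iarr s ''sum'' i = 0" and n: "1 \<le> n" and t: "n * 50 \<le> t"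
    and Q: "\<And>s'. frame [''j''] [''cnt'', ''sum''] [] [] s s' \<Longrightarrow>
      iarr s' ''cnt'' = (iarr s ''cnt'')(i := card {j. j < n \<and> tight n A x i j}) \<Longrightarrow>
      iarr s' ''sum'' = (iarr s ''sum'')(i := \<Sum>{j. j < n \<and> tight n A x i j}) \<Longrightarrow> Q s'"
  shows "runs count_loop s t Q"
  unfolding count_loop_def
proof -
  let ?T = "\<lambda>k. {j. j < k \<and> tight n A x i j}"
  let ?Inv = "\<lambda>k s'. frame [''j''] [''cnt'', ''sum''] [] [] s s' \<and>
    iarr s' ''cnt'' = (iarr s ''cnt'')(i := card (?T k)) \<and> iarr s' ''sum'' = (iarr s ''sum'')(i := \<Sum>(?T k))"
  let ?p = "Cond (TLess weight (TVar ''w'')) Skip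
     (Seq (IStore ''cnt'' (IVar ''i'') (IAdd (IArr ''cnt'' (IVar ''i'')) (ILit 1)))
          (IStore ''sum'' (IVar ''i'') (IAdd (IArr ''sum'' (IVar ''i'')) (IVar ''j''))))"
  show "runs (For ''j'' ''n'' ?p) s t Q"
  proof (rule runs_For[where B = 36 and Inv = ?Inv])
    fix k s' assume k: "k < n" and inv: "?Inv k s'" and j: "ivar s' ''j'' = k" "ivar s' ''n'' = n"
    have "holds_input m n A c x I s'"
      by (rule holds_input_frame[OF conjunct1[OF inv] s(1)]) simp_all
    moreover have i: "ivar s' ''i'' = i"
      using frame_ivar[OF conjunct1[OF inv], of "''i''"] s by simp
    ultimately have w: "tval weight s' = modulus (A i k) + x k"
      using tval_weight j k s(3) by blast
    have w': "tvar s' ''w'' = row_value n A x i"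
      using frame_tvar[OF conjunct1[OF inv], of "''w''"] s by simp
    have T: "?T (Suc k) = (if tight n A x i k then insert k (?T k) else ?T k)"
      by (auto simp: less_Suc_eq)
    show "runs ?p s' 36 (\<lambda>s'. ivar s' ''j'' = k \<and> ivar s' ''n'' = n \<and>
        ?Inv (Suc k) (s'\<lparr>ivar := (ivar s')(''j'' := Suc k)\<rparr>))"
    proof (rule runs_loop_free)
      show "max_cost ?p \<le> 36"
        by (simp add: weight_def)
    qed (use inv j i s(4) in \<open>simp_all add: w w' T frame_def tight_iff_not_less[OF k] add.commute\<close>)
  next
    show "?Inv 0 (s\<lparr>ivar := (ivar s)(''j'' := 0)\<rparr>)"
      using s(5,6) by (simp add: frame_def fun_upd_idem)
    show "Q s'" if "?Inv n s'" for s'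
      using Q[of s'] that by blast
  qed (use s n t in \<open>simp_all add: holds_inputD\<close>)
qed

lemma runs_find_loop:
  assumes s: "holds_input m n A c x I s" and m: "1 \<le> m" and t: "m * 40 \<le> t"
    and ex: "\<exists>i<m. i \<in> I \<and> iarr s ''cnt'' i = 1"
    and Q: "\<And>s' k. frame [''i'', ''k''] [] [] [] s s' \<Longrightarrow> ivar s' ''k'' = k \<Longrightarrow> k < m \<Longrightarrow> k \<in> I \<Longrightarrow>
      iarr s ''cnt'' k = 1 \<Longrightarrow> Q s'"
  shows "runs find_loop s t Q"
  unfolding find_loop_def
proof -
  let ?ok = "\<lambda>i. i < m \<and> i \<in> I \<and> iarr s ''cnt'' i = 1"
  let ?Inv = "\<lambda>k s'. frame [''i'', ''k''] [] [] [] s s' \<and> ((\<exists>i<k. ?ok i) \<longrightarrow> ?ok (ivar s' ''k''))"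
  let ?p = "Cond (BAnd (ILess (ILit 0) (IArr ''I'' (IVar ''i'')))
        (BAnd (ILess (ILit 0) (IArr ''cnt'' (IVar ''i''))) (ILess (IArr ''cnt'' (IVar ''i'')) (ILit 2))))
     (IAssign ''k'' (IVar ''i'')) Skip"
  show "runs (For ''i'' ''m'' ?p) s t Q"
  proof (rule runs_For[where B = 20 and Inv = ?Inv])
    fix k s' assume k: "k < m" and inv: "?Inv k s'" and i: "ivar s' ''i'' = k" "ivar s' ''m'' = m"
    have h: "iarr s' ''I'' k = (if k \<in> I then 1 else 0)"
      using frame_iarr[OF conjunct1[OF inv], of "''I''"] holds_inputD(7)[OF s k] by simp
    have cnt: "iarr s' ''cnt'' = iarr s ''cnt''"
      using frame_iarr[OF conjunct1[OF inv], of "''cnt''"] by simp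
    show "runs ?p s' 20 (\<lambda>s'. ivar s' ''i'' = k \<and> ivar s' ''m'' = m \<and>
        ?Inv (Suc k) (s'\<lparr>ivar := (ivar s')(''i'' := Suc k)\<rparr>))"
    proof (rule runs_loop_free)
      show "ivar (result ?p s') ''i'' = k \<and> ivar (result ?p s') ''m'' = m \<and>
          ?Inv (Suc k) ((result ?p s')\<lparr>ivar := (ivar (result ?p s'))(''i'' := Suc k)\<rparr>)"
      proof (cases "?ok k")
        case True
        then have "result ?p s' = s'\<lparr>ivar := (ivar s')(''k'' := k)\<rparr>"
          using h i cnt by simp
        then show ?thesis
          using inv i True by (simp add: frame_def)
      next
        case False
        then have "\<not> (k \<in> I \<and> iarr s ''cnt'' k = 1)"
          using k by simp
        then have "result ?p s' = s'"
          using h i cnt by auto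
        moreover have "(\<exists>i<Suc k. ?ok i) \<longleftrightarrow> (\<exists>i<k. ?ok i)"
          using False less_Suc_eq by auto
        ultimately show ?thesis
          using inv i by (simp add: frame_def)
      qed
    qed simp_all
  next
    show "Q s'" if "?Inv m s'" for s'
      using Q[of s' "ivar s' ''k''"] that ex by blast
  qed (use s m t in \<open>simp_all add: holds_inputD frame_def\<close>)
qed

lemma runs_remove_loop:
  assumes s: "holds_input m n A c x I s" "ivar s ''j'' = j" "j < n"
      "\<And>i. i < m \<Longrightarrow> tarr s ''v'' 0 i = row_value n A x i" and m: "1 \<le> m" and t: "m * 50 \<le> t"
    and Q: "\<And>s'. frame [''i''] [''cnt'', ''sum''] [] [] s s' \<Longrightarrow>
      (\<And>i. i < m \<Longrightarrow> iarr s' ''cnt'' i = (if tight n A x i j then iarr s ''cnt'' i - 1 else iarr s ''cnt'' i)) \<Longrightarrow>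
      (\<And>i. i < m \<Longrightarrow> iarr s' ''sum'' i = (if tight n A x i j then iarr s ''sum'' i - j else iarr s ''sum'' i)) \<Longrightarrow>
      Q s'"
  shows "runs remove_loop s t Q"
  unfolding remove_loop_def
proof -
  let ?Inv = "\<lambda>k s'. frame [''i''] [''cnt'', ''sum''] [] [] s s' \<and>
    (\<forall>i<m. iarr s' ''cnt'' i = (if i < k \<and> tight n A x i j then iarr s ''cnt'' i - 1 else iarr s ''cnt'' i) \<and>
      iarr s' ''sum'' i = (if i < k \<and> tight n A x i j then iarr s ''sum'' i - j else iarr s ''sum'' i))"
  let ?p = "Cond (TLess weight (TArr ''v'' (ILit 0) (IVar ''i''))) Skip
     (Seq (IStore ''cnt'' (IVar ''i'') (ISub (IArr ''cnt'' (IVar ''i'')) (ILit 1)))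
          (IStore ''sum'' (IVar ''i'') (ISub (IArr ''sum'' (IVar ''i'')) (IVar ''j''))))"
  show "runs (For ''i'' ''m'' ?p) s t Q"
  proof (rule runs_For[where B = 36 and Inv = ?Inv])
    fix k s' assume k: "k < m" and inv: "?Inv k s'" and i: "ivar s' ''i'' = k" "ivar s' ''m'' = m"
    have "holds_input m n A c x I s'"
      by (rule holds_input_frame[OF conjunct1[OF inv] s(1)]) simp_all
    moreover have j: "ivar s' ''j'' = j"
      using frame_ivar[OF conjunct1[OF inv], of "''j''"] s by simp
    ultimately have w: "tval weight s' = modulus (A k j) + x j"
      using tval_weight i k s(3) by blast
    have v: "tarr s' ''v'' 0 k = row_value n A x k"
      using frame_tarr[OF conjunct1[OF inv], of "''v''"] s(4)[OF k] by simp
    show "runs ?p s' 36 (\<lambda>s'. ivar s' ''i'' = k \<and> ivar s' ''m'' = m \<and>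
        ?Inv (Suc k) (s'\<lparr>ivar := (ivar s')(''i'' := Suc k)\<rparr>))"
    proof (rule runs_loop_free)
      show "max_cost ?p \<le> 36"
        by (simp add: weight_def)
      show "ivar (result ?p s') ''i'' = k \<and> ivar (result ?p s') ''m'' = m \<and>
          ?Inv (Suc k) ((result ?p s')\<lparr>ivar := (ivar (result ?p s'))(''i'' := Suc k)\<rparr>)"
      proof (cases "tight n A x k j")
        case True
        then have "result ?p s' = s'\<lparr>iarr := (iarr s')(''cnt'' := (iarr s' ''cnt'')(k := iarr s' ''cnt'' k - 1),
            ''sum'' := (iarr s' ''sum'')(k := iarr s' ''sum'' k - j))\<rparr>"
          using tight_iff_not_less[OF s(3)] by (simp add: w v i j)
        then show ?thesis
          using inv i True k by (simp add: frame_def less_Suc_eq)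
      next
        case False
        then have "result ?p s' = s'"
          using tight_iff_not_less[OF s(3)] by (simp add: w v i)
        moreover have "i < Suc k \<and> tight n A x i j \<longleftrightarrow> i < k \<and> tight n A x i j" for i
          using False less_Suc_eq by auto
        ultimately show ?thesis
          using inv i by (simp add: frame_def)
      qed
    qed simp
  next
    show "Q s'" if "?Inv m s'" for s'
      using Q[of s'] that by simp
  qed (use s m t in \<open>simp_all add: holds_inputD frame_def\<close>)
qed

section \<open>The program computes the matching\<close>

context basic_setting
begin

definition rows_ok :: "nat set \<Rightarrow> nat \<Rightarrow> state \<Rightarrow> bool" where
  "rows_ok U k s \<longleftrightarrow> (\<forall>i<k. tarr s ''v'' 0 i = row_value n A x i \<and>
     iarr s ''cnt'' i = card (open_columns U i) \<and> iarr s ''sum'' i = \<Sum>(open_columns U i))"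

lemma runs_row_phase:
  assumes s: "holds_input m n A c x I s" and n: "1 \<le> n" and m: "1 \<le> m" and t: "m * (n * 130) \<le> t"
    and Q: "\<And>s'. holds_input m n A c x I s' \<Longrightarrow> rows_ok {} m s' \<Longrightarrow> Q s'"
  shows "runs row_phase s t Q"
  unfolding row_phase_def
\<comment> \<open>The body costs at most \<open>n * 30 + n * 50 + 22\<close>, within
  \<open>n * 116\<close> for \<open>n \<ge> 1\<close>; the overhead 14 brings this to
  \<open>n * 130\<close>.\<close>
proof (rule runs_For[where B = "n * 116" and Inv = "\<lambda>k s. holds_input m n A c x I s \<and> rows_ok {} k s"])
  let ?st = "Seq (TStore ''v'' (ILit 0) (IVar ''i'') (TVar ''w''))
          (Seq (IStore ''cnt'' (IVar ''i'') (ILit 0)) (IStore ''sum'' (IVar ''i'') (ILit 0)))"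
  fix k s assume k: "k < m" and inv: "holds_input m n A c x I s \<and> rows_ok {} k s"
    and i: "ivar s ''i'' = k" "ivar s ''m'' = m"
  let ?Post = "\<lambda>s'. ivar s' ''i'' = k \<and> ivar s' ''m'' = m \<and>
      holds_input m n A c x I (s'\<lparr>ivar := (ivar s')(''i'' := Suc k)\<rparr>) \<and>
      rows_ok {} (Suc k) (s'\<lparr>ivar := (ivar s')(''i'' := Suc k)\<rparr>)"
  define s1 where "s1 = s\<lparr>tvar := (tvar s)(''w'' := NegInf)\<rparr>"
  have s1: "holds_input m n A c x I s1" "ivar s1 ''i'' = k" "tvar s1 ''w'' = NegInf"
    using inv i by (simp_all add: s1_def holds_input_def)
  have *: "runs (Seq ?st count_loop) s2 (n * 50 + 20) ?Post"
    if fr: "frame [''j''] [] [''w''] [] s1 s2" and w: "tvar s2 ''w'' = row_value n A x k" for s2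
  proof (rule runs_Seq[where t = 20 and u = "n * 50"])
    define s3 where "s3 = result ?st s2"
    have i2: "ivar s2 ''i'' = k"
      using frame_ivar[OF fr, of "''i''"] s1 by simp
    have s3: "tarr s3 = (tarr s2)(''v'' := (tarr s2 ''v'')(0 := (tarr s2 ''v'' 0)(k := row_value n A x k)))"
      "iarr s3 = (iarr s2)(''cnt'' := (iarr s2 ''cnt'')(k := 0), ''sum'' := (iarr s2 ''sum'')(k := 0))"
      "ivar s3 = ivar s2" "tvar s3 = tvar s2"
      by (simp_all add: s3_def i2 w)
    have h3: "holds_input m n A c x I s3"
      by (rule holds_input_frame[where X = "[''j'']" and Y = "[''cnt'', ''sum'']" and Z = "[''w'']"
            and W = "[''v'']", OF _ s1(1)]) (use fr in \<open>simp_all add: frame_def s3\<close>)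
    have "runs count_loop s3 (n * 50) ?Post"
    proof (rule runs_count_loop[OF h3 _ k _ _ _ n])
      fix s4 assume fr4: "frame [''j''] [''cnt'', ''sum''] [] [] s3 s4"
        and cnt: "iarr s4 ''cnt'' = (iarr s3 ''cnt'')(k := card {j. j < n \<and> tight n A x k j})"
        and sum: "iarr s4 ''sum'' = (iarr s3 ''sum'')(k := \<Sum>{j. j < n \<and> tight n A x k j})"
      let ?s = "s4\<lparr>ivar := (ivar s4)(''i'' := Suc k)\<rparr>"
      have "holds_input m n A c x I ?s"
        by (rule holds_input_frame[where X = "[''i'', ''j'']" and Y = "[''cnt'', ''sum'']" and Z = "[''w'']"
              and W = "[''v'']", OF _ h3]) (use fr4 in \<open>simp_all add: frame_def\<close>)
      moreover have "rows_ok {} (Suc k) ?s"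
        unfolding rows_ok_def
      proof (intro allI impI)
        fix i assume "i < Suc k"
        have v4: "tarr s4 ''v'' = tarr s3 ''v''"
          using fr4 by (simp add: frame_def)
        have old: "tarr s2 ''v'' = tarr s ''v''" "iarr s2 = iarr s"
          using frame_tarr_Nil[OF fr] frame_iarr_Nil[OF fr] by (simp_all add: s1_def)
        show "tarr ?s ''v'' 0 i = row_value n A x i \<and> iarr ?s ''cnt'' i = card (open_columns {} i) \<and>
            iarr ?s ''sum'' i = \<Sum> (open_columns {} i)"
        proof (cases "i = k")
          case True
          then show ?thesis
            by (simp add: v4 s3 cnt sum open_columns_def)
        next
          case False
          then have "i < k"
            using \<open>i < Suc k\<close> by simp
          then show ?thesis
            using inv False by (simp add: v4 s3 cnt sum old rows_ok_def)
        qed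
      qed
      moreover have "ivar s4 ''i'' = k" "ivar s4 ''m'' = m"
        using fr4 fr i by (simp_all add: frame_def s3 s1_def)
      ultimately show "?Post s4"
        by simp
    qed (use i2 w in \<open>simp_all add: s3\<close>)
    then show "runs ?st s2 20 (\<lambda>s3. runs count_loop s3 (n * 50) ?Post)"
      by - (rule runs_loop_free, simp_all add: s3_def)
  qed simp
  have "runs (Seq max_loop (Seq ?st count_loop)) s1 (n * 30 + (n * 50 + 20)) ?Post"
    by (rule runs_Seq[OF runs_max_loop[OF s1(1,2) k s1(3) n order_refl *]]) simp_all
  then have "runs (TAssign ''w'' TNegInf) s 2
      (\<lambda>s1. runs (Seq max_loop (Seq ?st count_loop)) s1 (n * 30 + (n * 50 + 20)) ?Post)"
    by - (rule runs_loop_free, simp_all add: s1_def)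
  then show "runs (Seq (TAssign ''w'' TNegInf) (Seq max_loop (Seq ?st count_loop))) s (n * 116) ?Post"
    by (rule runs_Seq) (use n in linarith)
next
  show "m * (n * 116 + 14) \<le> t"
    using n by (intro order_trans[OF mult_le_mono2 t]) linarith
  show "holds_input m n A c x I (s\<lparr>ivar := (ivar s)(''i'' := 0)\<rparr>) \<and>
      rows_ok {} 0 (s\<lparr>ivar := (ivar s)(''i'' := 0)\<rparr>)"
    using s by (simp add: holds_input_def rows_ok_def)
qed (use s m Q in \<open>simp_all add: holds_inputD\<close>)

lemma runs_match_phase:
  assumes s: "holds_input m n A c x I s" "rows_ok {} m s" and n: "1 \<le> n" and m: "1 \<le> m"
    and t: "n * (m * 130) \<le> t"
    and Q: "\<And>s'. holds_input m n A c x I s' \<Longrightarrow>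
      matched_rows m n A I x (row_value n A x) (iarr s' ''rho'') \<Longrightarrow> Q s'"
  shows "runs match_phase s t Q"
  unfolding match_phase_def
proof -
  \<comment> \<open>The set \<open>U\<close> exists only in the invariant. Entries of the array
    \<open>rho\<close> outside \<open>U\<close> are arbitrary.\<close>
  let ?Inv = "\<lambda>r s. holds_input m n A c x I s \<and>
    (\<exists>U. partial_matching U (iarr s ''rho'') \<and> card U = r \<and> rows_ok U m s)"
  let ?st = "Seq (IAssign ''j'' (IArr ''sum'' (IVar ''k''))) (IStore ''rho'' (IVar ''j'') (IVar ''k''))"
  show "runs (For ''r'' ''n'' (Seq find_loop (Seq ?st remove_loop))) s t Q"
  proof (rule runs_For[where B = "m * 110" and Inv = ?Inv])
    fix r s assume r: "r < n" and inv: "?Inv r s" and var: "ivar s ''r'' = r" "ivar s ''n'' = n"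
    let ?Post = "\<lambda>s'. ivar s' ''r'' = r \<and> ivar s' ''n'' = n \<and> ?Inv (Suc r) (s'\<lparr>ivar := (ivar s')(''r'' := Suc r)\<rparr>)"
    have h: "holds_input m n A c x I s"
      using inv by blast
    obtain U where U: "partial_matching U (iarr s ''rho'')" "card U = r" "rows_ok U m s"
      using inv by blast
    obtain i where "i \<in> I" "card (open_columns U i) = 1"
      using ex_matchable_row[OF U(1)] U(2) r by blast
    then have ex: "\<exists>i<m. i \<in> I \<and> iarr s ''cnt'' i = 1"
      using U(3) I_sub by (intro exI[of _ i]) (auto simp: rows_ok_def)
    have *: "runs (Seq ?st remove_loop) s1 (m * 50 + 8) ?Post"
      if fr: "frame [''i'', ''k''] [] [] [] s s1" and k: "ivar s1 ''k'' = k" "k < m" "k \<in> I"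
        "iarr s ''cnt'' k = 1" for s1 k
    proof (rule runs_Seq[where t = 8 and u = "m * 50"])
      have "card (open_columns U k) = 1"
        using U(3) k by (simp add: rows_ok_def)
      then obtain j where j: "open_columns U k = {j}"
        using card_1_singletonE by blast
      have step: "partial_matching (insert j U) ((iarr s ''rho'')(j := k))" "j < n" "j \<notin> U"
        using partial_matching_step[OF U(1) k(3) j] by auto
      have sum: "iarr s1 ''sum'' k = j"
        using U(3) k(2) j frame_iarr[OF fr, of "''sum''"] by (simp add: rows_ok_def)
      define s2 where "s2 = result ?st s1"
      have s2: "ivar s2 = (ivar s1)(''j'' := j)" "iarr s2 = (iarr s1)(''rho'' := (iarr s1 ''rho'')(j := k))"
        "tvar s2 = tvar s1" "tarr s2 = tarr s1"
        by (simp_all add: s2_def sum k)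
      have old: "iarr s1 = iarr s" "tarr s1 = tarr s"
        by (rule frame_iarr_Nil[OF fr], rule frame_tarr_Nil[OF fr])
      have h2: "holds_input m n A c x I s2"
        by (rule holds_input_frame[where X = "[''i'', ''j'', ''k'']" and Y = "[''rho'']" and Z = "[]" and W = "[]", OF _ h])
          (use fr in \<open>simp_all add: frame_def s2\<close>)
      have "runs remove_loop s2 (m * 50) ?Post"
      proof (rule runs_remove_loop[OF h2 _ step(2) _ m])
        show "tarr s2 ''v'' 0 i = row_value n A x i" if "i < m" for i
          using U(3) that by (simp add: s2 old rows_ok_def)
        fix s3 assume fr3: "frame [''i''] [''cnt'', ''sum''] [] [] s2 s3"
          and c3: "\<And>i. i < m \<Longrightarrow> iarr s3 ''cnt'' i =
            (if tight n A x i j then iarr s2 ''cnt'' i - 1 else iarr s2 ''cnt'' i)"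
          and m3: "\<And>i. i < m \<Longrightarrow> iarr s3 ''sum'' i =
            (if tight n A x i j then iarr s2 ''sum'' i - j else iarr s2 ''sum'' i)"
        let ?s = "s3\<lparr>ivar := (ivar s3)(''r'' := Suc r)\<rparr>"
        have "holds_input m n A c x I ?s"
          by (rule holds_input_frame[where X = "[''i'', ''r'']" and Y = "[''cnt'', ''sum'']" and Z = "[]"
                and W = "[]", OF _ h2]) (use fr3 in \<open>simp_all add: frame_def\<close>)
        moreover have "partial_matching (insert j U) (iarr ?s ''rho'')"
          using step(1) fr3 by (simp add: frame_def s2 old)
        moreover have "card (insert j U) = Suc r"
          using U(1,2) step(3) finite_subset[of U "{..<n}"] by (simp add: partial_matching_def)
        moreover have "rows_ok (insert j U) m ?s"
          unfolding rows_ok_def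
        proof (intro allI impI)
          fix i assume i: "i < m"
          have v: "tarr s3 ''v'' 0 i = row_value n A x i"
            using U(3) i fr3 by (simp add: frame_def s2 old rows_ok_def)
          have fin: "finite (open_columns U i)"
            by (simp add: open_columns_def)
          have eq: "open_columns (insert j U) i = open_columns U i - {j}"
            by (auto simp: open_columns_def)
          \<comment> \<open>Because \<open>j\<close> was still open, tightness at \<open>j\<close>
            means membership in \<open>open_columns U i\<close>; so the truncated subtractions from
            \<open>cnt\<close> and \<open>sum\<close> are exact.\<close>
          have mem: "j \<in> open_columns U i \<longleftrightarrow> tight n A x i j"
            using step by (simp add: open_columns_def)
          show "tarr ?s ''v'' 0 i = row_value n A x i \<and>
            iarr ?s ''cnt'' i = card (open_columns (insert j U) i) \<and>
            iarr ?s ''sum'' i = \<Sum> (open_columns (insert j U) i)"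
            using U(3) i v fin mem
            by (simp add: c3 m3 s2 old rows_ok_def eq card_Diff_singleton_if sum_diff1_nat)
        qed
        moreover have "ivar s3 ''r'' = r" "ivar s3 ''n'' = n"
          using fr3 fr var by (simp_all add: frame_def s2)
        ultimately show "?Post s3"
          by blast
      qed (simp_all add: s2)
      then show "runs ?st s1 8 (\<lambda>s2. runs remove_loop s2 (m * 50) ?Post)"
        by - (rule runs_loop_free, simp_all add: s2_def)
    qed simp
    show "runs (Seq find_loop (Seq ?st remove_loop)) s (m * 110) ?Post"
      by (rule runs_Seq[OF runs_find_loop[OF h m order_refl ex *]]) (use m in simp_all)
  next
    have "partial_matching {} (iarr s ''rho'')"
      by (simp add: partial_matching_def)
    then show "?Inv 0 (s\<lparr>ivar := (ivar s)(''r'' := 0)\<rparr>)"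
      using s by (intro conjI exI[of _ "{}"]) (simp_all add: holds_input_def rows_ok_def)
    show "n * (m * 110 + 14) \<le> t"
      using m by (intro order_trans[OF mult_le_mono2 t]) linarith
    show "Q s" if "?Inv n s" for s
      using that partial_matching_full Q by blast
  qed (use s n in \<open>simp_all add: holds_inputD\<close>)
qed

end

section \<open>Initialisation, selection and relaxation\<close>

lemma runs_init_y:
  assumes s: "ivar s ''m'' = m" and m: "1 \<le> m" and t: "m * 30 \<le> t"
    and Q: "\<And>s'. frame [''i''] [] [] [''y+'', ''y-''] s s' \<Longrightarrow>
      (\<And>i. i < m \<Longrightarrow> tarr s' ''y+'' 0 i = NegInf) \<Longrightarrow> (\<And>i. i < m \<Longrightarrow> tarr s' ''y-'' 0 i = NegInf) \<Longrightarrow> Q s'"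
  shows "runs init_y s t Q"
  unfolding init_y_def
proof (rule runs_For[where B = 16 and Inv = "\<lambda>k s'. frame [''i''] [] [] [''y+'', ''y-''] s s' \<and>
    (\<forall>i<k. tarr s' ''y+'' 0 i = NegInf \<and> tarr s' ''y-'' 0 i = NegInf)"])
  show "Q s'" if "frame [''i''] [] [] [''y+'', ''y-''] s s' \<and>
    (\<forall>i<m. tarr s' ''y+'' 0 i = NegInf \<and> tarr s' ''y-'' 0 i = NegInf)" for s'
    using Q[of s'] that by blast
qed (use s m t in \<open>auto simp: frame_def less_Suc_eq intro!: runs_loop_free\<close>)

lemma runs_init_columns:
  assumes s: "holds_input m n A c x I s" and n: "1 \<le> n" and t: "n * 40 \<le> t"
    and Q: "\<And>s'. frame [''j''] [''done''] [] [''p'', ''q''] s s' \<Longrightarrow>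
      (\<And>j. j < n \<Longrightarrow> tarr s' ''p'' 0 j = c j \<and> tarr s' ''q'' 0 j = NegInf \<and> iarr s' ''done'' j = 0) \<Longrightarrow> Q s'"
  shows "runs init_columns s t Q"
  unfolding init_columns_def
proof (rule runs_For[where B = 26 and Inv = "\<lambda>k s'. frame [''j''] [''done''] [] [''p'', ''q''] s s' \<and>
    (\<forall>j<k. tarr s' ''p'' 0 j = c j \<and> tarr s' ''q'' 0 j = NegInf \<and> iarr s' ''done'' j = 0)"])
  show "Q s'" if "frame [''j''] [''done''] [] [''p'', ''q''] s s' \<and>
    (\<forall>j<n. tarr s' ''p'' 0 j = c j \<and> tarr s' ''q'' 0 j = NegInf \<and> iarr s' ''done'' j = 0)" for s'
    using Q[of s'] that by blast
qed (use holds_inputD(2,5)[OF s] n t in \<open>auto simp: frame_def less_Suc_eq intro!: runs_loop_free\<close>)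

lemma runs_select_loop:
  assumes s: "holds_input m n A c x I s" "tvar s ''w'' = NegInf"
      "\<And>j. j < n \<Longrightarrow> tarr s ''p'' 0 j = pos_part (\<omega> j) \<and> tarr s ''q'' 0 j = neg_part (\<omega> j) \<and>
        iarr s ''done'' j = (if j \<in> S then 1 else 0)"
    and ex: "\<exists>j<n. j \<notin> S" and n: "1 \<le> n" and t: "n * 50 \<le> t"
    and Q: "\<And>s' k. frame [''j'', ''k''] [] [''w''] [] s s' \<Longrightarrow> ivar s' ''k'' = k \<Longrightarrow> k < n \<Longrightarrow> k \<notin> S \<Longrightarrow>
      (\<And>j. j < n \<Longrightarrow> j \<notin> S \<Longrightarrow> modulus (\<omega> j) + x j \<le> modulus (\<omega> k) + x k) \<Longrightarrow> Q s'"
  shows "runs select_loop s t Q"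
  unfolding select_loop_def
proof -
  let ?key = "\<lambda>j. modulus (\<omega> j) + x j"
  \<comment> \<open>Having \<open>w\<close> equal to \<open>NegInf\<close> does not mean that
    nothing has been selected, as keys may be \<open>NegInf\<close>; the first alternative therefore
    also requires that no unsettled column has been scanned.\<close>
  let ?best = "\<lambda>l s'. (\<forall>j<l. j \<notin> S \<longrightarrow> ?key j \<le> tvar s' ''w'') \<and>
    (tvar s' ''w'' = NegInf \<and> (\<forall>j<l. j \<in> S) \<or>
     ivar s' ''k'' < n \<and> ivar s' ''k'' \<notin> S \<and> tvar s' ''w'' = ?key (ivar s' ''k''))"
  let ?Inv = "\<lambda>l s'. frame [''j'', ''k''] [] [''w''] [] s s' \<and> ?best l s'"
  let ?p = "Cond (BAnd (ILess (IArr ''done'' (IVar ''j'')) (ILit 1)) (BNot (TLess key (TVar ''w''))))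
     (Seq (TAssign ''w'' key) (IAssign ''k'' (IVar ''j''))) Skip"
  show "runs (For ''j'' ''n'' ?p) s t Q"
  proof (rule runs_For[where B = 36 and Inv = ?Inv])
    fix l s' assume l: "l < n" and inv: "?Inv l s'" and j: "ivar s' ''j'' = l" "ivar s' ''n'' = n"
    have key: "tval key s' = ?key l"
      using inv s(3)[OF l] holds_inputD(6)[OF s(1) l] j by (simp add: key_def frame_def modulus_eq_max)
    have "iarr s' ''done'' l = (if l \<in> S then 1 else 0)"
      using inv s(3)[OF l] by (simp add: frame_def)
    then have cond: "bval (BAnd (ILess (IArr ''done'' (IVar ''j'')) (ILit 1)) (BNot (TLess key (TVar ''w'')))) s'
        \<longleftrightarrow> l \<notin> S \<and> tvar s' ''w'' \<le> ?key l"
      using j key by auto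
    show "runs ?p s' 36 (\<lambda>s'. ivar s' ''j'' = l \<and> ivar s' ''n'' = n \<and>
        ?Inv (Suc l) (s'\<lparr>ivar := (ivar s')(''j'' := Suc l)\<rparr>))"
    proof (rule runs_loop_free)
      show "ivar (result ?p s') ''j'' = l \<and> ivar (result ?p s') ''n'' = n \<and>
          ?Inv (Suc l) ((result ?p s')\<lparr>ivar := (ivar (result ?p s'))(''j'' := Suc l)\<rparr>)"
      proof (cases "l \<notin> S \<and> tvar s' ''w'' \<le> ?key l")
        case True
        then have "result ?p s' = s'\<lparr>tvar := (tvar s')(''w'' := ?key l), ivar := (ivar s')(''k'' := l)\<rparr>"
          using cond key j by simp
        moreover have "\<forall>j<Suc l. j \<notin> S \<longrightarrow> ?key j \<le> ?key l"
          using conjunct2[OF inv] True by (auto simp: less_Suc_eq intro: order_trans)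
        ultimately show ?thesis
          using conjunct1[OF inv] j True l by (simp add: frame_def)
      next
        case False
        then have "result ?p s' = s'"
          using cond by (auto simp del: bval.simps)
        moreover have "?best (Suc l) s'"
          using conjunct2[OF inv] False by (auto simp: less_Suc_eq)
        ultimately show ?thesis
          using conjunct1[OF inv] j by (simp add: frame_def)
      qed
    qed (simp_all add: key_def)
  next
    show "Q s'" if "?Inv n s'" for s'
    proof -
      have "ivar s' ''k'' < n \<and> ivar s' ''k'' \<notin> S \<and> tvar s' ''w'' = ?key (ivar s' ''k'')"
        using that ex by blast
      then show ?thesis
        using that by (intro Q[of s' "ivar s' ''k''"]) auto
    qed
  qed (use holds_inputD(2)[OF s(1)] s(2) n t in \<open>simp_all add: frame_def\<close>)
qed

lemma pos_part_smult: "pos_part (smult a b) = max (pos_part a + pos_part b) (neg_part a + neg_part b)"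
  and neg_part_smult: "neg_part (smult a b) = max (pos_part a + neg_part b) (neg_part a + pos_part b)"
  and pos_part_sdiv: "pos_part (sdiv a b) = max (tdiv (pos_part a) (pos_part b)) (tdiv (neg_part a) (neg_part b))"
  and neg_part_sdiv: "neg_part (sdiv a b) = max (tdiv (neg_part a) (pos_part b)) (tdiv (pos_part a) (neg_part b))"
  and pos_part_sneg: "pos_part (sneg a) = neg_part a" and neg_part_sneg: "neg_part (sneg a) = pos_part a"
  by (cases a; cases b; simp)+

lemma runs_relax_loop:
  assumes s: "holds_input m n A c x I s" "ivar s ''i'' = i" "i < m"
      "tarr s ''y+'' 0 i = pos_part y" "tarr s ''y-'' 0 i = neg_part y"
      "\<And>j. j < n \<Longrightarrow> tarr s ''p'' 0 j = pos_part (\<omega> j) \<and> tarr s ''q'' 0 j = neg_part (\<omega> j)"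
    and n: "1 \<le> n" and t: "n * 80 \<le> t"
    and \<omega>': "\<And>j. \<omega>' j = (if modulus (\<omega> j) < modulus (smult (A i j) y) then sneg (smult (A i j) y) else \<omega> j)"
    and Q: "\<And>s'. frame [''j''] [] [''a'', ''b''] [''p'', ''q''] s s' \<Longrightarrow>
      (\<And>j. j < n \<Longrightarrow> tarr s' ''p'' 0 j = pos_part (\<omega>' j) \<and> tarr s' ''q'' 0 j = neg_part (\<omega>' j)) \<Longrightarrow> Q s'"
  shows "runs relax_loop s t Q"
  unfolding relax_loop_def
proof -
  let ?Inv = "\<lambda>l s'. frame [''j''] [] [''a'', ''b''] [''p'', ''q''] s s' \<and>
    (\<forall>j<n. tarr s' ''p'' 0 j = pos_part (if j < l then \<omega>' j else \<omega> j) \<and>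
      tarr s' ''q'' 0 j = neg_part (if j < l then \<omega>' j else \<omega> j))"
  let ?p = "Seq (TAssign ''a'' (mul ''y+'' ''y-''))
     (Seq (TAssign ''b'' (mul ''y-'' ''y+''))
     (Cond (TLess (TMax (TArr ''p'' (ILit 0) (IVar ''j'')) (TArr ''q'' (ILit 0) (IVar ''j'')))
              (TMax (TVar ''a'') (TVar ''b'')))
        (Seq (TStore ''p'' (ILit 0) (IVar ''j'') (TVar ''b''))
             (TStore ''q'' (ILit 0) (IVar ''j'') (TVar ''a''))) Skip))"
  show "runs (For ''j'' ''n'' ?p) s t Q"
  proof (rule runs_For[where B = 66 and Inv = ?Inv])
    fix l s' assume l: "l < n" and inv: "?Inv l s'" and j: "ivar s' ''j'' = l" "ivar s' ''n'' = n"
    let ?q = "smult (A i l) y"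
    define s1 where "s1 = s'\<lparr>tvar := (tvar s')(''a'' := pos_part ?q, ''b'' := neg_part ?q)\<rparr>"
    have i: "ivar s' ''i'' = i"
      using inv s(2) by (simp add: frame_def)
    have ab: "tval (mul ''y+'' ''y-'') s' = pos_part ?q"
      "tval (mul ''y-'' ''y+'') (s'\<lparr>tvar := (tvar s')(''a'' := pos_part ?q)\<rparr>) = neg_part ?q"
      using inv s(2,4,5) holds_inputD(3,4)[OF s(1,3) l] j i
      by (simp_all add: mul_def frame_def pos_part_smult neg_part_smult)
    have pq: "tarr s' ''p'' 0 l = pos_part (\<omega> l)" "tarr s' ''q'' 0 l = neg_part (\<omega> l)"
      using inv l by auto
    have res: "result ?p s' = (if modulus (\<omega> l) < modulus ?q
      then s1\<lparr>tarr := (tarr s')(''p'' := (tarr s' ''p'')(0 := (tarr s' ''p'' 0)(l := neg_part ?q)),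
        ''q'' := (tarr s' ''q'')(0 := (tarr s' ''q'' 0)(l := pos_part ?q)))\<rparr> else s1)"
      using ab pq j by (simp add: s1_def modulus_eq_max)
    show "runs ?p s' 66 (\<lambda>s'. ivar s' ''j'' = l \<and> ivar s' ''n'' = n \<and>
        ?Inv (Suc l) (s'\<lparr>ivar := (ivar s')(''j'' := Suc l)\<rparr>))"
    proof (rule runs_loop_free)
      show "ivar (result ?p s') ''j'' = l \<and> ivar (result ?p s') ''n'' = n \<and>
          ?Inv (Suc l) ((result ?p s')\<lparr>ivar := (ivar (result ?p s'))(''j'' := Suc l)\<rparr>)"
      proof (cases "modulus (\<omega> l) < modulus ?q")
        case True
        have "\<omega>' l = sneg ?q"
          using True \<omega>'[of l] by simp
        then show ?thesis
          unfolding res using True inv j l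
          by (simp add: s1_def frame_def less_Suc_eq pos_part_sneg neg_part_sneg)
      next
        case False
        have "\<omega>' l = \<omega> l"
          using False \<omega>'[of l] by simp
        then have "(if j < Suc l then \<omega>' j else \<omega> j) = (if j < l then \<omega>' j else \<omega> j)" for j
          by (auto simp: less_Suc_eq)
        then show ?thesis
          unfolding res using False inv j
          by (simp add: s1_def frame_def)
      qed
    qed (simp_all add: mul_def)
  next
    show "Q s'" if "?Inv n s'" for s'
      using Q[of s'] that by simp
  qed (use holds_inputD(2)[OF s(1)] s(6) n t in \<open>simp_all add: frame_def\<close>)
qed

section \<open>The program maintains Dijkstra's invariant\<close>

context matched_rows
begin

definition holds_settled :: "nat set \<Rightarrow> (nat \<Rightarrow> strop) \<Rightarrow> (nat \<Rightarrow> strop) \<Rightarrow> state \<Rightarrow> bool" where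
  "holds_settled S \<omega> y s \<longleftrightarrow> (\<forall>j<n. tarr s ''p'' 0 j = pos_part (\<omega> j) \<and> tarr s ''q'' 0 j = neg_part (\<omega> j) \<and>
     iarr s ''done'' j = (if j \<in> S then 1 else 0) \<and> iarr s ''rho'' j = \<rho> j) \<and>
     (\<forall>i<m. tarr s ''y+'' 0 i = pos_part (y i) \<and> tarr s ''y-'' 0 i = neg_part (y i))"

lemma runs_settle_phase:
  assumes s: "holds_input m n A c x I s" "holds_settled {} (\<lambda>j. of_trop (c j)) (\<lambda>i. SNegInf) s"
    and n: "1 \<le> n" and t: "n * (n * 210) \<le> t"
    and Q: "\<And>s' y. is_reduced_costs m n A c I y \<Longrightarrow> holds_output m y s' \<Longrightarrow> Q s'"
  shows "runs settle_phase s t Q"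
  unfolding settle_phase_def
proof -
  let ?Inv = "\<lambda>r s. holds_input m n A c x I s \<and>
    (\<exists>S \<omega> y. settled S \<omega> y \<and> card S = r \<and> holds_settled S \<omega> y s)"
  let ?st = "Seq (IAssign ''i'' (IArr ''rho'' (IVar ''k'')))
          (Seq (IStore ''done'' (IVar ''k'') (ILit 1))
          (Seq (TStore ''y+'' (ILit 0) (IVar ''i'') (quot ''p'' ''q''))
               (TStore ''y-'' (ILit 0) (IVar ''i'') (quot ''q'' ''p''))))"
  show "runs (For ''r'' ''n'' (Seq (TAssign ''w'' TNegInf) (Seq select_loop (Seq ?st relax_loop)))) s t Q"
  \<comment> \<open>192 = 50 + 80 + 60 + 2: selection, relaxation, the assignments between them and
    the reset of \<open>w\<close>.\<close>
  proof (rule runs_For[where B = "n * 192" and Inv = ?Inv])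
    fix r s assume r: "r < n" and inv: "?Inv r s" and var: "ivar s ''r'' = r" "ivar s ''n'' = n"
    let ?Post = "\<lambda>s'. ivar s' ''r'' = r \<and> ivar s' ''n'' = n \<and> ?Inv (Suc r) (s'\<lparr>ivar := (ivar s')(''r'' := Suc r)\<rparr>)"
    have h: "holds_input m n A c x I s"
      using inv by blast
    obtain S \<omega> y where st: "settled S \<omega> y" "card S = r" "holds_settled S \<omega> y s"
      using inv by blast
    have S: "S \<subseteq> {..<n}"
      using st(1) by (simp add: settled_def)
    then have ex: "\<exists>j<n. j \<notin> S"
      using st(2) r by (metis card_lessThan lessThan_iff nat_neq_iff subsetI subset_antisym)
    define s1 where "s1 = s\<lparr>tvar := (tvar s)(''w'' := NegInf)\<rparr>"
    have h1: "holds_input m n A c x I s1"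
      using h by (simp add: s1_def holds_input_def)
    have hs1: "tarr s1 ''p'' 0 j = pos_part (\<omega> j) \<and> tarr s1 ''q'' 0 j = neg_part (\<omega> j) \<and>
        iarr s1 ''done'' j = (if j \<in> S then 1 else 0)" if "j < n" for j
      using st(3) that by (simp add: holds_settled_def s1_def)
    have *: "runs (Seq ?st relax_loop) s2 (n * 80 + 60) ?Post"
      if fr: "frame [''j'', ''k''] [] [''w''] [] s1 s2" and k: "ivar s2 ''k'' = k" "k < n" "k \<notin> S"
        "\<And>j. j < n \<Longrightarrow> j \<notin> S \<Longrightarrow> modulus (\<omega> j) + x j \<le> modulus (\<omega> k) + x k" for s2 k
    proof (rule runs_Seq[where t = 60 and u = "n * 80"])
      define y' where "y' = y(\<rho> k := sdiv (\<omega> k) (A (\<rho> k) k))"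
      define \<omega>' where "\<omega>' j = (if modulus (\<omega> j) < modulus (smult (A (\<rho> k) j) (y' (\<rho> k)))
        then sneg (smult (A (\<rho> k) j) (y' (\<rho> k))) else \<omega> j)" for j
      have st': "settled (insert k S) \<omega>' y'"
        by (rule settled_step[OF st(1) k(2-4) y'_def \<omega>'_def])
      have old: "iarr s2 = iarr s" "tarr s2 = tarr s"
        using frame_iarr_Nil[OF fr] frame_tarr_Nil[OF fr] by (simp_all add: s1_def)
      have h2: "holds_input m n A c x I s2"
        by (rule holds_input_frame[OF fr h1]) simp_all
      have rho: "iarr s2 ''rho'' k = \<rho> k" and pq: "tarr s2 ''p'' 0 k = pos_part (\<omega> k)"
        "tarr s2 ''q'' 0 k = neg_part (\<omega> k)"
        using st(3) k(2) by (simp_all add: holds_settled_def old)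
      note A2 = holds_inputD(3,4)[OF h2 \<rho>_less[OF k(2)] k(2)]
      define s3 where "s3 = result ?st s2"
      have s3: "ivar s3 = (ivar s2)(''i'' := \<rho> k)" "iarr s3 = (iarr s2)(''done'' := (iarr s2 ''done'')(k := 1))"
        "tvar s3 = tvar s2"
        "tarr s3 = (tarr s2)(''y+'' := (tarr s2 ''y+'')(0 := (tarr s2 ''y+'' 0)(\<rho> k := pos_part (y' (\<rho> k)))),
          ''y-'' := (tarr s2 ''y-'')(0 := (tarr s2 ''y-'' 0)(\<rho> k := neg_part (y' (\<rho> k)))))"
        using A2 pq by (simp_all add: s3_def rho k(1) quot_def y'_def pos_part_sdiv neg_part_sdiv)
      have h3: "holds_input m n A c x I s3"
        by (rule holds_input_frame[where X = "[''i'']" and Y = "[''done'']" and Z = "[]" and W = "[''y+'', ''y-'']", OF _ h2])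
          (simp_all add: frame_def s3)
      have "runs relax_loop s3 (n * 80) ?Post"
      proof (rule runs_relax_loop[OF h3 _ \<rho>_less[OF k(2)] _ _ _ n order_refl \<omega>'_def])
        show "tarr s3 ''p'' 0 j = pos_part (\<omega> j) \<and> tarr s3 ''q'' 0 j = neg_part (\<omega> j)" if "j < n" for j
          using st(3) that by (simp add: s3 old holds_settled_def)
        fix s4 assume fr4: "frame [''j''] [] [''a'', ''b''] [''p'', ''q''] s3 s4"
          and pq4: "\<And>j. j < n \<Longrightarrow> tarr s4 ''p'' 0 j = pos_part (\<omega>' j) \<and> tarr s4 ''q'' 0 j = neg_part (\<omega>' j)"
        let ?s = "s4\<lparr>ivar := (ivar s4)(''r'' := Suc r)\<rparr>"
        have "holds_input m n A c x I ?s"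
          by (rule holds_input_frame[where X = "[''r'', ''j'']" and Y = "[]" and Z = "[''a'', ''b'']"
                and W = "[''p'', ''q'']", OF _ h3]) (use fr4 in \<open>simp_all add: frame_def\<close>)
        moreover have "card (insert k S) = Suc r"
          using st(2) k(3) finite_subset[OF S] by simp
        moreover have "holds_settled (insert k S) \<omega>' y' ?s"
        proof -
          have "iarr s4 ''done'' = (iarr s ''done'')(k := 1)" "iarr s4 ''rho'' = iarr s ''rho''"
            "tarr s4 ''y+'' = (tarr s ''y+'')(0 := (tarr s ''y+'' 0)(\<rho> k := pos_part (y' (\<rho> k))))"
            "tarr s4 ''y-'' = (tarr s ''y-'')(0 := (tarr s ''y-'' 0)(\<rho> k := neg_part (y' (\<rho> k))))"
            using fr4 by (simp_all add: frame_def s3 old)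
          then show ?thesis
            using st(3) pq4 by (simp add: holds_settled_def y'_def)
        qed
        moreover have "ivar s4 ''r'' = r" "ivar s4 ''n'' = n"
          using fr4 fr var by (simp_all add: frame_def s3 s1_def)
        ultimately show "?Post s4"
          using st' by (metis (no_types, lifting))
      qed (simp_all add: s3)
      then show "runs ?st s2 60 (\<lambda>s3. runs relax_loop s3 (n * 80) ?Post)"
        by - (rule runs_loop_free, simp_all add: s3_def quot_def)
    qed simp
    have "tvar s1 ''w'' = NegInf"
      by (simp add: s1_def)
    then have "runs (Seq select_loop (Seq ?st relax_loop)) s1 (n * 50 + (n * 80 + 60)) ?Post"
      by - (rule runs_Seq[OF runs_select_loop[OF h1 _ hs1 ex n order_refl *]], simp_all)
    then have "runs (TAssign ''w'' TNegInf) s 2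
        (\<lambda>s1. runs (Seq select_loop (Seq ?st relax_loop)) s1 (n * 50 + (n * 80 + 60)) ?Post)"
      by - (rule runs_loop_free, simp_all add: s1_def)
    then show "runs (Seq (TAssign ''w'' TNegInf) (Seq select_loop (Seq ?st relax_loop))) s (n * 192) ?Post"
      by (rule runs_Seq) (use n in linarith)
  next
    show "?Inv 0 (s\<lparr>ivar := (ivar s)(''r'' := 0)\<rparr>)"
    proof
      show "holds_input m n A c x I (s\<lparr>ivar := (ivar s)(''r'' := 0)\<rparr>)"
        using s(1) by (simp add: holds_input_def)
      have "holds_settled {} (\<lambda>j. of_trop (c j)) (\<lambda>i. SNegInf) (s\<lparr>ivar := (ivar s)(''r'' := 0)\<rparr>)"
        using s(2) by (simp add: holds_settled_def)
      then show "\<exists>S \<omega> y. settled S \<omega> y \<and> card S = 0 \<and>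
          holds_settled S \<omega> y (s\<lparr>ivar := (ivar s)(''r'' := 0)\<rparr>)"
        using settled_init card.empty by blast
    qed
    show "n * (n * 192 + 14) \<le> t"
      using n by (intro order_trans[OF mult_le_mono2 t]) linarith
    show "Q s" if inv: "?Inv n s" for s
    proof -
      obtain S \<omega> y where st: "settled S \<omega> y" "card S = n" "holds_settled S \<omega> y s"
        using inv by blast
      have "S = {..<n}"
        using st by (intro card_subset_eq) (auto simp: settled_def)
      then show ?thesis
        using st settled_full[of \<omega> y] Q[of y s] by (simp add: holds_output_def holds_settled_def)
    qed
  qed (use s n in \<open>simp_all add: holds_inputD\<close>)
qed

end

section \<open>Total running time and conclusion\<close>

lemma (in basic_setting) runs_reduced_costs_prog:
  assumes s: "holds_input m n A c x I s" and n: "1 \<le> n"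
  shows "runs reduced_costs_prog s (600 * (n * (m + n))) (\<lambda>s'. \<exists>\<rho> y.
    matched_rows m n A I x (row_value n A x) \<rho> \<and> is_reduced_costs m n A c I y \<and> holds_output m y s')"
    (is "runs _ _ _ ?Q")
proof -
  have m: "1 \<le> m"
    using n card_I I_sub card_mono[of "{..<m}" I] by simp
  have init: "runs init_columns s2 (n * 40) (\<lambda>s3. runs settle_phase s3 (n * (n * 210)) ?Q)"
    if h: "holds_input m n A c x I s1"
      and mr: "matched_rows m n A I x (row_value n A x) (iarr s1 ''rho'')"
      and fr: "frame [''i''] [] [] [''y+'', ''y-''] s1 s2"
      and y: "\<And>i. i < m \<Longrightarrow> tarr s2 ''y+'' 0 i = NegInf" "\<And>i. i < m \<Longrightarrow> tarr s2 ''y-'' 0 i = NegInf"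
    for s1 s2
  proof -
    interpret matched_rows m n A c I x "row_value n A x" "iarr s1 ''rho''"
      by (rule mr)
    have h2: "holds_input m n A c x I s2"
      by (rule holds_input_frame[OF fr h]) simp_all
    show ?thesis
    proof (rule runs_init_columns[OF h2 n order_refl])
      fix s3 assume fr3: "frame [''j''] [''done''] [] [''p'', ''q''] s2 s3"
        and cols: "\<And>j. j < n \<Longrightarrow> tarr s3 ''p'' 0 j = c j \<and> tarr s3 ''q'' 0 j = NegInf \<and> iarr s3 ''done'' j = 0"
      have h3: "holds_input m n A c x I s3"
        by (rule holds_input_frame[OF fr3 h2]) simp_all
      have "iarr s3 ''rho'' = iarr s1 ''rho''" "tarr s3 ''y+'' = tarr s2 ''y+''" "tarr s3 ''y-'' = tarr s2 ''y-''"
        using fr fr3 by (simp_all add: frame_def)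
      moreover have "pos_part (of_trop a) = a" "neg_part (of_trop a) = NegInf" for a
        by (cases a; simp)+
      ultimately have "holds_settled {} (\<lambda>j. of_trop (c j)) (\<lambda>i. SNegInf) s3"
        using cols y by (simp add: holds_settled_def)
      then show "runs settle_phase s3 (n * (n * 210)) ?Q"
        using mr by (intro runs_settle_phase[OF h3 _ n order_refl]) blast+
    qed
  qed
  have rest: "runs (Seq init_y (Seq init_columns settle_phase)) s1
      (m * 30 + (n * 40 + n * (n * 210))) ?Q"
    if h: "holds_input m n A c x I s1"
      and mr: "matched_rows m n A I x (row_value n A x) (iarr s1 ''rho'')" for s1
    by (rule runs_Seq[OF runs_init_y[OF holds_inputD(1)[OF h] m order_refl runs_Seq[OF init[OF h mr] order_refl]]])
      simp_all
  have "runs reduced_costs_prog s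
      (m * (n * 130) + (n * (m * 130) + (m * 30 + (n * 40 + n * (n * 210))))) ?Q"
    unfolding reduced_costs_prog_def
    by (rule runs_Seq[OF runs_row_phase[OF s n m order_refl
            runs_Seq[OF runs_match_phase[OF _ _ n m order_refl rest] order_refl]]]) simp_all
  \<comment> \<open>The linear terms are absorbed by \<open>m \<le> d\<close> and
    \<open>n \<le> e\<close>, which gives at most \<open>290 * d + 250 * e\<close>; the constant 600
    is generous.\<close>
  moreover have "m * (n * 130) + (n * (m * 130) + (m * 30 + (n * 40 + n * (n * 210)))) \<le> 600 * (n * (m + n))"
  proof -
    define d e where "d = n * m" and "e = n * n"
    have le: "m \<le> d" "n \<le> e"
      using n by (simp_all add: d_def e_def)
    have eq: "m * (n * 130) = 130 * d" "n * (m * 130) = 130 * d" "n * (n * 210) = 210 * e"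
      "600 * (n * (m + n)) = 600 * d + 600 * e"
      by (simp_all add: d_def e_def algebra_simps)
    show ?thesis
      unfolding eq using le by simp
  qed
  ultimately show ?thesis
    by (rule runs_mono)
qed

text \<open>The program and the constant are fixed before the dimensions. The case
  \<open>n = 0\<close> is set aside because the bound is 0 there, while every run takes
  time.\<close>

theorem theorem5p7:
  "\<exists>(prog :: com) (C :: nat). \<forall>(m :: nat) (n :: nat) (A :: strop matrix) (b :: nat \<Rightarrow> strop)
      (c :: nat \<Rightarrow> trop) (I :: nat set) (x :: nat \<Rightarrow> trop).
     1 \<le> n \<longrightarrow> standing_assumptions m n A b c \<longrightarrow> basic_point m n A b I x \<longrightarrow>
       (\<exists>!y. is_reduced_costs m n A c I y) \<and>
       (\<forall>s. holds_input m n A c x I s \<longrightarrow>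
          (\<exists>t s'. exec prog s t s' \<and> t \<le> C * (n * (m + n)) \<and>
             holds_output m (reduced_costs m n A c I) s'))"
proof (intro exI[of _ reduced_costs_prog] exI[of _ "600 :: nat"] allI impI)
  fix m n A b c I x
  assume n: "1 \<le> n" and standing: "standing_assumptions m n A b c" and basic: "basic_point m n A b I x"
  interpret basic_setting m n A b c I x
    by unfold_locales (rule standing basic)+
  have unique: "y = y'"
    if \<rho>: "matched_rows m n A I x (row_value n A x) \<rho>"
      and y: "is_reduced_costs m n A c I y" "is_reduced_costs m n A c I y'" for \<rho> y y'
  proof -
    interpret matched_rows m n A c I x "row_value n A x" \<rho>
      by (rule \<rho>)
    show ?thesis
      by (rule reduced_costs_unique[OF y]) (use sign_generic_Ac in \<open>simp add: hmat_def\<close>)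
  qed
  have run: "\<exists>t s' \<rho> y. exec reduced_costs_prog s t s' \<and> t \<le> 600 * (n * (m + n)) \<and>
      matched_rows m n A I x (row_value n A x) \<rho> \<and> is_reduced_costs m n A c I y \<and> holds_output m y s'"
    if "holds_input m n A c x I s" for s
    using runs_reduced_costs_prog[OF that n] unfolding runs_def by blast
  \<comment> \<open>A state holding the input, built in order to run the program once: this run
    provides a solution and a matching, and by uniqueness every other run outputs the same
    solution.\<close>
  define s0 where "s0 = \<lparr>ivar = (\<lambda>_. 0)(''m'' := m, ''n'' := n), iarr = (\<lambda>_ i. if i \<in> I then 1 else 0),
    tvar = (\<lambda>_. NegInf), tarr = (\<lambda>_ _ _. NegInf)(''A+'' := pos_mat A, ''A-'' := neg_mat A,
      ''c'' := (\<lambda>_. c), ''x'' := (\<lambda>_. x))\<rparr>"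
  have "holds_input m n A c x I s0"
    by (simp add: holds_input_def s0_def pos_mat_def neg_mat_def)
  then obtain \<rho> y where \<rho>: "matched_rows m n A I x (row_value n A x) \<rho>" and y: "is_reduced_costs m n A c I y"
    using run by blast
  have rc: "reduced_costs m n A c I = y"
    unfolding reduced_costs_def using y unique[OF \<rho>] by blast
  show "(\<exists>!y. is_reduced_costs m n A c I y) \<and>
      (\<forall>s. holds_input m n A c x I s \<longrightarrow>
         (\<exists>t s'. exec reduced_costs_prog s t s' \<and> t \<le> 600 * (n * (m + n)) \<and>
            holds_output m (reduced_costs m n A c I) s'))"
    unfolding rc using y unique[OF \<rho>] run by metis
qed

end
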